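(* Consider the CTMDP model described in the context and suppose Condition 1 holds. Let $\pi=(\pi_n)\in\Pi$ be a feasible policy with a finite value such that for each $n=0,1,\dots$, $\pi_{n+1}(da|x_0,\theta_1,\dots,x_n,s)=\delta_{\psi^\ast(x_n)}(da)$ whenever $x_n\in\zeta^c$. Let $\varphi_\pi$ be a stationary policy such that $\eta^\pi_\gamma(dx\times da)=\varphi_\pi(da|x)\eta^\pi_\gamma(dx\times A)$ on $\mathcal B(\zeta\times A)$ and $\varphi_\pi(da|x)=\delta_{\psi^\ast(x)}(da)$ for all $x\in\zeta^c$. Then for each $i=0,1,\dots,N$, $$E^{\varphi_\pi}_\gamma\Big[\int_0^\infty\int_A c_i(\xi_t,a)\varphi_\pi(da|\xi_t)dt\Big]\le E^\pi_\gamma\Big[\int_0^\infty\int_A c_i(\xi_t,a)\pi(da|\omega,t)dt\Big].$$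
   Context: CTMDP model. $S$ and $A$ are nonempty Borel spaces, $\gamma$ is a probability measure on $\mathcal B(S)$, and $q(dy|x,a)$ is a signed kernel on $\mathcal B(S)$ given $(x,a)\in S\times A$ such that $\tilde q(\Gamma|x,a):=q(\Gamma\setminus\{x\}|x,a)\ge0$ for all $\Gamma\in\mathcal B(S)$, $q(S|x,a)=0$, and, with $q_x(a):=-q(\{x\}|x,a)\ge0$, $\sup_{a\in A}q_x(a)<\infty$ for each $x\in S$. Conventions: $0/0:=0$, $0\cdot\infty:=0$, $c/0:=+\infty$ for $c>0$. Let $x_\infty\notin S$ be an isolated point. The sample space $\Omega$ consists of sequences $\omega=(x_0,\theta_1,x_1,\theta_2,\dots)$ with $x_n\in S$, $\theta_n\in(0,\infty)$, together with sequences $(x_0,\theta_1,\dots,\theta_n,x_n,\infty,x_\infty,\infty,x_\infty,\dots)$; $t_0:=0$, $t_n:=t_{n-1}+\theta_n$, $t_\infty:=\lim_n t_n$, $\xi_t:=\sum_{n\ge0}I\{t_n\le t<t_{n+1}\}x_n+I\{t_\infty\le t\}x_\infty$. A policy $\pi=(\pi_n)_{n\ge1}$ is a sequence of stochastic kernels $\pi_n(da|x_0,\theta_1,\dots,x_{n-1},s)$ on $A$ ($s>0$ is the time since the last jump), and $\pi(da|\omega,t):=\sum_{n\ge0}I\{t_n<t\le t_{n+1}\}\pi_{n+1}(da|x_0,\theta_1,\dots,x_n,t-t_n)$ for $t<t_\infty$ (after $t_\infty$ a dummy action at which all rates and costs vanish is used). A policy is Markov if $\pi_n$ depends only on $(x_{n-1},s)$,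 deterministic Markov if moreover each $\pi_n(\cdot|x,s)$ is a Dirac measure, and stationary if $\pi_n(da|x_0,\dots,x_{n-1},s)=\varphi(da|x_{n-1})$ for one stochastic kernel $\varphi$ (identified with the policy); a measurable map $g:S\to A$ is identified with the stationary policy $\delta_{g(x)}$. $\Pi$ is the set of all policies, $\Pi_{DM}$ the set of deterministic Markov policies. Under $\pi$, $P^\pi_\gamma$ is the unique probability on $\Omega$ such that $x_0\sim\gamma$, $P^\pi_\gamma(\theta_{n+1}\ge t|x_0,\theta_1,\dots,x_n)=\exp(-\int_0^t\int_A q_{x_n}(a)\pi_{n+1}(da|x_0,\dots,x_n,s)ds)$, and $P^\pi_\gamma(x_{n+1}\in\Gamma|x_0,\dots,x_n,\theta_{n+1})=\frac{\int_A\tilde q(\Gamma|x_n,a)\pi_{n+1}(da|x_0,\dots,x_n,\theta_{n+1})}{\int_A q_{x_n}(a)\pi_{n+1}(da|x_0,\dots,x_n,\theta_{n+1})}$ for $\Gamma\in\mathcal B(S)$, the remaining probability going to $x_\infty$; $E^\pi_\gamma$ is its expectation, and $P^\pi_x,E^\pi_x$ are used when $\gamma=\delta_x$. Costs: measurable $c_0,\dots,c_N:S\times A\to[0,\infty)$, with $c_i(x_\infty,\cdot):=0$; constants $d_1,\dots,d_N\in[0,\infty)$. Constrained problem: minimize $E^\pi_\gamma[\int_0^\infty\int_A c_0(\xi_t,a)\pi(da|\omega,t)dt]$ over $\pi\in\Pi$ subject to $E^\pi_\gamma[\int_0^\infty\int_A c_j(\xi_t,a)\pi(da|\omega,t)dt]\le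 d_j$, $j=1,\dots,N$. A policy is feasible if it satisfies the constraints, and feasible with a finite value if moreover its $c_0$-objective is finite. Condition 1: (a) $A$ is compact; (b) for each bounded continuous $f$ on $S$, $(x,a)\mapsto\int_S f(y)\tilde q(dy|x,a)/q_x(a)$ is continuous; (c) $(x,a)\mapsto q_x(a)$ is continuous; (d) each $c_i$ is lower semicontinuous on $S\times A$. Occupation measure: $\eta^\pi_\gamma(\Gamma_S\times\Gamma_A):=E^\pi_\gamma[\int_0^\infty I\{\xi_t\in\Gamma_S\}\pi(\Gamma_A|\omega,t)dt]$. Sets: $S_2:=\{x\in S:\inf_{a\in A}(q_x(a)+\sum_{i=0}^N c_i(x,a))=0\}$; $\zeta:=\{x\in S:\inf_{\pi\in\Pi_{DM}}E^\pi_x[\int_0^\infty\int_A\sum_{i=0}^Nc_i(\xi_t,a)\pi(da|\omega,t)dt]>0\}$ (a measurable set under Condition 1), $\zeta^c:=S\setminus\zeta$. $f^\ast:S\to A$ is a fixed measurable map with $\sum_{i=0}^Nc_i(x,f^\ast(x))+q_x(f^\ast(x))=0$ for all $x\in S_2$, and $\psi^\ast:S\to A$ is a fixed measurable map such that $E^{\psi^\ast}_x[\int_0^\infty\sum_{i=0}^Nc_i(\xi_t,\psi^\ast(\xi_t))dt]=0$ for all $x\in\zeta^c$ and $\psi^\ast=f^\ast$ on $S_2$ (such maps exist under Condition 1). *)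

theory Defs
  imports "HOL-Probability.Probability"
begin

text \<open>The post-jump state x_n is encoded as an element of 's option, where None stands for
  the cemetery x_infinity; sojourn times theta_n live in ennreal (value infinity allowed).
  A sample path omega is encoded as omega n = (x_n, theta_n) for n = 0,1,...,
  where theta_0 is a dummy coordinate fixed to 0.\<close>

definition Xopt :: "'s::topological_space set \<Rightarrow> 's option measure" where
  "Xopt S = sigma (insert None (Some ` S))
                  (insert {None} ((`) Some ` sets (restrict_space borel S)))"

definition OmegaM :: "'s::topological_space set \<Rightarrow> (nat \<Rightarrow> 's option \<times> ennreal) measure" where
  "OmegaM S = PiM UNIV (\<lambda>_::nat. Xopt S \<Otimes>\<^sub>M (borel :: ennreal measure))"

definition hist :: "nat \<Rightarrow> (nat \<Rightarrow> 's option \<times> ennreal) \<Rightarrow> (nat \<Rightarrow> 's option \<times> ennreal)" where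
  "hist n \<omega> = (\<lambda>k. if k \<le> n then \<omega> k else (None, 0))"

definition tt :: "(nat \<Rightarrow> 's option \<times> ennreal) \<Rightarrow> nat \<Rightarrow> ennreal" where
  "tt \<omega> n = (\<Sum>k\<in>{1..n}. snd (\<omega> k))"

definition xi :: "(nat \<Rightarrow> 's option \<times> ennreal) \<Rightarrow> real \<Rightarrow> 's option" where
  "xi \<omega> t = (if \<exists>n. tt \<omega> n \<le> ennreal t \<and> ennreal t < tt \<omega> (Suc n)
             then fst (\<omega> (THE n. tt \<omega> n \<le> ennreal t \<and> ennreal t < tt \<omega> (Suc n)))
             else None)"

text \<open>q x a \<Gamma> is the signed kernel q(\<Gamma>|x,a).\<close>
definition qx :: "('s \<Rightarrow> 'a \<Rightarrow> 's set \<Rightarrow> real) \<Rightarrow> 's \<Rightarrow> 'a \<Rightarrow> real" where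
  "qx q x a = - q x a {x}"

definition qt :: "('s \<Rightarrow> 'a \<Rightarrow> 's set \<Rightarrow> real) \<Rightarrow> 's \<Rightarrow> 'a \<Rightarrow> 's set \<Rightarrow> real" where
  "qt q x a \<Gamma> = q x a (\<Gamma> - {x})"

definition qt_meas :: "'s::topological_space set \<Rightarrow> ('s \<Rightarrow> 'a \<Rightarrow> 's set \<Rightarrow> real) \<Rightarrow> 's \<Rightarrow> 'a \<Rightarrow> 's measure" where
  "qt_meas S q x a = measure_of S (sets (restrict_space borel S)) (\<lambda>\<Gamma>. ennreal (qt q x a \<Gamma>))"

definition ctmdp_model ::
  "'s::topological_space set \<Rightarrow> 'a::topological_space set \<Rightarrow> ('s \<Rightarrow> 'a \<Rightarrow> 's set \<Rightarrow> real) \<Rightarrow> bool" where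
  "ctmdp_model S A q \<longleftrightarrow>
     (\<forall>x\<in>S. \<forall>a\<in>A. \<forall>F. range F \<subseteq> sets (restrict_space borel S) \<longrightarrow> disjoint_family F \<longrightarrow>
         (\<lambda>n. q x a (F n)) sums q x a (\<Union>n. F n)) \<and>
     (\<forall>\<Gamma>\<in>sets (restrict_space borel S).
         (\<lambda>(x,a). q x a \<Gamma>) \<in> borel_measurable (restrict_space borel S \<Otimes>\<^sub>M restrict_space borel A)) \<and>
     (\<forall>x\<in>S. \<forall>a\<in>A. \<forall>\<Gamma>\<in>sets (restrict_space borel S). qt q x a \<Gamma> \<ge> 0) \<and>
     (\<forall>x\<in>S. \<forall>a\<in>A. q x a S = 0) \<and>
     (\<forall>x\<in>S. bdd_above ((\<lambda>a. qx q x a) ` A))"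

text \<open>pol n h s is pi_{n+1}(da | x_0, theta_1, ..., x_n, s), evaluated at h = hist n omega.\<close>
type_synonym ('s,'a) policy = "nat \<Rightarrow> (nat \<Rightarrow> 's option \<times> ennreal) \<Rightarrow> real \<Rightarrow> 'a measure"

definition is_policy :: "'s::topological_space set \<Rightarrow> 'a::topological_space set \<Rightarrow> ('s,'a) policy \<Rightarrow> bool" where
  "is_policy S A pol \<longleftrightarrow>
     (\<forall>n. (\<lambda>(h,s). pol n h s) \<in> measurable (OmegaM S \<Otimes>\<^sub>M (borel :: real measure))
                                       (prob_algebra (restrict_space borel A)))"

definition det_markov :: "'s::topological_space set \<Rightarrow> 'a::topological_space set \<Rightarrow> ('s,'a) policy \<Rightarrow> bool" where
  "det_markov S A pol \<longleftrightarrow> is_policy S A pol \<and>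
     (\<forall>n. \<forall>h\<in>space (OmegaM S). \<forall>h'\<in>space (OmegaM S). \<forall>s>0.
        fst (h n) = fst (h' n) \<longrightarrow> pol n h s = pol n h' s) \<and>
     (\<forall>n. \<forall>h\<in>space (OmegaM S). \<forall>s>0. \<exists>a\<in>A. pol n h s = return (restrict_space borel A) a)"

definition stat_kernel :: "'s::topological_space set \<Rightarrow> 'a::topological_space set \<Rightarrow> ('s \<Rightarrow> 'a measure) \<Rightarrow> bool" where
  "stat_kernel S A \<phi> \<longleftrightarrow> \<phi> \<in> measurable (restrict_space borel S) (prob_algebra (restrict_space borel A))"

definition stat_pol :: "'s set \<Rightarrow> ('s \<Rightarrow> 'a measure) \<Rightarrow> ('s,'a) policy" where
  "stat_pol S \<phi> = (\<lambda>n h s. \<phi> (case fst (h n) of Some x \<Rightarrow> x | None \<Rightarrow> (SOME x. x \<in> S)))"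

text \<open>pi(da|omega,t) for t < t_infinity; a dummy measure afterwards (where all costs vanish).\<close>
definition pol_at :: "('s,'a) policy \<Rightarrow> (nat \<Rightarrow> 's option \<times> ennreal) \<Rightarrow> real \<Rightarrow> 'a measure" where
  "pol_at pol \<omega> t = (if \<exists>n. tt \<omega> n < ennreal t \<and> ennreal t \<le> tt \<omega> (Suc n)
      then (let n = (THE n. tt \<omega> n < ennreal t \<and> ennreal t \<le> tt \<omega> (Suc n))
            in pol n (hist n \<omega>) (t - enn2real (tt \<omega> n)))
      else count_space {})"

definition rate :: "('s \<Rightarrow> 'a \<Rightarrow> 's set \<Rightarrow> real) \<Rightarrow> ('s,'a) policy \<Rightarrow> nat
                     \<Rightarrow> (nat \<Rightarrow> 's option \<times> ennreal) \<Rightarrow> real \<Rightarrow> real" where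
  "rate q pol n \<omega> s = (case fst (\<omega> n) of None \<Rightarrow> 0
                        | Some x \<Rightarrow> \<integral>a. qx q x a \<partial>(pol n (hist n \<omega>) s))"

text \<open>P(x_{n+1} in Gamma | h_n, theta_{n+1} = \<theta>) for Gamma in B(S), with 0/0 = 0.\<close>
definition jump_prob :: "('s \<Rightarrow> 'a \<Rightarrow> 's set \<Rightarrow> real) \<Rightarrow> ('s,'a) policy \<Rightarrow> nat
                     \<Rightarrow> (nat \<Rightarrow> 's option \<times> ennreal) \<Rightarrow> ennreal \<Rightarrow> 's set \<Rightarrow> real" where
  "jump_prob q pol n \<omega> \<theta> \<Gamma> = (case fst (\<omega> n) of None \<Rightarrow> 0
      | Some x \<Rightarrow> if \<theta> = \<infinity> then 0 else
          (\<integral>a. qt q x a \<Gamma> \<partial>(pol n (hist n \<omega>) (enn2real \<theta>))) /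
          (\<integral>a. qx q x a \<partial>(pol n (hist n \<omega>) (enn2real \<theta>))))"

definition is_strat :: "'s::topological_space set \<Rightarrow> ('s \<Rightarrow> 'a \<Rightarrow> 's set \<Rightarrow> real) \<Rightarrow> ('s,'a) policy
                        \<Rightarrow> 's measure \<Rightarrow> (nat \<Rightarrow> 's option \<times> ennreal) measure \<Rightarrow> bool" where
  "is_strat S q pol \<gamma> P \<longleftrightarrow>
     sets P = sets (OmegaM S) \<and> prob_space P \<and>
     distr P (Xopt S \<Otimes>\<^sub>M borel) (\<lambda>\<omega>. \<omega> 0) = distr \<gamma> (Xopt S \<Otimes>\<^sub>M borel) (\<lambda>x. (Some x, 0)) \<and>
     (\<forall>n t g. 0 \<le> t \<longrightarrow> g \<in> borel_measurable (OmegaM S) \<longrightarrow>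
        (\<integral>\<^sup>+\<omega>. g (hist n \<omega>) * indicator {\<omega>. ennreal t \<le> snd (\<omega> (Suc n))} \<omega> \<partial>P)
        = (\<integral>\<^sup>+\<omega>. g (hist n \<omega>) *
              ennreal (exp (- (LINT s:{0..t}|lborel. rate q pol n \<omega> s))) \<partial>P)) \<and>
     (\<forall>n \<Gamma> g. \<Gamma> \<in> sets (restrict_space borel S) \<longrightarrow> g \<in> borel_measurable (OmegaM S \<Otimes>\<^sub>M borel) \<longrightarrow>
        (\<integral>\<^sup>+\<omega>. g (hist n \<omega>, snd (\<omega> (Suc n))) *
              indicator {\<omega>. fst (\<omega> (Suc n)) \<in> Some ` \<Gamma>} \<omega> \<partial>P)
        = (\<integral>\<^sup>+\<omega>. g (hist n \<omega>, snd (\<omega> (Suc n))) *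
              ennreal (jump_prob q pol n \<omega> (snd (\<omega> (Suc n))) \<Gamma>) \<partial>P)) \<and>
     (\<forall>n g. g \<in> borel_measurable (OmegaM S \<Otimes>\<^sub>M borel) \<longrightarrow>
        (\<integral>\<^sup>+\<omega>. g (hist n \<omega>, snd (\<omega> (Suc n))) *
              indicator {\<omega>. fst (\<omega> (Suc n)) = None} \<omega> \<partial>P)
        = (\<integral>\<^sup>+\<omega>. g (hist n \<omega>, snd (\<omega> (Suc n))) *
              ennreal (1 - jump_prob q pol n \<omega> (snd (\<omega> (Suc n))) S) \<partial>P))"

definition Pstrat :: "'s::topological_space set \<Rightarrow> ('s \<Rightarrow> 'a \<Rightarrow> 's set \<Rightarrow> real) \<Rightarrow> ('s,'a) policy
                        \<Rightarrow> 's measure \<Rightarrow> (nat \<Rightarrow> 's option \<times> ennreal) measure" where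
  "Pstrat S q pol \<gamma> = (THE P. is_strat S q pol \<gamma> P)"

definition cost_ext :: "('s \<Rightarrow> 'a \<Rightarrow> real) \<Rightarrow> 's option \<Rightarrow> 'a \<Rightarrow> real" where
  "cost_ext c x a = (case x of None \<Rightarrow> 0 | Some y \<Rightarrow> c y a)"

definition Ecost :: "'s::topological_space set \<Rightarrow> ('s \<Rightarrow> 'a \<Rightarrow> 's set \<Rightarrow> real) \<Rightarrow> ('s,'a) policy
                        \<Rightarrow> 's measure \<Rightarrow> ('s \<Rightarrow> 'a \<Rightarrow> real) \<Rightarrow> ennreal" where
  "Ecost S q pol \<gamma> c =
     (\<integral>\<^sup>+\<omega>. (\<integral>\<^sup>+t\<in>{0..}. (\<integral>\<^sup>+a. ennreal (cost_ext c (xi \<omega> t) a) \<partial>(pol_at pol \<omega> t)) \<partial>lborel)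
        \<partial>(Pstrat S q pol \<gamma>))"

definition occ :: "'s::topological_space set \<Rightarrow> ('s \<Rightarrow> 'a \<Rightarrow> 's set \<Rightarrow> real) \<Rightarrow> ('s,'a) policy
                        \<Rightarrow> 's measure \<Rightarrow> ('s \<times> 'a) set \<Rightarrow> ennreal" where
  "occ S q pol \<gamma> \<Gamma> = Ecost S q pol \<gamma> (\<lambda>x a. indicator \<Gamma> (x, a))"

definition occ_marg :: "'s::topological_space set \<Rightarrow> 'a set \<Rightarrow> ('s \<Rightarrow> 'a \<Rightarrow> 's set \<Rightarrow> real) \<Rightarrow> ('s,'a) policy
                        \<Rightarrow> 's measure \<Rightarrow> 's measure" where
  "occ_marg S A q pol \<gamma> = measure_of S (sets (restrict_space borel S)) (\<lambda>B. occ S q pol \<gamma> (B \<times> A))"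

definition lsc_on :: "('b::topological_space) set \<Rightarrow> ('b \<Rightarrow> real) \<Rightarrow> bool" where
  "lsc_on X f \<longleftrightarrow> (\<forall>r. openin (top_of_set X) {p\<in>X. f p > r})"

definition condition1 :: "'s::topological_space set \<Rightarrow> 'a::topological_space set
     \<Rightarrow> ('s \<Rightarrow> 'a \<Rightarrow> 's set \<Rightarrow> real) \<Rightarrow> (nat \<Rightarrow> 's \<Rightarrow> 'a \<Rightarrow> real) \<Rightarrow> nat \<Rightarrow> bool" where
  "condition1 S A q c N \<longleftrightarrow>
     compact A \<and>
     (\<forall>f::'s \<Rightarrow> real. continuous_on S f \<and> bounded (f ` S) \<longrightarrow>
        continuous_on (S \<times> A) (\<lambda>(x,a). (\<integral>y. f y \<partial>(qt_meas S q x a)) / qx q x a)) \<and>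
     continuous_on (S \<times> A) (\<lambda>(x,a). qx q x a) \<and>
     (\<forall>i\<le>N. lsc_on (S \<times> A) (\<lambda>(x,a). c i x a))"

definition S2 :: "'s set \<Rightarrow> 'a set \<Rightarrow> ('s \<Rightarrow> 'a \<Rightarrow> 's set \<Rightarrow> real) \<Rightarrow> (nat \<Rightarrow> 's \<Rightarrow> 'a \<Rightarrow> real) \<Rightarrow> nat \<Rightarrow> 's set" where
  "S2 S A q c N = {x\<in>S. (INF a\<in>A. qx q x a + (\<Sum>i\<le>N. c i x a)) = 0}"

definition zeta :: "'s::topological_space set \<Rightarrow> 'a::topological_space set
     \<Rightarrow> ('s \<Rightarrow> 'a \<Rightarrow> 's set \<Rightarrow> real) \<Rightarrow> (nat \<Rightarrow> 's \<Rightarrow> 'a \<Rightarrow> real) \<Rightarrow> nat \<Rightarrow> 's set" where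
  "zeta S A q c N = {x\<in>S. (INF pol\<in>{pol. det_markov S A pol}.
        Ecost S q pol (return (restrict_space borel S) x) (\<lambda>y a. \<Sum>i\<le>N. c i y a)) > 0}"

end

theory Submission
  imports Defs
begin

text \<open>
  Write \<open>x\<^sub>n\<close> for the embedded states and \<open>m f = (\<Sum>n. E (f x\<^sub>n))\<close> for the expected visits under the given
  policy. For every policy, \<open>m f\<close> equals \<open>\<gamma> f\<close> plus the integral of the jump rate into \<open>f\<close> against the
  occupation measure. A state \<open>x\<close> of \<open>zeta\<close> lies outside \<open>S2\<close>, so rate plus total cost is bounded
  below there by some \<open>\<delta> x > 0\<close>; as the costs are finite, such a state is a.s. left in finite time,
  and hence \<open>m f \<le> \<integral> f(x) q\<^sub>x(a) \<eta>(dx, da)\<close> for \<open>f\<close> vanishing off \<open>zeta\<close>. Disintegrating \<open>\<eta>\<close> along \<open>\<phi>\<close>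
  turns these two facts into \<open>m f \<ge> \<gamma> f + m (p f)\<close>, where \<open>p\<close> is the embedded chain of the stationary
  policy, for which the complement of \<open>zeta\<close> is closed and free of cost. Iterating, the expected
  visits to \<open>zeta\<close> under the stationary policy are at most \<open>m\<close>, and its cost, which is the expected
  number of visits weighted by the mean cost per sojourn, is at most the \<open>zeta\<close>-part of the cost of
  the original policy.

  To evaluate \<^const>\<open>Pstrat\<close> one needs existence and uniqueness of the strategic measure: uniqueness follows
  from the \<open>\<pi>\<close>-\<open>\<lambda>\<close> theorem applied to one step at a time, existence from the Ionescu-Tulcea theorem.
\<close>

section \<open>Measures from positive functionals\<close>

text \<open>Two kinds of infinity shape the argument. The transition rates are bounded only state by
  state, and the occupation measure as well as \<open>m\<close> may be infinite, so kernels are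
  subprobabilities only after normalisation and no finite total mass can be used. Laws and
  occupation measures are therefore given as monotonically continuous functionals of nonnegative
  functions, then turned into measures. The comparison uses only sums and suprema; \<open>m\<close>
  is never subtracted. The restriction to \<open>zeta\<close> is forced: where rate and cost both
  vanish, the process may stay forever. Such a stay counts as a visit in \<open>m\<close> but yields
  no outflow, so visits cannot be recovered from the occupation measure there. In the extended reals
  \<open>inverse 0 = top\<close> and \<open>0 * top = 0\<close>. With these conventions the formulas
  for the stationary policy also hold at absorbing states.\<close>

definition integral_functional :: "'a measure \<Rightarrow> (('a \<Rightarrow> ennreal) \<Rightarrow> ennreal) \<Rightarrow> bool" where
  "integral_functional M \<Phi> \<longleftrightarrow>
     (\<forall>f\<in>borel_measurable M. \<forall>g. (\<forall>x\<in>space M. f x = g x) \<longrightarrow> \<Phi> f = \<Phi> g) \<and>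
     (\<forall>f\<in>borel_measurable M. \<forall>r. \<Phi> (\<lambda>x. r * f x) = r * \<Phi> f) \<and>
     (\<forall>f\<in>borel_measurable M. \<forall>g\<in>borel_measurable M. \<Phi> (\<lambda>x. f x + g x) = \<Phi> f + \<Phi> g) \<and>
     (\<forall>F. (\<forall>i::nat. F i \<in> borel_measurable M) \<longrightarrow> incseq F \<longrightarrow>
        \<Phi> (\<lambda>x. SUP i. F i x) = (SUP i. \<Phi> (F i)) \<and> incseq (\<lambda>i. \<Phi> (F i)))"

lemma integral_functionalI:
  assumes "\<And>f g. f \<in> borel_measurable M \<Longrightarrow> (\<And>x. x \<in> space M \<Longrightarrow> f x = g x) \<Longrightarrow> \<Phi> f = \<Phi> g"
    and "\<And>f r. f \<in> borel_measurable M \<Longrightarrow> \<Phi> (\<lambda>x. r * f x) = r * \<Phi> f"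
    and "\<And>f g. f \<in> borel_measurable M \<Longrightarrow> g \<in> borel_measurable M \<Longrightarrow>
           \<Phi> (\<lambda>x. f x + g x) = \<Phi> f + \<Phi> g"
    and "\<And>F :: nat \<Rightarrow> _. (\<And>i. F i \<in> borel_measurable M) \<Longrightarrow> incseq F \<Longrightarrow>
           \<Phi> (\<lambda>x. SUP i. F i x) = (SUP i. \<Phi> (F i))"
    and "\<And>F :: nat \<Rightarrow> _. (\<And>i. F i \<in> borel_measurable M) \<Longrightarrow> incseq F \<Longrightarrow> incseq (\<lambda>i. \<Phi> (F i))"
  shows "integral_functional M \<Phi>"
  unfolding integral_functional_def using assms by blast

lemma integral_functionalD:
  assumes "integral_functional M \<Phi>"
  shows integral_functional_cong:
      "f \<in> borel_measurable M \<Longrightarrow> (\<And>x. x \<in> space M \<Longrightarrow> f x = g x) \<Longrightarrow> \<Phi> f = \<Phi> g"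
    and integral_functional_cmult:
      "f \<in> borel_measurable M \<Longrightarrow> \<Phi> (\<lambda>x. r * f x) = r * \<Phi> f"
    and integral_functional_add:
      "f \<in> borel_measurable M \<Longrightarrow> g \<in> borel_measurable M \<Longrightarrow> \<Phi> (\<lambda>x. f x + g x) = \<Phi> f + \<Phi> g"
    and integral_functional_SUP:
      "(\<And>i::nat. F i \<in> borel_measurable M) \<Longrightarrow> incseq F \<Longrightarrow>
         \<Phi> (\<lambda>x. SUP i. F i x) = (SUP i. \<Phi> (F i))"
    and integral_functional_incseq:
      "(\<And>i::nat. F i \<in> borel_measurable M) \<Longrightarrow> incseq F \<Longrightarrow> incseq (\<lambda>i. \<Phi> (F i))"
  using assms unfolding integral_functional_def by blast+

lemma integral_functional_eval:
  "x \<in> space M \<Longrightarrow> integral_functional M (\<lambda>f. f x)"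
  by (rule integral_functionalI) (auto simp: incseq_def le_fun_def)

lemma integral_functional_zero: "integral_functional M (\<lambda>f. 0)"
  by (rule integral_functionalI) auto

lemma integral_functional_plus:
  assumes "integral_functional M \<Phi>" "integral_functional M \<Psi>"
  shows "integral_functional M (\<lambda>f. \<Phi> f + \<Psi> f)"
proof (rule integral_functionalI)
  fix F :: "nat \<Rightarrow> _ \<Rightarrow> ennreal" assume F: "\<And>i. F i \<in> borel_measurable M" "incseq F"
  have "incseq (\<lambda>i. \<Phi> (F i))" "incseq (\<lambda>i. \<Psi> (F i))"
    using integral_functional_incseq[OF assms(1) F] integral_functional_incseq[OF assms(2) F] by auto
  then show "\<Phi> (\<lambda>x. SUP i. F i x) + \<Psi> (\<lambda>x. SUP i. F i x) = (SUP i. \<Phi> (F i) + \<Psi> (F i))"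
    by (simp add: integral_functional_SUP[OF assms(1) F] integral_functional_SUP[OF assms(2) F]
        ennreal_SUP_add)
  show "incseq (\<lambda>i. \<Phi> (F i) + \<Psi> (F i))"
    using \<open>incseq (\<lambda>i. \<Phi> (F i))\<close> \<open>incseq (\<lambda>i. \<Psi> (F i))\<close> by (auto simp: incseq_def intro: add_mono)
next
  fix f g :: "_ \<Rightarrow> ennreal" assume "f \<in> borel_measurable M" "\<And>x. x \<in> space M \<Longrightarrow> f x = g x"
  then show "\<Phi> f + \<Psi> f = \<Phi> g + \<Psi> g"
    using integral_functional_cong[OF assms(1), of f g] integral_functional_cong[OF assms(2), of f g]
    by auto
qed (simp_all add: integral_functional_cmult[OF assms(1)] integral_functional_cmult[OF assms(2)]
    integral_functional_add[OF assms(1)] integral_functional_add[OF assms(2)] distrib_left ac_simps)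

lemma integral_functional_scale:
  assumes "integral_functional M \<Phi>"
  shows "integral_functional M (\<lambda>f. c * \<Phi> f)"
proof (rule integral_functionalI)
  fix f g :: "_ \<Rightarrow> ennreal" assume "f \<in> borel_measurable M" "\<And>x. x \<in> space M \<Longrightarrow> f x = g x"
  then show "c * \<Phi> f = c * \<Phi> g"
    using integral_functional_cong[OF assms, of f g] by auto
next
  fix F :: "nat \<Rightarrow> _ \<Rightarrow> ennreal" assume F: "\<And>i. F i \<in> borel_measurable M" "incseq F"
  show "c * \<Phi> (\<lambda>x. SUP i. F i x) = (SUP i. c * \<Phi> (F i))"
    by (simp add: integral_functional_SUP[OF assms F] SUP_mult_left_ennreal)
  show "incseq (\<lambda>i. c * \<Phi> (F i))"
    using integral_functional_incseq[OF assms F] by (auto simp: incseq_def intro: mult_left_mono)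
qed (simp_all add: integral_functional_cmult[OF assms]
    integral_functional_add[OF assms] distrib_left ac_simps)

lemma integral_functional_if:
  assumes "b \<Longrightarrow> integral_functional M \<Phi>" "\<not> b \<Longrightarrow> integral_functional M \<Psi>"
  shows "integral_functional M (\<lambda>f. if b then \<Phi> f else \<Psi> f)"
  using assms by (cases b) auto

text \<open>Mixtures of functionals are functionals by monotone convergence under the outer
  integral. The integrals over time, actions and paths, and the sum over the jump number, are all
  instances.\<close>

lemma integral_functional_nn_integral:
  assumes "\<And>z. z \<in> space N \<Longrightarrow> integral_functional M (\<Phi> z)"
    and "\<And>f. f \<in> borel_measurable M \<Longrightarrow> (\<lambda>z. \<Phi> z f) \<in> borel_measurable N"
  shows "integral_functional M (\<lambda>f. \<integral>\<^sup>+z. \<Phi> z f \<partial>N)"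
proof (rule integral_functionalI)
  fix f g :: "_ \<Rightarrow> ennreal" assume f: "f \<in> borel_measurable M" "\<And>x. x \<in> space M \<Longrightarrow> f x = g x"
  show "(\<integral>\<^sup>+z. \<Phi> z f \<partial>N) = (\<integral>\<^sup>+z. \<Phi> z g \<partial>N)"
    by (intro nn_integral_cong integral_functional_cong[OF assms(1)] f)
next
  fix f :: "_ \<Rightarrow> ennreal" and r assume f: "f \<in> borel_measurable M"
  have "(\<integral>\<^sup>+z. \<Phi> z (\<lambda>x. r * f x) \<partial>N) = (\<integral>\<^sup>+z. r * \<Phi> z f \<partial>N)"
    by (intro nn_integral_cong integral_functional_cmult[OF assms(1)] f)
  also have "\<dots> = r * (\<integral>\<^sup>+z. \<Phi> z f \<partial>N)"
    by (intro nn_integral_cmult assms f)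
  finally show "(\<integral>\<^sup>+z. \<Phi> z (\<lambda>x. r * f x) \<partial>N) = r * (\<integral>\<^sup>+z. \<Phi> z f \<partial>N)" .
next
  fix f g :: "_ \<Rightarrow> ennreal" assume f: "f \<in> borel_measurable M" "g \<in> borel_measurable M"
  have "(\<integral>\<^sup>+z. \<Phi> z (\<lambda>x. f x + g x) \<partial>N) = (\<integral>\<^sup>+z. \<Phi> z f + \<Phi> z g \<partial>N)"
    by (intro nn_integral_cong integral_functional_add[OF assms(1)] f)
  also have "\<dots> = (\<integral>\<^sup>+z. \<Phi> z f \<partial>N) + (\<integral>\<^sup>+z. \<Phi> z g \<partial>N)"
    by (intro nn_integral_add assms f)
  finally show "(\<integral>\<^sup>+z. \<Phi> z (\<lambda>x. f x + g x) \<partial>N) = (\<integral>\<^sup>+z. \<Phi> z f \<partial>N) + (\<integral>\<^sup>+z. \<Phi> z g \<partial>N)" .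
next
  fix F :: "nat \<Rightarrow> _ \<Rightarrow> ennreal" assume F: "\<And>i. F i \<in> borel_measurable M" "incseq F"
  have mono: "\<Phi> z (F i) \<le> \<Phi> z (F j)" if "z \<in> space N" "i \<le> j" for z i j
    using integral_functional_incseq[OF assms(1) F] that by (auto simp: incseq_def)
  then show "incseq (\<lambda>i. \<integral>\<^sup>+z. \<Phi> z (F i) \<partial>N)"
    by (auto simp: incseq_def intro!: nn_integral_mono)
  have "(\<integral>\<^sup>+z. \<Phi> z (\<lambda>x. SUP i. F i x) \<partial>N) = (\<integral>\<^sup>+z. (SUP i. \<Phi> z (F i)) \<partial>N)"
    by (intro nn_integral_cong integral_functional_SUP[OF assms(1)] F)
  also have "\<dots> = (SUP i. (\<integral>\<^sup>+z. \<Phi> z (F i) \<partial>N))"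
    by (intro nn_integral_monotone_convergence_SUP_AE AE_I2 mono assms F) auto
  finally show "(\<integral>\<^sup>+z. \<Phi> z (\<lambda>x. SUP i. F i x) \<partial>N) = (SUP i. (\<integral>\<^sup>+z. \<Phi> z (F i) \<partial>N))" .
qed

lemma integral_functional_suminf:
  assumes "\<And>n. integral_functional M (\<Phi> n)"
  shows "integral_functional M (\<lambda>f. \<Sum>n. \<Phi> n f)"
  using integral_functional_nn_integral[of "count_space UNIV" M \<Phi>] assms
  by (simp add: nn_integral_count_space_nat)

lemma integral_functional_comp:
  assumes "integral_functional N \<Phi>" and T: "T \<in> measurable N M"
  shows "integral_functional M (\<lambda>f. \<Phi> (\<lambda>y. f (T y)))"
proof -
  have [simp]: "(\<lambda>y. f (T y)) \<in> borel_measurable N" if "f \<in> borel_measurable M" for f :: "_ \<Rightarrow> ennreal"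
    using measurable_compose[OF T that] .
  have inc: "incseq (\<lambda>i y. F i (T y))" if "incseq F" for F :: "nat \<Rightarrow> _ \<Rightarrow> ennreal"
    using that by (auto simp: incseq_def le_fun_def)
  show ?thesis
  proof (rule integral_functionalI)
    fix f g :: "_ \<Rightarrow> ennreal" assume "f \<in> borel_measurable M" "\<And>x. x \<in> space M \<Longrightarrow> f x = g x"
    then show "\<Phi> (\<lambda>y. f (T y)) = \<Phi> (\<lambda>y. g (T y))"
      using measurable_space[OF T] by (intro integral_functional_cong[OF assms(1)]) auto
  next
    fix F :: "nat \<Rightarrow> _ \<Rightarrow> ennreal" assume F: "\<And>i. F i \<in> borel_measurable M" "incseq F"
    show "\<Phi> (\<lambda>y. SUP i. F i (T y)) = (SUP i. \<Phi> (\<lambda>y. F i (T y)))"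
      by (rule integral_functional_SUP[OF assms(1), of "\<lambda>i y. F i (T y)"]) (auto simp: F inc)
    show "incseq (\<lambda>i. \<Phi> (\<lambda>y. F i (T y)))"
      by (rule integral_functional_incseq[OF assms(1), of "\<lambda>i y. F i (T y)"]) (auto simp: F inc)
  qed (simp_all add: integral_functional_cmult[OF assms(1)] integral_functional_add[OF assms(1)])
qed

lemma integral_functional_integral:
  "sets N = sets M \<Longrightarrow> integral_functional M (\<lambda>f. \<integral>\<^sup>+x. f x \<partial>N)"
proof -
  assume sets: "sets N = sets M"
  then have "space N = space M" by (rule sets_eq_imp_space_eq)
  with sets show "integral_functional M (\<lambda>f. \<integral>\<^sup>+x. f x \<partial>N)"
    by (intro integral_functional_nn_integral integral_functional_eval)
      (auto cong: measurable_cong_sets)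
qed

text \<open>A representation of Daniell type: the measure is read off from the values on indicators.
  It replaces compositions of kernels, which would ask for subprobability kernels.\<close>

definition functional_measure :: "'a measure \<Rightarrow> (('a \<Rightarrow> ennreal) \<Rightarrow> ennreal) \<Rightarrow> 'a measure" where
  "functional_measure M \<Phi> = measure_of (space M) (sets M) (\<lambda>B. \<Phi> (indicator B))"

lemma sets_functional_measure[simp, measurable_cong]: "sets (functional_measure M \<Phi>) = sets M"
  and space_functional_measure[simp]: "space (functional_measure M \<Phi>) = space M"
  by (simp_all add: functional_measure_def)

lemma emeasure_functional_measure:
  assumes \<Phi>: "integral_functional M \<Phi>" and B: "B \<in> sets M"
  shows "emeasure (functional_measure M \<Phi>) B = \<Phi> (indicator B)"
  unfolding functional_measure_def
proof (rule emeasure_measure_of_sigma)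
  show "sigma_algebra (space M) (sets M)" ..
  have 0: "\<Phi> (\<lambda>x. 0) = 0"
    using integral_functional_cmult[OF \<Phi>, of "\<lambda>x. 0" 0] by simp
  then show "positive (sets M) (\<lambda>B. \<Phi> (indicator B))"
    by (simp add: positive_def indicator_def[abs_def])
  show "countably_additive (sets M) (\<lambda>B. \<Phi> (indicator B))"
  proof (rule countably_additiveI)
    fix B :: "nat \<Rightarrow> _" assume B: "range B \<subseteq> sets M" "disjoint_family B" "\<Union> (range B) \<in> sets M"
    then have [measurable]: "\<And>i. B i \<in> sets M" by auto
    have fin: "\<Phi> (\<lambda>x. \<Sum>i<n. indicator (B i) x) = (\<Sum>i<n. \<Phi> (indicator (B i)))" for n
    proof (induction n)
      case (Suc n)
      have "\<Phi> (\<lambda>x. (\<Sum>i<n. indicator (B i) x) + indicator (B n) x)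
          = \<Phi> (\<lambda>x. \<Sum>i<n. indicator (B i) x) + \<Phi> (indicator (B n))"
        by (rule integral_functional_add[OF \<Phi>]) auto
      then show ?case using Suc by simp
    qed (simp add: 0)
    have "\<Phi> (indicator (\<Union> (range B))) = \<Phi> (\<lambda>x. SUP n. \<Sum>i<n. indicator (B i) x)"
      using B by (intro arg_cong[where f=\<Phi>]) (auto simp: suminf_indicator suminf_eq_SUP[symmetric])
    also have "\<dots> = (SUP n. \<Phi> (\<lambda>x. \<Sum>i<n. indicator (B i) x))"
      by (rule integral_functional_SUP[OF \<Phi>])
        (auto simp: incseq_def le_fun_def intro!: sum_mono2)
    also have "\<dots> = (\<Sum>i. \<Phi> (indicator (B i)))"
      by (simp add: fin suminf_eq_SUP)
    finally show "(\<Sum>i. \<Phi> (indicator (B i))) = \<Phi> (indicator (\<Union> (range B)))" ..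
  qed
qed (rule B)

lemma nn_integral_functional_measure:
  assumes \<Phi>: "integral_functional M \<Phi>" and f: "f \<in> borel_measurable M"
  shows "(\<integral>\<^sup>+x. f x \<partial>functional_measure M \<Phi>) = \<Phi> f"
  using f
proof (induction rule: borel_measurable_induct)
  case (cong f g)
  then show ?case
    using integral_functional_cong[OF \<Phi>, of f g] nn_integral_cong[of "functional_measure M \<Phi>" f g] by auto
next
  case (set A)
  then show ?case by (simp add: emeasure_functional_measure[OF \<Phi>])
next
  case (mult u c)
  then show ?case
    by (subst nn_integral_cmult) (auto simp: integral_functional_cmult[OF \<Phi>])
next
  case (add u v)
  then show ?case
    by (subst nn_integral_add) (auto simp: integral_functional_add[OF \<Phi>])
next
  case (seq U)
  have eq: "Sup (range U) = (\<lambda>x. SUP i. U i x)" by (auto simp: fun_eq_iff image_image)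
  have "(\<integral>\<^sup>+x. (SUP i. U i x) \<partial>functional_measure M \<Phi>) = (SUP i. \<integral>\<^sup>+x. U i x \<partial>functional_measure M \<Phi>)"
    by (rule nn_integral_monotone_convergence_SUP) (use seq in auto)
  then show ?case
    unfolding eq using seq integral_functional_SUP[OF \<Phi>, of U] by simp
qed

text \<open>The \<pi>-\<lambda> theorem for rectangles whose second side runs through a generator
  only. This is the shape of the tail clause in \<open>is_strat\<close>, which tests arbitrary
  events of the history but only rays of the sojourn time.\<close>

lemma pair_measure_eqI_finite:
  assumes fin: "finite_measure P"
    and P: "sets P = sets (M \<Otimes>\<^sub>M N)" and Q: "sets Q = sets (M \<Otimes>\<^sub>M N)"
    and G: "Int_stable G" "G \<subseteq> Pow (space N)" "sets N = sigma_sets (space N) G" "space N \<in> G"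
    and eq: "\<And>H B. H \<in> sets M \<Longrightarrow> B \<in> G \<Longrightarrow> emeasure P (H \<times> B) = emeasure Q (H \<times> B)"
  shows "P = Q"
proof (rule measure_eqI_generator_eq)
  let ?E = "{H \<times> B | H B. H \<in> sets M \<and> B \<in> G}"
  show "Int_stable ?E"
  proof (rule Int_stableI)
    fix a b assume "a \<in> ?E" "b \<in> ?E"
    then obtain H B H' B' where "a = H \<times> B" "b = H' \<times> B'" "H \<in> sets M" "H' \<in> sets M" "B \<in> G" "B' \<in> G"
      by auto
    then show "a \<inter> b \<in> ?E"
      using G(1) by (auto simp: Times_Int_Times Int_stable_def intro!: exI[of _ "H \<inter> H'"] exI[of _ "B \<inter> B'"])
  qed
  show "?E \<subseteq> Pow (space M \<times> space N)" using G(2) sets.sets_into_space by fastforce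
  have "sets (M \<Otimes>\<^sub>M N) = sets (sigma (space M \<times> space N) ?E)"
    by (rule sets_pair_eq[where Ca="{space M}" and Cb="{space N}"])
      (use G sets.space_closed[of M] in \<open>auto simp: sets.sigma_sets_eq\<close>)
  also have "\<dots> = sigma_sets (space M \<times> space N) ?E"
    using \<open>?E \<subseteq> Pow (space M \<times> space N)\<close> by simp
  finally show "sets P = sigma_sets (space M \<times> space N) ?E" "sets Q = sigma_sets (space M \<times> space N) ?E"
    using P Q by simp_all
  show "range (\<lambda>i::nat. space M \<times> space N) \<subseteq> ?E" using G(4) by auto
  show "emeasure P (space M \<times> space N) \<noteq> \<infinity>" for i :: nat
    using fin by (simp add: finite_measure.emeasure_finite)
qed (use eq in auto)

text \<open>Rays with a finite left end suffice, as in the tail clause of \<open>is_strat\<close>,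
  where \<open>t\<close> is real. An open ray from a finite point is a countable union of them, and
  the open ray from infinity is empty.\<close>

lemma sets_borel_ennreal_atLeast:
  "sets (borel :: ennreal measure) = sigma_sets UNIV ((\<lambda>t. {ennreal t..}) ` {0..})"
proof -
  let ?G = "(\<lambda>t. {ennreal t..}) ` {0..}"
  have "borel = sigma UNIV ?G"
  proof (rule borel_eq_sigmaI1[OF borel_Ioi])
    fix B :: "ennreal set" assume "B \<in> range greaterThan"
    then obtain x where B: "B = {x<..}" by auto
    show "B \<in> sets (sigma UNIV ?G)"
    proof (cases x)
      case (real r)
      have "{x<..} = (\<Union>n. {ennreal (r + 1 / real (Suc n))..})"
      proof (intro set_eqI iffI)
        fix y assume y: "y \<in> {x<..}"
        show "y \<in> (\<Union>n. {ennreal (r + 1 / real (Suc n))..})"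
        proof (cases y)
          case (real u)
          then have "0 < u - r" using y \<open>x = ennreal r\<close> \<open>0 \<le> r\<close> by (simp add: ennreal_less_iff)
          then obtain n where "1 / real (Suc n) < u - r" using nat_approx_posE by blast
          then show ?thesis using real \<open>0 \<le> r\<close> by (auto intro!: exI[of _ n] ennreal_leI simp del: ennreal_plus)
        qed auto
      next
        fix y assume "y \<in> (\<Union>n. {ennreal (r + 1 / real (Suc n))..})"
        then obtain n where "ennreal (r + 1 / real (Suc n)) \<le> y" by auto
        moreover have "x < ennreal (r + 1 / real (Suc n))"
          using real by (simp add: ennreal_less_iff)
        ultimately show "y \<in> {x<..}" by auto
      qed
      also have "\<dots> \<in> sets (sigma UNIV ?G)"
      proof (rule sets.countable_UN)
        show "range (\<lambda>n. {ennreal (r + 1 / real (Suc n))..}) \<subseteq> sets (sigma UNIV ?G)"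
          using \<open>0 \<le> r\<close> by (auto intro!: sigma_sets.Basic simp del: ennreal_plus)
      qed
      finally show ?thesis unfolding B .
    next
      case top
      then have "B = {}" by (auto simp: B)
      then show ?thesis by (metis sets.empty_sets)
    qed
  qed auto
  then have "sets (borel :: ennreal measure) = sets (sigma UNIV ?G)" by simp
  then show ?thesis by simp
qed

lemma Int_stable_ennreal_atLeast: "Int_stable ((\<lambda>t. {ennreal t..}) ` {0..})"
proof (rule Int_stableI)
  fix a b assume "a \<in> ((\<lambda>t. {ennreal t..}) ` {0..})" "b \<in> ((\<lambda>t. {ennreal t..}) ` {0..})"
  then obtain t u where tu: "a = {ennreal t..}" "b = {ennreal u..}" "0 \<le> t" "0 \<le> u" by auto
  show "a \<inter> b \<in> (\<lambda>t. {ennreal t..}) ` {0..}"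
  proof (cases "t \<le> u")
    case True
    then have "b \<subseteq> a" by (simp add: tu(1,2) ennreal_leI)
    then show ?thesis using tu by (auto simp: Int_absorb1)
  next
    case False
    then have "a \<subseteq> b" by (simp add: tu(1,2) ennreal_leI)
    then show ?thesis using tu by (auto simp: Int_absorb2)
  qed
qed

text \<open>The limit is specified through its marginals \<open>CI\<close>. For an initial segment
  \<open>{0..<n}\<close> the marginal is the iterated kernel \<open>C 0 n\<close> itself, since
  \<open>up_to\<close> returns exactly \<open>n\<close>.\<close>

lemma (in Ionescu_Tulcea) nn_integral_lim_restrict:
  assumes f[measurable]: "f \<in> borel_measurable (PiM {0..<n} M)"
  shows "(\<integral>\<^sup>+\<omega>. f (restrict \<omega> {0..<n}) \<partial>PF.lim) = (\<integral>\<^sup>+w. f w \<partial>C 0 n (\<lambda>_. undefined))"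
proof -
  have [simp]: "(\<lambda>_. undefined) \<in> space (PiM {0..<0} M)" by (simp add: space_PiM)
  have up: "up_to {0..<n} = n"
  proof (rule antisym)
    show "n \<le> up_to {0..<n}" using up_to_less[of "{0..<n}" "up_to {0..<n}"] by (cases "up_to {0..<n} < n") auto
  qed (simp add: up_to_iff)
  have "(\<integral>\<^sup>+\<omega>. f (restrict \<omega> {0..<n}) \<partial>PF.lim) = (\<integral>\<^sup>+w. f w \<partial>distr PF.lim (PiM {0..<n} M) (\<lambda>x. restrict x {0..<n}))"
    by (subst nn_integral_distr)
      (auto intro!: measurable_restrict simp: measurable_cong_sets[OF PF.sets_lim refl])
  also have "\<dots> = (\<integral>\<^sup>+w. f w \<partial>CI {0..<n})" by (simp add: distr_lim)
  also have "\<dots> = (\<integral>\<^sup>+w. f (restrict w {0..<n}) \<partial>C 0 n (\<lambda>_. undefined))"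
    unfolding CI_def up
    by (subst nn_integral_distr)
      (auto intro!: measurable_restrict simp: measurable_cong_sets[OF sets_C refl])
  also have "\<dots> = (\<integral>\<^sup>+w. f w \<partial>C 0 n (\<lambda>_. undefined))"
    by (intro nn_integral_cong) (simp add: space_C space_PiM)
  finally show ?thesis .
qed

text \<open>The recursion of \<open>C 0 n\<close> read back on the limit measure: the last
  coordinate is integrated out with the kernel \<open>P n\<close>. This is how the transition
  kernels become visible in the strategic measure.\<close>

lemma (in Ionescu_Tulcea) nn_integral_lim_step:
  assumes f[measurable]: "f \<in> borel_measurable (PiM {0..<Suc n} M)"
  shows "(\<integral>\<^sup>+\<omega>. f (restrict \<omega> {0..<Suc n}) \<partial>PF.lim)
    = (\<integral>\<^sup>+\<omega>. (\<integral>\<^sup>+y. f ((restrict \<omega> {0..<n})(n := y)) \<partial>P n (restrict \<omega> {0..<n})) \<partial>PF.lim)"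
proof -
  have [simp]: "(\<lambda>_. undefined) \<in> space (PiM {0..<0} M)" by (simp add: space_PiM)
  have u: "(\<lambda>(w, y). f (w(n := y))) \<in> borel_measurable (PiM {0..<n} M \<Otimes>\<^sub>M M n)"
    using measurable_compose[OF measurable_add_dim f[unfolded atLeast0_lessThan_Suc]]
    by (simp add: split_beta')
  have g: "(\<lambda>w. \<integral>\<^sup>+y. f (w(n := y)) \<partial>P n w) \<in> borel_measurable (PiM {0..<n} M)"
    by (rule nn_integral_measurable_subprob_algebra2[OF u P])
  have "(\<integral>\<^sup>+\<omega>. f (restrict \<omega> {0..<Suc n}) \<partial>PF.lim) = (\<integral>\<^sup>+w. f w \<partial>(C 0 n (\<lambda>_. undefined) \<bind> eP n))"
    by (simp add: nn_integral_lim_restrict)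
  also have "\<dots> = (\<integral>\<^sup>+w. (\<integral>\<^sup>+w'. f w' \<partial>eP n w) \<partial>C 0 n (\<lambda>_. undefined))"
    by (rule nn_integral_bind[OF f]) (simp add: measurable_cong_sets[OF sets_C refl])
  also have "\<dots> = (\<integral>\<^sup>+w. (\<integral>\<^sup>+y. f (w(n := y)) \<partial>P n w) \<partial>C 0 n (\<lambda>_. undefined))"
    by (intro nn_integral_cong nn_integral_eP f) (simp add: space_C)
  also have "\<dots> = (\<integral>\<^sup>+\<omega>. (\<integral>\<^sup>+y. f ((restrict \<omega> {0..<n})(n := y)) \<partial>P n (restrict \<omega> {0..<n})) \<partial>PF.lim)"
    by (rule nn_integral_lim_restrict[OF g, symmetric])
  finally show ?thesis .
qed

section \<open>Integrals with exponential weights\<close>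

lemma set_integrable_Icc_bounded:
  fixes f :: "real \<Rightarrow> real"
  assumes [measurable]: "f \<in> borel_measurable borel" and f: "\<And>s. \<bar>f s\<bar> \<le> C"
  shows "set_integrable lborel {a..b} f"
  unfolding set_integrable_def
proof (rule Bochner_Integration.integrable_bound)
  show "integrable lborel (\<lambda>s. C * indicator {a..b} s)"
    by (intro integrable_mult_right integrable_real_indicator) (auto simp: emeasure_lborel_Icc_eq)
  show "AE s in lborel. norm (indicator {a..b} s *\<^sub>R f s) \<le> norm (C * indicator {a..b} s)"
    using f order_trans[OF f abs_ge_self] by (intro AE_I2) (auto split: split_indicator)
qed simp

text \<open>The variable upper limit is moved into the integrand, where joint measurability
  applies.\<close>

lemma borel_measurable_set_integral_upto:
  fixes f :: "'a \<Rightarrow> real \<Rightarrow> real"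
  assumes [measurable]: "case_prod f \<in> borel_measurable (M \<Otimes>\<^sub>M borel)" "g \<in> borel_measurable M"
  shows "(\<lambda>x. LINT u:{0..g x}|lborel. f x u) \<in> borel_measurable M"
proof -
  have "(\<lambda>x. \<integral>u. (if 0 \<le> u \<and> u \<le> g x then f x u else 0) \<partial>lborel) \<in> borel_measurable M"
    by measurable
  moreover have "(LINT u:{0..g x}|lborel. f x u) = (\<integral>u. (if 0 \<le> u \<and> u \<le> g x then f x u else 0) \<partial>lborel)" for x
    unfolding set_lebesgue_integral_def
    by (intro Bochner_Integration.integral_cong) (auto simp: indicator_def)
  ultimately show ?thesis by (simp cong: measurable_cong)
qed

lemma rate_exp_bound:
  fixes r :: "real \<Rightarrow> real"
  assumes r: "\<And>s. 0 \<le> r s" "\<And>s. r s \<le> C"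
  shows "\<bar>r s * exp (- (LINT u:{0..s}|lborel. r u))\<bar> \<le> C"
proof -
  have "0 \<le> (LINT u:{0..s}|lborel. r u)"
    unfolding set_lebesgue_integral_def using r by (intro Bochner_Integration.integral_nonneg) (auto simp: indicator_def)
  then have "r s * exp (- (LINT u:{0..s}|lborel. r u)) \<le> r s"
    using r(1)[of s] by (intro mult_left_le) auto
  then show ?thesis using r[of s] by (simp add: abs_mult)
qed

text \<open>The two sides have the same increments up to a quadratic error, hence their difference has
  derivative 0; this avoids differentiating the integral of a merely measurable rate.\<close>

lemma set_integral_rate_exp:
  fixes r :: "real \<Rightarrow> real"
  assumes [measurable]: "r \<in> borel_measurable borel"
    and r: "\<And>s. 0 \<le> r s" "\<And>s. r s \<le> C" and t: "0 \<le> t"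
  shows "(LINT s:{0..t}|lborel. r s * exp (- (LINT u:{0..s}|lborel. r u)))
       = 1 - exp (- (LINT u:{0..t}|lborel. r u))"
proof -
  define R where "R t = (LINT u:{0..t}|lborel. r u)" for t
  define F where "F t = (LINT s:{0..t}|lborel. r s * exp (- R s))" for t
  have C: "0 \<le> C" using r order_trans by blast
  have [measurable]: "R \<in> borel_measurable borel"
    unfolding R_def by (rule borel_measurable_set_integral_upto) measurable
  have int: "set_integrable lborel {a..b} r" for a b
    by (rule set_integrable_Icc_bounded[of _ C]) (use r in auto)
  have R0: "0 \<le> R t" for t
    unfolding R_def set_lebesgue_integral_def using r by (intro Bochner_Integration.integral_nonneg) (auto simp: indicator_def)
  have intF: "set_integrable lborel {a..b} (\<lambda>s. r s * exp (- R s))" for a b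
    by (rule set_integrable_Icc_bounded[of _ C]) (use rate_exp_bound[of r, OF r] in \<open>auto simp: R_def[symmetric]\<close>)
  have split: "(LINT s:{0..b}|lborel. f s) = (LINT s:{0..a}|lborel. f s) + (LINT s:{a..b}|lborel. f s)"
    if "0 \<le> a" "a \<le> b" "\<And>a b. set_integrable lborel {a..b} f" for a b and f :: "real \<Rightarrow> real"
  proof -
    have "{0..b} = {0..a} \<union> {a..b}" using that by auto
    moreover have "(LINT s:{0..a} \<union> {a..b}|lborel. f s) = (LINT s:{0..a}|lborel. f s) + (LINT s:{a..b}|lborel. f s)"
    proof (rule set_integral_Un_AE)
      show "AE x in lborel. \<not> (x \<in> {0..a} \<and> x \<in> {a..b})"
        using AE_lborel_singleton[of a] by eventually_elim auto
    qed (use that in auto)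
    ultimately show ?thesis by simp
  qed
  have bd: "0 \<le> (LINT s:{a..b}|lborel. r s)" "(LINT s:{a..b}|lborel. r s) \<le> C * (b - a)" if "a \<le> b" for a b
  proof -
    show "0 \<le> (LINT s:{a..b}|lborel. r s)"
      unfolding set_lebesgue_integral_def using r by (intro Bochner_Integration.integral_nonneg) (auto simp: indicator_def)
    have "(LINT s:{a..b}|lborel. r s) \<le> (LINT s:{a..b}|lborel. C)"
      by (intro set_integral_mono int) (auto simp: r intro: set_integrable_Icc_bounded[of _ C] simp: C)
    then show "(LINT s:{a..b}|lborel. r s) \<le> C * (b - a)"
      using that by (simp add: set_lebesgue_integral_def ac_simps)
  qed
  have Rmono: "R a \<le> R b" "R b - R a \<le> C * (b - a)" if "0 \<le> a" "a \<le> b" for a b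
    using split[OF that int] bd[OF that(2)] by (auto simp: R_def)
  have inc: "\<bar>(F b + exp (- R b)) - (F a + exp (- R a))\<bar> \<le> C\<^sup>2 * (b - a)\<^sup>2" if ab: "0 \<le> a" "a \<le> b" for a b
  proof -
    define d where "d = R b - R a"
    have d: "0 \<le> d" "d \<le> C * (b - a)" using Rmono[OF ab] by (auto simp: d_def)
    have Fd: "F b - F a = (LINT s:{a..b}|lborel. r s * exp (- R s))"
      unfolding F_def using split[OF ab intF] by simp
    have Rd: "d = (LINT s:{a..b}|lborel. r s)"
      unfolding d_def R_def using split[OF ab int] by simp
    have up: "F b - F a \<le> exp (- R a) * d"
    proof -
      have "F b - F a \<le> (LINT s:{a..b}|lborel. exp (- R a) * r s)"
        unfolding Fd using ab r Rmono(1)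
        by (intro set_integral_mono intF set_integrable_mult_right int)
          (auto simp: mult.commute intro!: mult_left_mono)
      then show ?thesis by (simp add: Rd)
    qed
    have lo: "exp (- R b) * d \<le> F b - F a"
    proof -
      have "(LINT s:{a..b}|lborel. exp (- R b) * r s) \<le> F b - F a"
        unfolding Fd using ab r Rmono(1)
        by (intro set_integral_mono intF set_integrable_mult_right int)
          (auto simp: mult.commute intro!: mult_left_mono)
      then show ?thesis by (simp add: Rd)
    qed
    have e: "exp (- R b) = exp (- R a) * exp (- d)" by (simp add: d_def exp_add[symmetric])
    have 1: "exp (- R a) * d \<le> exp (- R a) - exp (- R b) + d\<^sup>2"
    proof -
      \<comment> \<open>The product of \<open>1 - d + d\<^sup>2\<close> and \<open>1 + d\<close> is
        \<open>1 + d^3\<close>, hence at least 1, and \<open>1 + d\<close> is at most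
        \<open>exp d\<close>.\<close>
      have "exp (-d) \<le> 1 - d + d\<^sup>2"
      proof -
        have "1 \<le> (1 - d + d\<^sup>2) * (1 + d)"
          using d(1) by (simp add: power2_eq_square algebra_simps)
        also have "\<dots> \<le> (1 - d + d\<^sup>2) * exp d"
        proof (rule mult_left_mono)
          have "0 \<le> (1 - d)\<^sup>2 + 1 + d\<^sup>2" by simp
          then show "0 \<le> 1 - d + d\<^sup>2" by (simp add: power2_eq_square algebra_simps)
        qed simp
        finally show ?thesis by (simp add: exp_minus field_simps)
      qed
      then have "exp (- R a) * (d - 1 + exp (- d)) \<le> 1 * d\<^sup>2"
        using R0[of a] exp_ge_add_one_self[of "- d"] by (intro mult_mono) auto
      then show ?thesis by (simp add: e algebra_simps)
    qed
    have 2: "exp (- R a) - exp (- R b) - d\<^sup>2 \<le> exp (- R b) * d"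
    proof -
      have "exp (- R a) - exp (- R b) = exp (- R a) * (1 - exp (- d))" by (simp add: e algebra_simps)
      also have "1 - exp (- d) \<le> exp (- d) * d + d\<^sup>2"
      proof -
        have "1 - exp (- d) \<le> d" using exp_ge_add_one_self[of "-d"] by simp
        have "d * (1 - exp (-d)) \<le> d * d" using \<open>1 - exp (- d) \<le> d\<close> d(1) by (rule mult_left_mono)
        with \<open>1 - exp (- d) \<le> d\<close> show ?thesis by (simp add: power2_eq_square algebra_simps)
      qed
      then have "exp (- R a) * (1 - exp (- d)) \<le> exp (- R a) * (exp (- d) * d + d\<^sup>2)"
        by (intro mult_left_mono) auto
      also have "\<dots> \<le> exp (- R b) * d + d\<^sup>2"
        using R0[of a] by (auto simp: e algebra_simps intro!: mult_left_le_one_le)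
      finally show ?thesis by simp
    qed
    have "\<bar>(F b + exp (- R b)) - (F a + exp (- R a))\<bar> \<le> d\<^sup>2"
      using 1 2 up lo by (auto simp: abs_le_iff)
    also have "\<dots> \<le> (C * (b - a))\<^sup>2" using d by (intro power_mono)
    finally show ?thesis by (simp add: power_mult_distrib)
  qed
  \<comment> \<open>\<open>G\<close> is continued to the negative axis by its value at 0, because
    the constancy theorem used below asks for a vanishing derivative on the whole line.\<close>
  define G where "G t = F (max 0 t) + exp (- R (max 0 t))" for t
  have incG: "\<bar>G b - G a\<bar> \<le> C\<^sup>2 * (b - a)\<^sup>2" for a b
  proof -
    have *: "\<bar>G b - G a\<bar> \<le> C\<^sup>2 * (b - a)\<^sup>2" if "a \<le> b" for a b
    proof -
      have "\<bar>G b - G a\<bar> \<le> C\<^sup>2 * (max 0 b - max 0 a)\<^sup>2"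
        unfolding G_def using that by (intro inc) auto
      also have "\<dots> \<le> C\<^sup>2 * (b - a)\<^sup>2"
        using that by (intro mult_left_mono power_mono) auto
      finally show ?thesis .
    qed
    show ?thesis
    proof (cases "a \<le> b")
      case False
      then show ?thesis using *[of b a] by (simp add: abs_minus_commute power2_commute)
    qed (rule *)
  qed
  have "(G has_real_derivative 0) (at x)" for x
    unfolding has_field_derivative_iff
  proof (rule LIM_I)
    fix e :: real assume e: "0 < e"
    \<comment> \<open>By \<open>incG\<close> the difference quotient is at most
      \<open>C\<^sup>2\<close> times the distance, which dictates the radius; the added 1 keeps the
      radius defined when \<open>C\<close> is 0.\<close>
    show "\<exists>s>0. \<forall>h. h \<noteq> x \<and> norm (h - x) < s \<longrightarrow> norm ((G h - G x) / (h - x) - 0) < e"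
    proof (intro exI[of _ "e / (C\<^sup>2 + 1)"] conjI allI impI)
      have C2: "0 < C\<^sup>2 + 1" by (simp add: add_nonneg_pos)
      then show "0 < e / (C\<^sup>2 + 1)" using e by simp
      fix h assume h: "h \<noteq> x \<and> norm (h - x) < e / (C\<^sup>2 + 1)"
      then have pos: "0 < \<bar>h - x\<bar>" by simp
      have "\<bar>G h - G x\<bar> \<le> (C\<^sup>2 * \<bar>h - x\<bar>) * \<bar>h - x\<bar>" using incG[of h x] by (simp add: power2_eq_square)
      then have "\<bar>G h - G x\<bar> / \<bar>h - x\<bar> \<le> C\<^sup>2 * \<bar>h - x\<bar>" using pos by (simp add: divide_le_eq)
      also have "\<dots> \<le> (C\<^sup>2 + 1) * \<bar>h - x\<bar>" by (intro mult_right_mono) auto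
      also have "\<dots> < e" using h C2 by (simp add: pos_less_divide_eq mult.commute)
      finally show "norm ((G h - G x) / (h - x) - 0) < e" by (simp add: abs_divide)
    qed
  qed
  then have "G t = G 0" by (intro DERIV_isconst_all) auto
  moreover have "{0..0::real} = {0}" by auto
  ultimately have "F t + exp (- R t) = F 0 + exp (- R 0)" using t by (simp add: G_def)
  moreover have "(LINT s:{0}|lborel. f s) = 0" for f :: "real \<Rightarrow> real"
    unfolding set_lebesgue_integral_def
    by (rule integral_eq_zero_AE, use AE_lborel_singleton[of 0] in eventually_elim) auto
  then have "F 0 = 0" "R 0 = 0" by (simp_all add: F_def R_def \<open>{0..0::real} = {0}\<close>)
  ultimately show ?thesis by (simp add: F_def R_def)
qed

text \<open>Rate times survival is the density of a sojourn time, so the left side is the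
  probability of a jump by time \<open>t\<close>. The point 0 is excluded because sojourn times are
  positive; it is a null set.\<close>

lemma nn_integral_rate_exp:
  fixes r :: "real \<Rightarrow> real"
  assumes [measurable]: "r \<in> borel_measurable borel"
    and r: "\<And>s. 0 \<le> r s" "\<And>s. r s \<le> C" and t: "0 \<le> t"
  shows "(\<integral>\<^sup>+s. indicator {0<..t} s * ennreal (exp (- (LINT u:{0..s}|lborel. r u))) * ennreal (r s) \<partial>lborel)
       = ennreal (1 - exp (- (LINT u:{0..t}|lborel. r u)))"
proof -
  define R where "R t = (LINT u:{0..t}|lborel. r u)" for t
  have [measurable]: "R \<in> borel_measurable borel"
    unfolding R_def by (rule borel_measurable_set_integral_upto) measurable
  have "(\<integral>\<^sup>+s. indicator {0<..t} s * ennreal (exp (- R s)) * ennreal (r s) \<partial>lborel)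
      = (\<integral>\<^sup>+s. ennreal (indicator {0..t} s *\<^sub>R (r s * exp (- R s))) \<partial>lborel)"
    by (rule nn_integral_cong_AE, use AE_lborel_singleton[of 0] in eventually_elim)
      (use r in \<open>auto simp: indicator_def ennreal_mult'' mult.commute\<close>)
  also have "\<dots> = ennreal (\<integral>s. indicator {0..t} s *\<^sub>R (r s * exp (- R s)) \<partial>lborel)"
  proof (rule nn_integral_eq_integral)
    show "integrable lborel (\<lambda>s. indicator {0..t} s *\<^sub>R (r s * exp (- R s)))"
      using set_integrable_Icc_bounded[of "\<lambda>s. r s * exp (- R s)" C 0 t] rate_exp_bound[of r, OF r]
      by (simp add: set_integrable_def R_def[symmetric])
  qed (use r in \<open>auto simp: indicator_def\<close>)
  also have "(\<integral>s. indicator {0..t} s *\<^sub>R (r s * exp (- R s)) \<partial>lborel) = 1 - exp (- R t)"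
    using set_integral_rate_exp[OF assms] unfolding set_lebesgue_integral_def R_def by simp
  finally show ?thesis unfolding R_def .
qed

lemma emeasure_lborel_greaterThan_zero: "emeasure lborel {0::real<..} = \<infinity>"
proof -
  have "of_nat n \<le> emeasure lborel {0::real<..}" for n
  proof -
    have "{0<..real n} \<subseteq> {0<..}" by auto
    then show ?thesis
      using emeasure_mono[of "{0<..real n}" "{0<..}" lborel] by (simp add: ennreal_of_nat_eq_real_of_nat)
  qed
  then have "(SUP n. of_nat n) \<le> emeasure lborel {0::real<..}" by (rule SUP_least)
  then show ?thesis by (simp add: ennreal_SUP_of_nat_eq_top top_unique)
qed

text \<open>The mean of an exponential sojourn; with \<open>inverse 0 = top\<close> it covers a
  state that is never left.\<close>

lemma nn_integral_exp_decay:
  assumes "0 \<le> r"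
  shows "(\<integral>\<^sup>+s. indicator {0<..} s * ennreal (exp (- (r * s))) \<partial>lborel) = inverse (ennreal r)"
proof (cases "r = 0")
  case True
  then show ?thesis by (simp add: emeasure_lborel_greaterThan_zero)
next
  case False
  then have r: "0 < r" using assms by simp
  have "(\<integral>\<^sup>+s. indicator {0<..} s * ennreal (exp (- (r * s))) \<partial>lborel) = (\<integral>\<^sup>+s. ennreal (exp (- (r * s))) * indicator {0..} s \<partial>lborel)"
    by (rule nn_integral_cong_AE, use AE_lborel_singleton[of 0] in eventually_elim)
      (auto simp: indicator_def)
  also have "\<dots> = ennreal (0 - (- exp (- (r * 0)) / r))"
  proof (rule nn_integral_FTC_atLeast)
    show "((\<lambda>s. - exp (- (r * s)) / r) has_real_derivative exp (- (r * s))) (at s)" for s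
      using r by (auto intro!: derivative_eq_intros)
    have "((\<lambda>s. exp (- (r * s))) \<longlongrightarrow> 0) at_top"
      using r by (intro filterlim_compose[OF exp_at_bot] filterlim_compose[OF filterlim_uminus_at_bot_at_top]
          filterlim_tendsto_pos_mult_at_top[OF tendsto_const]) (auto simp: filterlim_ident)
    then show "((\<lambda>s. - exp (- (r * s)) / r) \<longlongrightarrow> 0) at_top"
      using tendsto_divide[OF tendsto_minus tendsto_const[of r]] r by fastforce
  qed auto
  finally show ?thesis using r by (simp add: inverse_ennreal inverse_eq_divide)
qed

text \<open>An inequality only, since the product is 0 at \<open>r = 0\<close> and at
  \<open>r = top\<close>. The first case is that of an absorbing state, which has no
  outflow.\<close>

lemma ennreal_mult_inverse_le_one: "(r::ennreal) * inverse r \<le> 1"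
  by (cases "r = 0 \<or> r = top") (auto simp: less_top ennreal_divide_self divide_ennreal_def[symmetric])

text \<open>Supplies joint measurability of the exit rate from its continuity: \<open>qx\<close>
  evaluates the kernel at the moving set \<open>{x}\<close>, while the model speaks of fixed sets.
  Second countability identifies the product of the Borel algebras with the Borel algebra of the
  product.\<close>

lemma continuous_on_measurable_restrict_pair:
  fixes f :: "'s::second_countable_topology \<times> 'a::second_countable_topology \<Rightarrow> real"
  assumes "continuous_on (S \<times> A) f"
  shows "f \<in> borel_measurable (restrict_space borel S \<Otimes>\<^sub>M restrict_space borel A)"
proof -
  let ?M = "restrict_space borel S \<Otimes>\<^sub>M restrict_space borel A"
  have [measurable]: "(\<lambda>x. x) \<in> measurable (restrict_space borel S) borel" "(\<lambda>a. a) \<in> measurable (restrict_space borel A) borel"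
    by (auto intro: measurable_restrict_space1)
  have "(\<lambda>z. (fst z, snd z)) \<in> measurable ?M (borel \<Otimes>\<^sub>M borel)"
    by (intro measurable_Pair measurable_compose[OF measurable_fst] measurable_compose[OF measurable_snd]) measurable
  then have "(\<lambda>z. z) \<in> measurable ?M (restrict_space borel (S \<times> A))"
    by (intro measurable_restrict_space2) (auto simp: borel_prod space_pair_measure space_restrict_space)
  from measurable_compose[OF this borel_measurable_continuous_on_restrict[OF assms]]
  show ?thesis .
qed

section \<open>The controlled rate kernel\<close>

text \<open>The value at \<open>None\<close> is the default built into \<open>stat_pol\<close>, so
  that stationary policies factor through \<open>pick\<close>. Being total, it is a measurable map
  into the state space.\<close>

definition pick :: "'s set \<Rightarrow> 's option \<Rightarrow> 's" where
  "pick S y = (case y of Some x \<Rightarrow> x | None \<Rightarrow> (SOME x. x \<in> S))"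

lemma pick_Some[simp]: "pick S (Some x) = x"
  by (simp add: pick_def)

lemma Xopt_generator_subset:
  "insert {None} ((`) Some ` sets (restrict_space borel S)) \<subseteq> Pow (insert None (Some ` S))"
  using sets.sets_into_space[of _ "restrict_space borel S"] by (fastforce simp: space_restrict_space)

lemma space_Xopt[simp]: "space (Xopt S) = insert None (Some ` S)"
  unfolding Xopt_def using Xopt_generator_subset by (rule space_measure_of)

lemma sets_Xopt:
  "sets (Xopt S) = sigma_sets (insert None (Some ` S)) (insert {None} ((`) Some ` sets (restrict_space borel S)))"
  unfolding Xopt_def using Xopt_generator_subset by (rule sets_measure_of)

lemma sets_Xopt_None[measurable]: "{None} \<in> sets (Xopt S)"
  by (auto simp: sets_Xopt)

lemma sets_Xopt_Some[measurable]: "\<Gamma> \<in> sets (restrict_space borel S) \<Longrightarrow> Some ` \<Gamma> \<in> sets (Xopt S)"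
  by (auto simp: sets_Xopt)

lemma measurable_Some_Xopt[measurable]: "Some \<in> measurable (restrict_space borel S) (Xopt S)"
proof -
  have "Some -` Some ` B = B" "Some -` {None} = ({} :: 'a set)" for B :: "'a set" by auto
  moreover have "B \<inter> S = B" if "B \<in> sets (restrict_space borel S)" for B
    using sets.sets_into_space[OF that] by (auto simp: space_restrict_space)
  ultimately show ?thesis
    unfolding Xopt_def
    by (intro measurable_measure_of Xopt_generator_subset) (auto simp: space_restrict_space)
qed

lemma measurable_pick[measurable]:
  assumes "S \<noteq> {}"
  shows "pick S \<in> measurable (Xopt S) (restrict_space borel S)"
proof (rule measurableI)
  have S: "(SOME x. x \<in> S) \<in> S" using assms by (simp add: some_in_eq)
  show "pick S x \<in> space (restrict_space borel S)" if "x \<in> space (Xopt S)" for x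
    using that S by (auto simp: space_restrict_space pick_def)
  fix B assume B: "B \<in> sets (restrict_space borel S)"
  then have "B \<subseteq> S" using sets.sets_into_space by (force simp: space_restrict_space)
  have "pick S -` B \<inter> space (Xopt S) = Some ` B \<union> (if (SOME x. x \<in> S) \<in> B then {None} else {})"
    using \<open>B \<subseteq> S\<close> by (auto simp: pick_def)
  also have "\<dots> \<in> sets (Xopt S)" using B by (intro sets.Un) auto
  finally show "pick S -` B \<inter> space (Xopt S) \<in> sets (Xopt S)" .
qed

lemma pred_is_None[measurable]: "Measurable.pred (Xopt S) (\<lambda>y. y = None)"
  using sets_Xopt_None[of S] by (simp add: pred_def Collect_conv_if)

text \<open>An event is a Borel set of states, with or without the cemetery. Hence the two jump
  clauses of \<open>is_strat\<close>, one for states and one for the cemetery, determine the law of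
  the next state.\<close>

lemma sets_Xopt_decompose:
  assumes "B \<in> sets (Xopt S)"
  shows "B = (B \<inter> {None}) \<union> Some ` (Some -` B \<inter> S)" "Some -` B \<inter> S \<in> sets (restrict_space borel S)"
proof -
  have "B \<subseteq> insert None (Some ` S)" using sets.sets_into_space[OF assms] by simp
  then show "B = (B \<inter> {None}) \<union> Some ` (Some -` B \<inter> S)" by auto
  show "Some -` B \<inter> S \<in> sets (restrict_space borel S)"
    using measurable_sets[OF measurable_Some_Xopt assms] by (simp add: space_restrict_space)
qed

lemma measurable_OmegaM_nth[measurable (raw)]:
  assumes "f \<in> measurable M (OmegaM S)"
  shows "(\<lambda>x. f x n) \<in> measurable M (Xopt S \<Otimes>\<^sub>M borel)"
  using measurable_compose[OF assms, of "\<lambda>\<omega>. \<omega> n"] unfolding OmegaM_def by simp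

lemma space_OmegaM: "\<omega> \<in> space (OmegaM S) \<longleftrightarrow> (\<forall>n. fst (\<omega> n) \<in> insert None (Some ` S))"
  by (auto simp: OmegaM_def space_PiM space_pair_measure PiE_iff mem_Times_iff)

lemma space_OmegaM_SomeD: "\<omega> \<in> space (OmegaM S) \<Longrightarrow> fst (\<omega> n) = Some x \<Longrightarrow> x \<in> S"
  unfolding space_OmegaM by (drule spec[of _ n]) auto

lemma hist_measurable[measurable]: "hist n \<in> measurable (OmegaM S) (OmegaM S)"
  unfolding hist_def OmegaM_def
  by (rule measurable_PiM_single') (auto simp: space_PiM space_pair_measure PiE_iff)

lemma hist_space: "\<omega> \<in> space (OmegaM S) \<Longrightarrow> hist n \<omega> \<in> space (OmegaM S)"
  by (rule measurable_space[OF hist_measurable])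

lemma hist_nth[simp]: "hist n \<omega> n = \<omega> n"
  by (simp add: hist_def)

locale ctmdp =
  fixes S :: "'s::polish_space set" and A :: "'a::polish_space set"
    and q :: "'s \<Rightarrow> 'a \<Rightarrow> 's set \<Rightarrow> real"
  assumes S_nonempty: "S \<noteq> {}" and A_nonempty: "A \<noteq> {}"
    and model: "ctmdp_model S A q"
    and qx_measurable:
      "(\<lambda>(x, a). qx q x a) \<in> borel_measurable (restrict_space borel S \<Otimes>\<^sub>M restrict_space borel A)"
begin

abbreviation MS :: "'s measure" where "MS \<equiv> restrict_space borel S"
abbreviation MA :: "'a measure" where "MA \<equiv> restrict_space borel A"

lemma space_MS[simp]: "space MS = S" and space_MA[simp]: "space MA = A"
  by (simp_all add: space_restrict_space)

declare measurable_pick[OF S_nonempty, measurable]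

lemma qx_measurable'[measurable (raw)]:
  "f \<in> measurable M MS \<Longrightarrow> g \<in> measurable M MA \<Longrightarrow> (\<lambda>z. qx q (f z) (g z)) \<in> borel_measurable M"
  using measurable_compose[OF measurable_Pair qx_measurable, of f M g] by simp

lemma singleton_MS: "x \<in> S \<Longrightarrow> {x} \<in> sets MS"
  by (auto simp: sets_restrict_space intro!: image_eqI[of _ _ "{x}"])

lemma q_sums:
  "x \<in> S \<Longrightarrow> a \<in> A \<Longrightarrow> range F \<subseteq> sets MS \<Longrightarrow> disjoint_family F \<Longrightarrow>
    (\<lambda>n. q x a (F n)) sums q x a (\<Union>n. F n)"
  using model unfolding ctmdp_model_def by blast

lemma q_empty: "x \<in> S \<Longrightarrow> a \<in> A \<Longrightarrow> q x a {} = 0"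
  using q_sums[of x a "\<lambda>_. {}", THEN sums_summable] by (simp add: disjoint_family_on_def summable_const_iff)

lemma q_union:
  assumes "x \<in> S" "a \<in> A" "B \<in> sets MS" "C \<in> sets MS" "B \<inter> C = {}"
  shows "q x a (B \<union> C) = q x a B + q x a C"
proof -
  have "(\<lambda>n. q x a (binaryset B C n)) sums q x a (\<Union>n. binaryset B C n)"
  proof (rule q_sums)
    show "range (binaryset B C) \<subseteq> sets MS" using assms by (simp add: range_binaryset_eq)
    show "disjoint_family (binaryset B C)"
      using assms(5) by (simp add: binaryset_def disjoint_family_on_def Int_commute)
  qed (use assms in auto)
  moreover have "(\<lambda>n. q x a (binaryset B C n)) sums (q x a B + q x a C)"
    by (rule binaryset_sums) (use assms q_empty in auto)
  ultimately show ?thesis using sums_unique2 by (metis UN_binaryset_eq)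
qed

lemma qt_nonneg: "x \<in> S \<Longrightarrow> a \<in> A \<Longrightarrow> \<Gamma> \<in> sets MS \<Longrightarrow> 0 \<le> qt q x a \<Gamma>"
  using model unfolding ctmdp_model_def by blast

lemma qt_space:
  assumes "x \<in> S" "a \<in> A"
  shows "qt q x a S = qx q x a"
proof -
  have "q x a ({x} \<union> (S - {x})) = q x a {x} + q x a (S - {x})"
    using assms singleton_MS[of x] sets.top[of MS]
    by (intro q_union) (auto simp del: sets.top)
  moreover have "{x} \<union> (S - {x}) = S" using assms by auto
  moreover have "q x a S = 0" using model assms unfolding ctmdp_model_def by blast
  ultimately show ?thesis by (simp add: qt_def qx_def)
qed

text \<open>Adding back the atom at \<open>x\<close> trades the moving set
  \<open>\<Gamma> - {x}\<close> for the fixed set \<Gamma>, for which the model gives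
  measurability.\<close>

lemma qt_eq:
  assumes "x \<in> S" "a \<in> A" "\<Gamma> \<in> sets MS"
  shows "qt q x a \<Gamma> = q x a \<Gamma> + indicator \<Gamma> x * qx q x a"
proof (cases "x \<in> \<Gamma>")
  case True
  have "q x a ({x} \<union> (\<Gamma> - {x})) = q x a {x} + q x a (\<Gamma> - {x})"
    using assms singleton_MS[of x] by (intro q_union) auto
  moreover have "{x} \<union> (\<Gamma> - {x}) = \<Gamma>" using True by auto
  ultimately show ?thesis using True by (simp add: qt_def qx_def)
qed (simp add: qt_def)

lemma emeasure_qt_meas:
  assumes "x \<in> S" "a \<in> A" "\<Gamma> \<in> sets MS"
  shows "emeasure (qt_meas S q x a) \<Gamma> = ennreal (qt q x a \<Gamma>)"
  unfolding qt_meas_def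
proof (rule emeasure_measure_of_sigma)
  show "sigma_algebra S (sets MS)"
    using sets.sigma_algebra_axioms[of MS] by simp
  show "positive (sets MS) (\<lambda>\<Gamma>. ennreal (qt q x a \<Gamma>))"
    using assms by (simp add: positive_def qt_def q_empty)
  show "countably_additive (sets MS) (\<lambda>\<Gamma>. ennreal (qt q x a \<Gamma>))"
  proof (rule countably_additiveI)
    fix F :: "nat \<Rightarrow> 's set" assume F: "range F \<subseteq> sets MS" "disjoint_family F"
    have "(\<lambda>n. q x a (F n - {x})) sums q x a (\<Union>n. F n - {x})"
      by (rule q_sums) (use F assms singleton_MS[of x] in \<open>auto simp: disjoint_family_on_def\<close>)
    then have "(\<lambda>n. qt q x a (F n)) sums qt q x a (\<Union>n. F n)"
      by (simp add: qt_def)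
    then show "(\<Sum>n. ennreal (qt q x a (F n))) = ennreal (qt q x a (\<Union>n. F n))"
      using F assms by (subst suminf_ennreal2) (auto simp: sums_iff intro!: qt_nonneg)
  qed
qed (rule assms)

lemma sets_qt_meas[simp, measurable_cong]: "sets (qt_meas S q x a) = sets MS"
  and space_qt_meas[simp]: "space (qt_meas S q x a) = S"
  using sets.sigma_sets_eq[of MS] sets.space_closed[of MS] unfolding qt_meas_def by simp_all

lemma qx_nonneg: "x \<in> S \<Longrightarrow> a \<in> A \<Longrightarrow> 0 \<le> qx q x a"
  using qt_nonneg[of x a S] qt_space[of x a] sets.top[of MS] by (simp del: sets.top)

lemma qt_measurable[measurable]:
  assumes [measurable]: "\<Gamma> \<in> sets MS"
  shows "(\<lambda>(x, a). qt q x a \<Gamma>) \<in> borel_measurable (MS \<Otimes>\<^sub>M MA)"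
proof -
  have [measurable]: "(\<lambda>(x, a). q x a \<Gamma>) \<in> borel_measurable (MS \<Otimes>\<^sub>M MA)"
    using model assms unfolding ctmdp_model_def by blast
  have "(\<lambda>z. (\<lambda>(x, a). q x a \<Gamma>) z + indicator \<Gamma> (fst z) * qx q (fst z) (snd z)) \<in> borel_measurable (MS \<Otimes>\<^sub>M MA)"
    by measurable
  then show ?thesis
    by (rule measurable_cong[THEN iffD1, rotated]) (auto simp: space_pair_measure qt_eq[OF _ _ assms])
qed

text \<open>The rate kernel is not uniformly bounded, so it does not map into \<open>subprob_algebra\<close>;
  its normalisation does (it is the null measure where the rate vanishes).\<close>

definition jump_kernel :: "'s \<Rightarrow> 'a \<Rightarrow> 's measure" where
  "jump_kernel x a = scale_measure (inverse (ennreal (qx q x a))) (qt_meas S q x a)"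

lemma jump_kernel_measurable[measurable]:
  "(\<lambda>(x, a). jump_kernel x a) \<in> measurable (MS \<Otimes>\<^sub>M MA) (subprob_algebra MS)"
proof (rule measurable_subprob_algebra)
  fix z assume "z \<in> space (MS \<Otimes>\<^sub>M MA)"
  then obtain x a where z: "z = (x, a)" "x \<in> S" "a \<in> A" by (auto simp: space_pair_measure)
  have "emeasure (jump_kernel x a) S \<le> 1"
    using z by (simp add: jump_kernel_def emeasure_qt_meas[of x a S] qt_space sets.top[of MS, simplified]
        ennreal_mult_inverse_le_one mult.commute)
  then show "subprob_space (case z of (x, a) \<Rightarrow> jump_kernel x a)"
    using S_nonempty z by (auto intro!: subprob_spaceI simp: jump_kernel_def space_scale_measure)
  show "sets (case z of (x, a) \<Rightarrow> jump_kernel x a) = sets MS"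
    by (simp add: z jump_kernel_def)
next
  fix \<Gamma> assume [measurable]: "\<Gamma> \<in> sets MS"
  have "(\<lambda>z. inverse (ennreal (qx q (fst z) (snd z))) * ennreal ((\<lambda>(x, a). qt q x a \<Gamma>) z)) \<in> borel_measurable (MS \<Otimes>\<^sub>M MA)"
    by measurable
  then show "(\<lambda>z. emeasure (case z of (x, a) \<Rightarrow> jump_kernel x a) \<Gamma>) \<in> borel_measurable (MS \<Otimes>\<^sub>M MA)"
    by (rule measurable_cong[THEN iffD1, rotated])
      (auto simp: space_pair_measure jump_kernel_def emeasure_qt_meas)
qed

definition qt_int :: "('s \<Rightarrow> ennreal) \<Rightarrow> 's \<Rightarrow> 'a \<Rightarrow> ennreal" where
  "qt_int f x a = (\<integral>\<^sup>+y. f y \<partial>qt_meas S q x a)"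

text \<open>Splits the unbounded kernel into a rate and a subprobability law, which reduces its
  measurability to the bounded case. At rate 0 the kernel is null and both sides vanish.\<close>

lemma qt_int_eq:
  assumes "x \<in> S" "a \<in> A" and f: "f \<in> borel_measurable MS"
  shows "qt_int f x a = ennreal (qx q x a) * (\<integral>\<^sup>+y. f y \<partial>jump_kernel x a)"
proof (cases "qx q x a = 0")
  case True
  then have "emeasure (qt_meas S q x a) S = 0"
    using assms qt_space[of x a] sets.top[of MS] by (simp add: emeasure_qt_meas del: sets.top)
  then have "AE y in qt_meas S q x a. False"
    by (intro AE_I[of _ _ S]) (auto simp: sets.top[of MS, simplified])
  then have "qt_int f x a = (\<integral>\<^sup>+y. 0 \<partial>qt_meas S q x a)"
    unfolding qt_int_def by (intro nn_integral_cong_AE) (auto elim: eventually_mono)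
  then show ?thesis using True by simp
next
  case False
  then have "ennreal (qx q x a) * inverse (ennreal (qx q x a)) = 1"
    using qx_nonneg[OF assms(1,2)] by (simp add: inverse_ennreal ennreal_mult'[symmetric])
  then show ?thesis
    using f by (simp add: jump_kernel_def qt_int_def nn_integral_scale_measure mult.assoc[symmetric]
        cong: measurable_cong_sets)
qed

lemma qt_int_measurable[measurable (raw)]:
  assumes [measurable]: "case_prod f \<in> borel_measurable (M \<Otimes>\<^sub>M MS)" "g \<in> measurable M MS" "h \<in> measurable M MA"
  shows "(\<lambda>z. qt_int (f z) (g z) (h z)) \<in> borel_measurable M"
proof -
  have "(\<lambda>z. (\<lambda>(x, a). jump_kernel x a) (g z, h z)) \<in> measurable M (subprob_algebra MS)"
    by measurable
  then have [measurable]: "(\<lambda>z. \<integral>\<^sup>+y. f z y \<partial>(\<lambda>(x, a). jump_kernel x a) (g z, h z)) \<in> borel_measurable M"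
    by (intro nn_integral_measurable_subprob_algebra2[where N=MS and f=f]) measurable
  have "(\<lambda>z. ennreal (qx q (g z) (h z)) * (\<integral>\<^sup>+y. f z y \<partial>(\<lambda>(x, a). jump_kernel x a) (g z, h z))) \<in> borel_measurable M"
    by measurable
  then show ?thesis
  proof (rule measurable_cong[THEN iffD1, rotated])
    fix z assume z: "z \<in> space M"
    have "g z \<in> S" "h z \<in> A" using assms(2,3)[THEN measurable_space, OF z] by simp_all
    moreover have "f z \<in> borel_measurable MS" using assms(1) z by simp
    ultimately show "ennreal (qx q (g z) (h z)) * (\<integral>\<^sup>+y. f z y \<partial>(\<lambda>(x, a). jump_kernel x a) (g z, h z)) = qt_int (f z) (g z) (h z)"
      by (simp add: qt_int_eq)
  qed
qed

lemma qt_int_indicator: "x \<in> S \<Longrightarrow> a \<in> A \<Longrightarrow> \<Gamma> \<in> sets MS \<Longrightarrow> qt_int (indicator \<Gamma>) x a = ennreal (qt q x a \<Gamma>)"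
  by (simp add: qt_int_def emeasure_qt_meas)

lemma qt_int_one: "x \<in> S \<Longrightarrow> a \<in> A \<Longrightarrow> qt_int (\<lambda>_. 1) x a = ennreal (qx q x a)"
  by (simp add: qt_int_def emeasure_qt_meas[of x a S] qt_space sets.top[of MS, simplified])

lemma qx_bounded: "x \<in> S \<Longrightarrow> \<exists>C\<ge>0. \<forall>a\<in>A. qx q x a \<le> C"
proof -
  assume x: "x \<in> S"
  then have "bdd_above ((\<lambda>a. qx q x a) ` A)" using model unfolding ctmdp_model_def by simp
  then obtain C where "\<forall>a\<in>A. qx q x a \<le> C" by (auto simp: bdd_above_def)
  then show ?thesis using A_nonempty qx_nonneg[OF x] by (auto intro!: exI[of _ C] intro: order_trans)
qed

end

section \<open>The law of one sojourn\<close>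

locale ctmdp_policy = ctmdp S A q
  for S :: "'s::polish_space set" and A :: "'a::polish_space set" and q +
  fixes pol :: "('s, 'a) policy"
  assumes policy: "is_policy S A pol"
begin

lemma pol_measurable: "(\<lambda>(h, s). pol n h s) \<in> measurable (OmegaM S \<Otimes>\<^sub>M borel) (prob_algebra MA)"
  using policy by (simp add: is_policy_def)

lemma pol_measurable'[measurable (raw)]:
  assumes "h \<in> measurable M (OmegaM S)" "s \<in> borel_measurable M"
  shows "(\<lambda>z. pol n (h z) (s z)) \<in> measurable M (prob_algebra MA)"
    "(\<lambda>z. pol n (h z) (s z)) \<in> measurable M (subprob_algebra MA)"
  using measurable_compose[OF measurable_Pair[OF assms] pol_measurable]
  by (auto intro: measurable_prob_algebraD)

lemma pol_space:
  assumes "h \<in> space (OmegaM S)"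
  shows "prob_space (pol n h s)" "sets (pol n h s) = sets MA" "space (pol n h s) = A"
proof -
  have "pol n h s \<in> space (prob_algebra MA)"
    using measurable_space[OF pol_measurable, of "(h, s)" n] assms by (simp add: space_pair_measure)
  then show "prob_space (pol n h s)" "sets (pol n h s) = sets MA"
    by (simp_all add: space_prob_algebra)
  then show "space (pol n h s) = A" using sets_eq_imp_space_eq[of "pol n h s" MA] by simp
qed

text \<open>The average over the action chosen at elapsed time \<open>s\<close> of sojourn
  \<open>n\<close>. The value 0 at the cemetery stands for the dummy action with vanishing rates and
  costs.\<close>

definition act_int :: "nat \<Rightarrow> (nat \<Rightarrow> 's option \<times> ennreal) \<Rightarrow> real \<Rightarrow> ('s \<Rightarrow> 'a \<Rightarrow> ennreal) \<Rightarrow> ennreal" where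
  "act_int n h s F = (if fst (h n) = None then 0 else \<integral>\<^sup>+a. F (pick S (fst (h n))) a \<partial>pol n h s)"

definition jump_rate :: "nat \<Rightarrow> (nat \<Rightarrow> 's option \<times> ennreal) \<Rightarrow> real \<Rightarrow> real" where
  "jump_rate n h s = (if fst (h n) = None then 0 else \<integral>a. qx q (pick S (fst (h n))) a \<partial>pol n h s)"

definition survival :: "nat \<Rightarrow> (nat \<Rightarrow> 's option \<times> ennreal) \<Rightarrow> real \<Rightarrow> ennreal" where
  "survival n h t = ennreal (exp (- (LINT s:{0..t}|lborel. jump_rate n h s)))"

text \<open>The atom of the sojourn law at infinity. It is the mass missing from the jump density
  and not a limit of \<open>survival\<close>, so total mass 1 follows once the density has mass at
  most 1.\<close>

definition never_jump :: "nat \<Rightarrow> (nat \<Rightarrow> 's option \<times> ennreal) \<Rightarrow> ennreal" where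
  "never_jump n h = 1 - (\<integral>\<^sup>+s. indicator {0<..} s * survival n h s * ennreal (jump_rate n h s) \<partial>lborel)"

lemma rate_eq: "rate q pol n \<omega> = jump_rate n (hist n \<omega>)"
  by (auto simp: rate_def jump_rate_def fun_eq_iff split: option.split)

lemma act_int_measurable[measurable (raw)]:
  assumes [measurable]: "(\<lambda>(z, x, a). F z x a) \<in> borel_measurable (M \<Otimes>\<^sub>M (MS \<Otimes>\<^sub>M MA))"
    and [measurable]: "h \<in> measurable M (OmegaM S)" "s \<in> borel_measurable M"
  shows "(\<lambda>z. act_int n (h z) (s z) (F z)) \<in> borel_measurable M"
proof -
  have "(\<lambda>z. (fst z, pick S (fst (h (fst z) n)), snd z)) \<in> measurable (M \<Otimes>\<^sub>M MA) (M \<Otimes>\<^sub>M (MS \<Otimes>\<^sub>M MA))"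
    by measurable
  from measurable_compose[OF this assms(1)]
  have "(\<lambda>(z, a). F z (pick S (fst (h z n))) a) \<in> borel_measurable (M \<Otimes>\<^sub>M MA)"
    by (simp add: split_beta')
  then have [measurable]: "(\<lambda>z. \<integral>\<^sup>+a. F z (pick S (fst (h z n))) a \<partial>pol n (h z) (s z)) \<in> borel_measurable M"
    by (rule nn_integral_measurable_subprob_algebra2) measurable
  show ?thesis unfolding act_int_def by measurable
qed

lemma pick_nth_space: "h \<in> space (OmegaM S) \<Longrightarrow> pick S (fst (h n)) \<in> S"
  using measurable_space[OF measurable_pick[OF S_nonempty], of "fst (h n)"]
  by (auto simp: space_OmegaM)

lemma integral_action:
  assumes h: "h \<in> space (OmegaM S)" and f: "f \<in> borel_measurable MA"
    and bd: "\<And>a. a \<in> A \<Longrightarrow> 0 \<le> f a" "\<And>a. a \<in> A \<Longrightarrow> f a \<le> C"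
  shows "ennreal (\<integral>a. f a \<partial>pol n h s) = (\<integral>\<^sup>+a. ennreal (f a) \<partial>pol n h s)"
    and "0 \<le> (\<integral>a. f a \<partial>pol n h s)" and "(\<integral>a. f a \<partial>pol n h s) \<le> C"
proof -
  interpret prob_space "pol n h s" by (rule pol_space[OF h])
  have [measurable]: "f \<in> borel_measurable (pol n h s)"
    using f by (simp cong: measurable_cong_sets add: pol_space[OF h])
  have int: "integrable (pol n h s) f"
    by (rule integrable_const_bound[of _ C]) (use bd in \<open>auto simp: pol_space[OF h]\<close>)
  then show "ennreal (\<integral>a. f a \<partial>pol n h s) = (\<integral>\<^sup>+a. ennreal (f a) \<partial>pol n h s)"
    by (intro nn_integral_eq_integral[symmetric]) (use bd in \<open>auto simp: pol_space[OF h]\<close>)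
  show "0 \<le> (\<integral>a. f a \<partial>pol n h s)"
    by (intro Bochner_Integration.integral_nonneg) (use bd in \<open>auto simp: pol_space[OF h]\<close>)
  show "(\<integral>a. f a \<partial>pol n h s) \<le> C"
    by (rule integral_le_const[OF int]) (use bd in \<open>auto simp: pol_space[OF h]\<close>)
qed

text \<open>Rates are bounded in a fixed state, so the Bochner integral in the definition agrees
  with the nonnegative one and the rules for \<open>act_int\<close> apply.\<close>

lemma jump_rate_eq:
  assumes h: "h \<in> space (OmegaM S)"
  shows "ennreal (jump_rate n h s) = act_int n h s (\<lambda>x a. ennreal (qx q x a))" "0 \<le> jump_rate n h s"
proof -
  obtain C where "\<forall>a\<in>A. qx q (pick S (fst (h n))) a \<le> C"
    using qx_bounded[OF pick_nth_space[OF h]] by blast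
  note * = integral_action[OF h, of "qx q (pick S (fst (h n)))" C n s]
  show "ennreal (jump_rate n h s) = act_int n h s (\<lambda>x a. ennreal (qx q x a))" "0 \<le> jump_rate n h s"
    unfolding jump_rate_def act_int_def
    using * \<open>\<forall>a\<in>A. _ a \<le> C\<close> qx_nonneg[OF pick_nth_space[OF h]]
      qx_measurable'[OF measurable_const measurable_ident, of "pick S (fst (h n))"] pick_nth_space[OF h]
    by auto
qed

lemma jump_rate_bounded:
  assumes h: "h \<in> space (OmegaM S)"
  obtains C where "\<And>s. jump_rate n h s \<le> C"
proof -
  obtain C where C: "0 \<le> C" "\<forall>a\<in>A. qx q (pick S (fst (h n))) a \<le> C"
    using qx_bounded[OF pick_nth_space[OF h]] by blast
  then have "jump_rate n h s \<le> C" for s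
    using integral_action(3)[OF h, of "qx q (pick S (fst (h n)))" C n s]
      qx_nonneg[OF pick_nth_space[OF h]] pick_nth_space[OF h]
      qx_measurable'[OF measurable_const measurable_ident, of "pick S (fst (h n))"]
    by (auto simp: jump_rate_def)
  then show ?thesis by (rule that)
qed

lemma jump_rate_measurable[measurable (raw)]:
  assumes [measurable]: "h \<in> measurable M (OmegaM S)" "s \<in> borel_measurable M"
  shows "(\<lambda>z. jump_rate n (h z) (s z)) \<in> borel_measurable M"
proof -
  have "(\<lambda>z. enn2real (act_int n (h z) (s z) (\<lambda>x a. ennreal (qx q x a)))) \<in> borel_measurable M"
    by measurable
  then show ?thesis
    by (rule measurable_cong[THEN iffD1, rotated])
      (use assms(1)[THEN measurable_space] in \<open>simp add: jump_rate_eq(2) jump_rate_eq(1)[symmetric]\<close>)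
qed

lemma survival_measurable[measurable (raw)]:
  assumes [measurable]: "h \<in> measurable M (OmegaM S)" "s \<in> borel_measurable M"
  shows "(\<lambda>z. survival n (h z) (s z)) \<in> borel_measurable M"
proof -
  have [measurable]: "(\<lambda>z. LINT u:{0..s z}|lborel. jump_rate n (h z) u) \<in> borel_measurable M"
    by (rule borel_measurable_set_integral_upto) measurable
  show ?thesis unfolding survival_def by measurable
qed

lemma never_jump_measurable[measurable (raw)]:
  assumes [measurable]: "h \<in> measurable M (OmegaM S)"
  shows "(\<lambda>z. never_jump n (h z)) \<in> borel_measurable M"
  unfolding never_jump_def by measurable

lemma jump_before:
  assumes h: "h \<in> space (OmegaM S)" and t: "0 \<le> t"
  shows "(\<integral>\<^sup>+s. indicator {0<..t} s * survival n h s * ennreal (jump_rate n h s) \<partial>lborel) + survival n h t = 1"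
proof -
  obtain C where C: "\<And>s. jump_rate n h s \<le> C" using jump_rate_bounded[OF h] by blast
  have "0 \<le> (LINT s:{0..t}|lborel. jump_rate n h s)"
    unfolding set_lebesgue_integral_def
    by (intro Bochner_Integration.integral_nonneg) (simp add: jump_rate_eq(2)[OF h])
  then show ?thesis
    unfolding survival_def
    by (subst nn_integral_rate_exp[OF _ _ C t])
      (use h in \<open>auto simp: jump_rate_eq ennreal_plus[symmetric] simp del: ennreal_plus\<close>)
qed

text \<open>By \<open>jump_before\<close> the density has mass at most 1 up to each time
  \<open>k\<close>; monotone convergence carries the bound to the half-line.\<close>

lemma never_jump_add:
  assumes h: "h \<in> space (OmegaM S)"
  shows "(\<integral>\<^sup>+s. indicator {0<..} s * survival n h s * ennreal (jump_rate n h s) \<partial>lborel) + never_jump n h = 1"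
proof -
  note [measurable] = measurable_const[OF h]
  have "(\<integral>\<^sup>+s. indicator {0<..} s * survival n h s * ennreal (jump_rate n h s) \<partial>lborel)
      = (\<integral>\<^sup>+s. (SUP k. indicator {0<..real k} s * (survival n h s * ennreal (jump_rate n h s))) \<partial>lborel)"
  proof (intro nn_integral_cong)
    fix s
    have "(SUP k. indicator {0<..real k} s * (survival n h s * ennreal (jump_rate n h s)))
        = (SUP k. indicator {0<..real k} s) * (survival n h s * ennreal (jump_rate n h s))"
      by (simp add: SUP_mult_right_ennreal)
    also have "(SUP k. indicator {0<..real k} s :: ennreal) = indicator {0<..} s"
    proof (cases "0 < s")
      case True
      then obtain k where "s \<le> real k" using real_arch_simple by blast
      then have "indicator {0<..real k} s = (1::ennreal)" using True by simp
      then have "1 \<le> (SUP k. indicator {0<..real k} s :: ennreal)" by (metis SUP_upper UNIV_I)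
      then show ?thesis using True by (auto intro!: antisym SUP_least split: split_indicator)
    qed simp
    finally show "indicator {0<..} s * survival n h s * ennreal (jump_rate n h s)
        = (SUP k. indicator {0<..real k} s * (survival n h s * ennreal (jump_rate n h s)))"
      by (simp add: mult.assoc)
  qed
  also have "\<dots> = (SUP k. \<integral>\<^sup>+s. indicator {0<..real k} s * (survival n h s * ennreal (jump_rate n h s)) \<partial>lborel)"
    by (intro nn_integral_monotone_convergence_SUP)
      (auto simp: incseq_def le_fun_def intro!: mult_right_mono split: split_indicator)
  also have "\<dots> \<le> 1"
  proof (rule SUP_least)
    fix k
    have "(\<integral>\<^sup>+s. indicator {0<..real k} s * survival n h s * ennreal (jump_rate n h s) \<partial>lborel) \<le> 1"
      using jump_before[OF h, of "real k" n] by (metis add.commute le_iff_add of_nat_0_le_iff)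
    then show "(\<integral>\<^sup>+s. indicator {0<..real k} s * (survival n h s * ennreal (jump_rate n h s)) \<partial>lborel) \<le> 1"
      by (simp add: mult.assoc)
  qed
  finally show ?thesis unfolding never_jump_def by (rule add_diff_inverse_ennreal)
qed

text \<open>The total mass is split at \<open>t\<close>, and the finite mass of the jumps before
  \<open>t\<close> is cancelled. The two ranges share only the null set \<open>{t}\<close>.\<close>

lemma jump_after:
  assumes h: "h \<in> space (OmegaM S)" and t: "0 \<le> t"
  shows "(\<integral>\<^sup>+s. indicator {0<..} s * survival n h s * ennreal (jump_rate n h s) * indicator {t..} s \<partial>lborel)
    + never_jump n h = survival n h t"
proof -
  note [measurable] = measurable_const[OF h]
  let ?f = "\<lambda>s. survival n h s * ennreal (jump_rate n h s)"
  have "(\<integral>\<^sup>+s. indicator {0<..} s * ?f s \<partial>lborel)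
      = (\<integral>\<^sup>+s. indicator {0<..t} s * ?f s + indicator {0<..} s * ?f s * indicator {t..} s \<partial>lborel)"
    by (rule nn_integral_cong_AE, use AE_lborel_singleton[of t] in eventually_elim)
      (use t in \<open>auto split: split_indicator\<close>)
  also have "\<dots> = (\<integral>\<^sup>+s. indicator {0<..t} s * ?f s \<partial>lborel) + (\<integral>\<^sup>+s. indicator {0<..} s * ?f s * indicator {t..} s \<partial>lborel)"
    by (intro nn_integral_add) auto
  finally have "(\<integral>\<^sup>+s. indicator {0<..t} s * ?f s \<partial>lborel) + ((\<integral>\<^sup>+s. indicator {0<..} s * ?f s * indicator {t..} s \<partial>lborel)
      + never_jump n h) = (\<integral>\<^sup>+s. indicator {0<..t} s * ?f s \<partial>lborel) + survival n h t"
    using never_jump_add[OF h, of n] jump_before[OF h t, of n] by (simp add: mult.assoc add.assoc)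
  moreover have "(\<integral>\<^sup>+s. indicator {0<..t} s * ?f s \<partial>lborel) \<le> 1"
    using jump_before[OF h t, of n] add_increasing2[of "survival n h t", OF _ order_refl] unfolding mult.assoc by (metis zero_le)
  then have "(\<integral>\<^sup>+s. indicator {0<..t} s * ?f s \<partial>lborel) \<noteq> top"
    using neq_top_trans[of 1] by auto
  ultimately show ?thesis by (simp add: ennreal_add_left_cancel mult.assoc)
qed

text \<open>The conditional law of the sojourn time given the history: the density
  \<open>survival\<close> times \<open>jump_rate\<close> on the positive reals, and an atom at
  infinity.\<close>

definition sojourn_int :: "nat \<Rightarrow> (nat \<Rightarrow> 's option \<times> ennreal) \<Rightarrow> (ennreal \<Rightarrow> ennreal) \<Rightarrow> ennreal" where
  "sojourn_int n h f =
     (\<integral>\<^sup>+s. indicator {0<..} s * survival n h s * ennreal (jump_rate n h s) * f (ennreal s) \<partial>lborel)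
     + never_jump n h * f \<infinity>"

lemma sojourn_int_measurable[measurable (raw)]:
  assumes [measurable]: "h \<in> measurable M (OmegaM S)" "case_prod f \<in> borel_measurable (M \<Otimes>\<^sub>M borel)"
  shows "(\<lambda>z. sojourn_int n (h z) (f z)) \<in> borel_measurable M"
  unfolding sojourn_int_def by measurable

lemma sojourn_int_functional:
  assumes h: "h \<in> space (OmegaM S)"
  shows "integral_functional borel (sojourn_int n h)"
  unfolding sojourn_int_def
  using measurable_const[OF h, measurable]
  by (intro integral_functional_plus integral_functional_nn_integral integral_functional_scale
      integral_functional_eval) auto

lemma sojourn_int_atLeast:
  assumes h: "h \<in> space (OmegaM S)" and t: "0 \<le> t"
  shows "sojourn_int n h (indicator {ennreal t..}) = survival n h t"
proof -
  have "indicator {0<..} s * survival n h s * ennreal (jump_rate n h s) * indicator {ennreal t..} (ennreal s)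
     = indicator {0<..} s * survival n h s * ennreal (jump_rate n h s) * indicator {t..} s" for s
    using t by (auto split: split_indicator simp: ennreal_le_iff)
  then show ?thesis
    unfolding sojourn_int_def using jump_after[OF h t, of n] by simp
qed

text \<open>The conditional law of next state and sojourn time together. Integrating against the
  rate kernel avoids the quotient of the jump law, and the cemetery is entered only through an
  infinite sojourn.\<close>

definition step_int :: "nat \<Rightarrow> (nat \<Rightarrow> 's option \<times> ennreal) \<Rightarrow> ('s option \<times> ennreal \<Rightarrow> ennreal) \<Rightarrow> ennreal" where
  "step_int n h f =
     (\<integral>\<^sup>+s. indicator {0<..} s * survival n h s * act_int n h s (qt_int (\<lambda>y. f (Some y, ennreal s))) \<partial>lborel)
     + never_jump n h * f (None, \<infinity>)"

lemma step_int_measurable[measurable (raw)]: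
  assumes [measurable]: "h \<in> measurable M (OmegaM S)" "case_prod f \<in> borel_measurable (M \<Otimes>\<^sub>M (Xopt S \<Otimes>\<^sub>M borel))"
  shows "(\<lambda>z. step_int n (h z) (f z)) \<in> borel_measurable M"
proof -
  have [measurable]: "(\<lambda>z. (None, \<infinity>)) \<in> measurable M (Xopt S \<Otimes>\<^sub>M borel)"
    by (intro measurable_const) (auto simp: space_pair_measure)
  show ?thesis unfolding step_int_def by measurable
qed

lemma act_qt_functional:
  assumes h: "h \<in> space (OmegaM S)"
  shows "integral_functional MS (\<lambda>f. act_int n h s (qt_int f))"
  unfolding act_int_def
proof (intro integral_functional_if integral_functional_zero integral_functional_nn_integral)
  show "integral_functional MS (\<lambda>f. qt_int f x a)" for x a
    unfolding qt_int_def by (rule integral_functional_integral[OF sets_qt_meas])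
  fix f :: "'s \<Rightarrow> ennreal" assume [measurable]: "f \<in> borel_measurable MS"
  have "pick S (fst (h n)) \<in> space MS" using pick_nth_space[OF h] by simp
  note [measurable] = measurable_const[OF this]
  have "(\<lambda>a. qt_int f (pick S (fst (h n))) a) \<in> borel_measurable MA"
    by measurable
  then show "qt_int f (pick S (fst (h n))) \<in> borel_measurable (pol n h s)"
    by (simp cong: measurable_cong_sets add: pol_space[OF h])
qed

lemma step_int_functional:
  assumes h: "h \<in> space (OmegaM S)"
  shows "integral_functional (Xopt S \<Otimes>\<^sub>M borel) (step_int n h)"
proof -
  note [measurable] = measurable_const[OF h]
  have act: "integral_functional (Xopt S \<Otimes>\<^sub>M borel) (\<lambda>f. act_int n h s (qt_int (\<lambda>y. f (Some y, ennreal s))))" for s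
    by (rule integral_functional_comp[OF act_qt_functional[OF h], of "\<lambda>y. (Some y, ennreal s)"]) measurable
  show ?thesis
    unfolding step_int_def
    by (intro integral_functional_plus integral_functional_nn_integral integral_functional_scale
      integral_functional_eval act) (auto simp: space_pair_measure)
qed

end

section \<open>The strategic measure\<close>

context ctmdp_policy
begin

definition jump_law :: "nat \<Rightarrow> (nat \<Rightarrow> 's option \<times> ennreal) \<Rightarrow> ennreal \<Rightarrow> 's set \<Rightarrow> real" where
  "jump_law n h \<theta> \<Gamma> = (if fst (h n) = None \<or> \<theta> = \<infinity> then 0 else
     (\<integral>a. qt q (pick S (fst (h n))) a \<Gamma> \<partial>pol n h (enn2real \<theta>)) / jump_rate n h (enn2real \<theta>))"

lemma jump_prob_eq: "jump_prob q pol n \<omega> \<theta> \<Gamma> = jump_law n (hist n \<omega>) \<theta> \<Gamma>"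
  by (auto simp: jump_prob_def jump_law_def jump_rate_def split: option.split)

lemma qt_le_qx:
  assumes "x \<in> S" "a \<in> A" "\<Gamma> \<in> sets MS"
  shows "qt q x a \<Gamma> \<le> qx q x a"
proof -
  have "emeasure (qt_meas S q x a) \<Gamma> \<le> emeasure (qt_meas S q x a) S"
    using sets.sets_into_space[OF assms(3)] sets.top[of MS] by (intro emeasure_mono) auto
  then show ?thesis
    using assms sets.top[of MS]
    by (simp add: emeasure_qt_meas qt_space ennreal_le_iff qx_nonneg del: sets.top)
qed

lemma act_qt_eq:
  assumes h: "h \<in> space (OmegaM S)" and [measurable]: "\<Gamma> \<in> sets MS"
  shows "act_int n h s (qt_int (indicator \<Gamma>)) =
      (if fst (h n) = None then 0 else ennreal (\<integral>a. qt q (pick S (fst (h n))) a \<Gamma> \<partial>pol n h s))"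
    and "0 \<le> (\<integral>a. qt q (pick S (fst (h n))) a \<Gamma> \<partial>pol n h s)"
proof -
  let ?x = "pick S (fst (h n))"
  have x: "?x \<in> S" by (rule pick_nth_space[OF h])
  obtain C where C: "\<forall>a\<in>A. qx q ?x a \<le> C" using qx_bounded[OF x] by blast
  have m: "(\<lambda>a. qt q ?x a \<Gamma>) \<in> borel_measurable MA"
    using measurable_compose[OF _ qt_measurable[OF assms(2)], of "Pair ?x" MA] x by simp
  have b: "0 \<le> qt q ?x a \<Gamma>" "qt q ?x a \<Gamma> \<le> C" if "a \<in> A" for a
    using qt_nonneg[OF x that assms(2)] qt_le_qx[OF x that assms(2)] C that by auto
  show "act_int n h s (qt_int (indicator \<Gamma>)) =
      (if fst (h n) = None then 0 else ennreal (\<integral>a. qt q ?x a \<Gamma> \<partial>pol n h s))"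
    unfolding act_int_def using integral_action(1)[OF h m b] x
    by (auto intro!: nn_integral_cong simp: qt_int_indicator pol_space[OF h])
  show "0 \<le> (\<integral>a. qt q ?x a \<Gamma> \<partial>pol n h s)"
    by (rule integral_action(2)[OF h m b])
qed

lemma act_int_mono:
  assumes h: "h \<in> space (OmegaM S)" and "\<And>x a. x \<in> S \<Longrightarrow> a \<in> A \<Longrightarrow> F x a \<le> G x a"
  shows "act_int n h s F \<le> act_int n h s G"
  unfolding act_int_def using assms pick_nth_space[OF h, of n]
  by (auto intro!: nn_integral_mono simp: pol_space[OF h])

lemma act_int_cong:
  assumes h: "h \<in> space (OmegaM S)" and "\<And>x a. x \<in> S \<Longrightarrow> a \<in> A \<Longrightarrow> F x a = G x a"
  shows "act_int n h s F = act_int n h s G"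
  using assms by (intro antisym act_int_mono) auto

text \<open>Multiplication by the rate removes the quotient. The convention 0/0 does no harm, since
  the numerator is at most the rate and so vanishes with it.\<close>

lemma jump_rate_jump_law:
  assumes h: "h \<in> space (OmegaM S)" and \<Gamma>: "\<Gamma> \<in> sets MS" and s: "0 \<le> s"
  shows "ennreal (jump_rate n h s) * ennreal (jump_law n h (ennreal s) \<Gamma>) = act_int n h s (qt_int (indicator \<Gamma>))"
proof (cases "fst (h n) = None")
  case False
  let ?q = "\<integral>a. qt q (pick S (fst (h n))) a \<Gamma> \<partial>pol n h s"
  have *: "act_int n h s (qt_int (indicator \<Gamma>)) = ennreal ?q" "0 \<le> ?q"
    using act_qt_eq[OF h \<Gamma>] False by auto
  have "act_int n h s (qt_int (indicator \<Gamma>)) \<le> act_int n h s (\<lambda>x a. ennreal (qx q x a))"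
    by (intro act_int_mono h) (auto simp: qt_int_indicator \<Gamma> intro!: ennreal_leI qt_le_qx)
  then have "ennreal ?q \<le> ennreal (jump_rate n h s)"
    by (simp add: * jump_rate_eq(1)[OF h])
  then have "jump_rate n h s = 0 \<Longrightarrow> ?q = 0" using *(2) by (simp add: ennreal_le_iff2)
  then show ?thesis
    using False s * jump_rate_eq(2)[OF h, of n s]
    by (auto simp: jump_law_def ennreal_mult'[symmetric])
qed (simp add: act_int_def jump_law_def)

lemma jump_law_measurable[measurable (raw)]:
  assumes [measurable]: "h \<in> measurable M (OmegaM S)" "\<theta> \<in> borel_measurable M" "\<Gamma> \<in> sets MS"
  shows "(\<lambda>z. jump_law n (h z) (\<theta> z) \<Gamma>) \<in> borel_measurable M"
proof -
  have "(\<lambda>z. if fst (h z n) = None \<or> \<theta> z = \<infinity> then 0 else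
     enn2real (act_int n (h z) (enn2real (\<theta> z)) (qt_int (indicator \<Gamma>))) / jump_rate n (h z) (enn2real (\<theta> z)))
     \<in> borel_measurable M"
    by measurable
  then show ?thesis
    by (rule measurable_cong[THEN iffD1, rotated])
      (use assms(1)[THEN measurable_space] in \<open>simp add: jump_law_def act_qt_eq\<close>)
qed

text \<open>At a positive rate the jump law has mass 1, because \<open>qt\<close> and
  \<open>qx\<close> agree on the whole of \<open>S\<close>; at rate 0 the first factor
  vanishes.\<close>

lemma jump_rate_no_cemetery:
  assumes h: "h \<in> space (OmegaM S)" and s: "0 \<le> s"
  shows "ennreal (jump_rate n h s) * ennreal (1 - jump_law n h (ennreal s) S) = 0"
proof (cases "fst (h n) = None")
  case False
  have "jump_rate n h s = (\<integral>a. qt q (pick S (fst (h n))) a S \<partial>pol n h s)"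
    using False pick_nth_space[OF h, of n] unfolding jump_rate_def
    by (auto intro!: Bochner_Integration.integral_cong simp: pol_space[OF h] qt_space)
  then show ?thesis using False s by (auto simp: jump_law_def)
qed (simp add: jump_rate_def)

lemma is_stratD:
  assumes "is_strat S q pol \<gamma> P"
  shows "sets P = sets (OmegaM S)" "prob_space P"
    "distr P (Xopt S \<Otimes>\<^sub>M borel) (\<lambda>\<omega>. \<omega> 0) = distr \<gamma> (Xopt S \<Otimes>\<^sub>M borel) (\<lambda>x. (Some x, 0))"
    "\<And>n t g. 0 \<le> t \<Longrightarrow> g \<in> borel_measurable (OmegaM S) \<Longrightarrow>
      (\<integral>\<^sup>+\<omega>. g (hist n \<omega>) * indicator {\<omega>. ennreal t \<le> snd (\<omega> (Suc n))} \<omega> \<partial>P)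
        = (\<integral>\<^sup>+\<omega>. g (hist n \<omega>) * survival n (hist n \<omega>) t \<partial>P)"
    "\<And>n \<Gamma> g. \<Gamma> \<in> sets MS \<Longrightarrow> g \<in> borel_measurable (OmegaM S \<Otimes>\<^sub>M borel) \<Longrightarrow>
      (\<integral>\<^sup>+\<omega>. g (hist n \<omega>, snd (\<omega> (Suc n))) * indicator {\<omega>. fst (\<omega> (Suc n)) \<in> Some ` \<Gamma>} \<omega> \<partial>P)
        = (\<integral>\<^sup>+\<omega>. g (hist n \<omega>, snd (\<omega> (Suc n))) * ennreal (jump_law n (hist n \<omega>) (snd (\<omega> (Suc n))) \<Gamma>) \<partial>P)"
    "\<And>n g. g \<in> borel_measurable (OmegaM S \<Otimes>\<^sub>M borel) \<Longrightarrow>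
      (\<integral>\<^sup>+\<omega>. g (hist n \<omega>, snd (\<omega> (Suc n))) * indicator {\<omega>. fst (\<omega> (Suc n)) = None} \<omega> \<partial>P)
        = (\<integral>\<^sup>+\<omega>. g (hist n \<omega>, snd (\<omega> (Suc n))) * ennreal (1 - jump_law n (hist n \<omega>) (snd (\<omega> (Suc n))) S) \<partial>P)"
  using assms unfolding is_strat_def rate_eq jump_prob_eq survival_def by blast+

text \<open>The tail clause fixes the joint law of history and sojourn time on rectangles with a ray
  as second side, and these generate the product.\<close>

lemma strat_sojourn_law:
  assumes P: "is_strat S q pol \<gamma> P" and g: "g \<in> borel_measurable (OmegaM S \<Otimes>\<^sub>M borel)"
  shows "(\<integral>\<^sup>+\<omega>. g (hist n \<omega>, snd (\<omega> (Suc n))) \<partial>P)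
       = (\<integral>\<^sup>+\<omega>. sojourn_int n (hist n \<omega>) (\<lambda>\<theta>. g (hist n \<omega>, \<theta>)) \<partial>P)"
proof -
  note sets_P[measurable_cong] = is_stratD(1)[OF P]
  interpret prob_space P by (rule is_stratD(2)[OF P])
  have sp: "space P = space (OmegaM S)" by (rule sets_eq_imp_space_eq[OF sets_P])
  let ?M = "OmegaM S \<Otimes>\<^sub>M (borel :: ennreal measure)"
  let ?\<Phi> = "\<lambda>g. \<integral>\<^sup>+\<omega>. sojourn_int n (hist n \<omega>) (\<lambda>\<theta>. g (hist n \<omega>, \<theta>)) \<partial>P"
  let ?D = "distr P ?M (\<lambda>\<omega>. (hist n \<omega>, snd (\<omega> (Suc n))))"
  have [measurable]: "(\<lambda>\<omega>. \<omega> (Suc n)) \<in> measurable P (Xopt S \<Otimes>\<^sub>M borel)"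
    by measurable
  have \<Phi>: "integral_functional ?M ?\<Phi>"
  proof (rule integral_functional_nn_integral)
    fix \<omega> assume "\<omega> \<in> space P"
    then have h: "hist n \<omega> \<in> space (OmegaM S)" by (simp add: sp hist_space)
    show "integral_functional ?M (\<lambda>g. sojourn_int n (hist n \<omega>) (\<lambda>\<theta>. g (hist n \<omega>, \<theta>)))"
      by (rule integral_functional_comp[OF sojourn_int_functional[OF h]]) (use h in measurable)
  next
    fix g :: "_ \<Rightarrow> ennreal" assume [measurable]: "g \<in> borel_measurable ?M"
    show "(\<lambda>\<omega>. sojourn_int n (hist n \<omega>) (\<lambda>\<theta>. g (hist n \<omega>, \<theta>))) \<in> borel_measurable P"
      by measurable
  qed
  have "?D = functional_measure ?M ?\<Phi>"
  proof (rule pair_measure_eqI_finite[where M="OmegaM S" and N=borel and G="(\<lambda>t. {ennreal t..}) ` {0..}"])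
    show "finite_measure ?D"
      by (rule finite_measure_distr) measurable
    show "space borel \<in> ((\<lambda>t. {ennreal t..}) ` {0..})" by (auto intro!: image_eqI[of _ _ 0])
    fix H B assume H[measurable]: "H \<in> sets (OmegaM S)" and "B \<in> ((\<lambda>t. {ennreal t..}) ` {0..})"
    then obtain t where t: "0 \<le> t" "B = {ennreal t..}" by auto
    have [measurable]: "B \<in> sets borel" by (simp add: t)
    have "emeasure ?D (H \<times> B) = (\<integral>\<^sup>+z. indicator (H \<times> B) z \<partial>?D)"
      by simp
    also have "\<dots> = (\<integral>\<^sup>+\<omega>. indicator (H \<times> B) (hist n \<omega>, snd (\<omega> (Suc n))) \<partial>P)"
      by (subst nn_integral_distr) measurable
    also have "\<dots> = (\<integral>\<^sup>+\<omega>. indicator H (hist n \<omega>) * indicator {\<omega>. ennreal t \<le> snd (\<omega> (Suc n))} \<omega> \<partial>P)"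
      by (intro nn_integral_cong) (auto simp: t indicator_def)
    also have "\<dots> = (\<integral>\<^sup>+\<omega>. indicator H (hist n \<omega>) * survival n (hist n \<omega>) t \<partial>P)"
      by (rule is_stratD(4)[OF P]) (use t in auto)
    also have "\<dots> = ?\<Phi> (indicator (H \<times> B))"
    proof (intro nn_integral_cong)
      fix \<omega> assume "\<omega> \<in> space P"
      then have h: "hist n \<omega> \<in> space (OmegaM S)" by (simp add: sp hist_space)
      have "indicator H (hist n \<omega>) * survival n (hist n \<omega>) t = indicator H (hist n \<omega>) * sojourn_int n (hist n \<omega>) (indicator B)"
        using sojourn_int_atLeast[OF h t(1)] by (simp add: t)
      also have "\<dots> = sojourn_int n (hist n \<omega>) (\<lambda>\<theta>. indicator H (hist n \<omega>) * indicator B \<theta>)"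
        by (rule integral_functional_cmult[OF sojourn_int_functional[OF h], symmetric]) measurable
      finally show "indicator H (hist n \<omega>) * survival n (hist n \<omega>) t = sojourn_int n (hist n \<omega>) (\<lambda>\<theta>. indicator (H \<times> B) (hist n \<omega>, \<theta>))"
        by (simp add: indicator_times)
    qed
    finally show "emeasure ?D (H \<times> B) = emeasure (functional_measure ?M ?\<Phi>) (H \<times> B)"
      by (simp add: emeasure_functional_measure[OF \<Phi>])
  qed (auto simp: sets_borel_ennreal_atLeast Int_stable_ennreal_atLeast)
  then have "(\<integral>\<^sup>+z. g z \<partial>?D) = ?\<Phi> g"
    by (simp add: nn_integral_functional_measure[OF \<Phi> g])
  then show ?thesis
    by (subst (asm) nn_integral_distr) (use g in measurable)
qed

lemma hist_measurable_PiM: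
  assumes "n < m"
  shows "hist n \<in> measurable (PiM {0..<m} (\<lambda>_. Xopt S \<Otimes>\<^sub>M borel)) (OmegaM S)"
  unfolding hist_def OmegaM_def
proof (rule measurable_PiM_single')
  fix k
  show "(\<lambda>\<omega>. if k \<le> n then \<omega> k else (None, 0)) \<in> measurable (PiM {0..<m} (\<lambda>_. Xopt S \<Otimes>\<^sub>M borel)) (Xopt S \<Otimes>\<^sub>M borel)"
    using assms by (cases "k \<le> n") (auto simp: space_pair_measure)
qed (use assms in \<open>auto simp: space_PiM space_pair_measure PiE_iff\<close>)

section \<open>Uniqueness of the strategic measure\<close>

lemma hist_Suc: "hist (Suc n) \<omega> = (hist n \<omega>)(Suc n := \<omega> (Suc n))"
  by (auto simp: hist_def fun_eq_iff)

text \<open>The law of a history determines its joint law with the next sojourn time. The jump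
  clauses condition on both, so they then determine the joint law with the next state, which is the
  law of the longer history.\<close>

lemma strat_hist_unique:
  assumes P: "is_strat S q pol \<gamma> P" and Q: "is_strat S q pol \<gamma> Q"
    and g: "g \<in> borel_measurable (OmegaM S)"
  shows "(\<integral>\<^sup>+\<omega>. g (hist n \<omega>) \<partial>P) = (\<integral>\<^sup>+\<omega>. g (hist n \<omega>) \<partial>Q)"
  using g
proof (induction n arbitrary: g)
  case (0 g)
  note [measurable_cong] = is_stratD(1)[OF P] is_stratD(1)[OF Q]
  note [measurable] = 0
  have m: "(\<lambda>y k. if k = 0 then y else (None, 0)) \<in> measurable (Xopt S \<Otimes>\<^sub>M (borel :: ennreal measure)) (OmegaM S)"
    unfolding OmegaM_def by (rule measurable_PiM_single') (auto simp: space_pair_measure)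
  note [measurable] = measurable_compose[OF m 0]
  \<comment> \<open>\<open>hist 0\<close> retains coordinate 0 only, so the initial clause
    decides.\<close>
  have *: "(\<integral>\<^sup>+\<omega>. g (hist 0 \<omega>) \<partial>P) =
     (\<integral>\<^sup>+y. g (\<lambda>k. if k = 0 then y else (None, 0)) \<partial>distr P (Xopt S \<Otimes>\<^sub>M borel) (\<lambda>\<omega>. \<omega> 0))"
    if "sets P = sets (OmegaM S)" for P
  proof -
    note [measurable_cong] = that
    have [measurable]: "(\<lambda>\<omega>. \<omega> 0) \<in> measurable P (Xopt S \<Otimes>\<^sub>M borel)" by measurable
    show ?thesis
      by (subst nn_integral_distr) (auto simp: hist_def cong: if_cong intro!: nn_integral_cong arg_cong[where f=g])
  qed
  show ?case
    by (simp only: *[OF is_stratD(1)[OF P]] *[OF is_stratD(1)[OF Q]] is_stratD(3)[OF P] is_stratD(3)[OF Q])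
next
  case (Suc n g)
  note sets_PQ[measurable_cong] = is_stratD(1)[OF P] is_stratD(1)[OF Q]
  interpret P: prob_space P by (rule is_stratD(2)[OF P])
  have [measurable]: "(\<lambda>\<omega>. \<omega> (Suc n)) \<in> measurable P (Xopt S \<Otimes>\<^sub>M borel)" "(\<lambda>\<omega>. \<omega> (Suc n)) \<in> measurable Q (Xopt S \<Otimes>\<^sub>M borel)"
    by measurable
  \<comment> \<open>The sojourn law turns a function of history and sojourn time into a function of
    the history alone, to which the induction hypothesis applies.\<close>
  have theta: "(\<integral>\<^sup>+\<omega>. g (hist n \<omega>, snd (\<omega> (Suc n))) \<partial>P) = (\<integral>\<^sup>+\<omega>. g (hist n \<omega>, snd (\<omega> (Suc n))) \<partial>Q)"
    if [measurable]: "g \<in> borel_measurable (OmegaM S \<Otimes>\<^sub>M borel)" for g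
    unfolding strat_sojourn_law[OF P that] strat_sojourn_law[OF Q that]
    by (rule Suc.IH[where g="\<lambda>h. sojourn_int n h (\<lambda>\<theta>. g (h, \<theta>))"]) measurable
  let ?M = "(OmegaM S \<Otimes>\<^sub>M (borel :: ennreal measure)) \<Otimes>\<^sub>M Xopt S"
  let ?T = "\<lambda>\<omega>. ((hist n \<omega>, snd (\<omega> (Suc n))), fst (\<omega> (Suc n)))"
  have "distr P ?M ?T = distr Q ?M ?T"
  proof (rule pair_measure_eqI_finite[where M="OmegaM S \<Otimes>\<^sub>M borel" and N="Xopt S" and G="sets (Xopt S)"])
    show "finite_measure (distr P ?M ?T)" by (rule P.finite_measure_distr) measurable
    show "sets (Xopt S) = sigma_sets (space (Xopt S)) (sets (Xopt S))" by (rule sets.sigma_sets_eq[symmetric])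
    show "space (Xopt S) \<in> sets (Xopt S)" by (rule sets.top)
    show "Int_stable (sets (Xopt S))" by (rule sets.Int_stable)
    show "sets (Xopt S) \<subseteq> Pow (space (Xopt S))" by (rule sets.space_closed)
    fix H B assume H[measurable]: "H \<in> sets (OmegaM S \<Otimes>\<^sub>M (borel :: ennreal measure))" and B[measurable]: "B \<in> sets (Xopt S)"
    let ?\<Gamma> = "Some -` B \<inter> S" and ?e = "if None \<in> B then 1 else 0 :: ennreal"
    note \<Gamma> = sets_Xopt_decompose[OF B]
    have *: "emeasure (distr P ?M ?T) (H \<times> B) =
      (\<integral>\<^sup>+\<omega>. indicator H (hist n \<omega>, snd (\<omega> (Suc n))) * ennreal (jump_law n (hist n \<omega>) (snd (\<omega> (Suc n))) ?\<Gamma>) \<partial>P)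
      + ?e * (\<integral>\<^sup>+\<omega>. indicator H (hist n \<omega>, snd (\<omega> (Suc n))) * ennreal (1 - jump_law n (hist n \<omega>) (snd (\<omega> (Suc n))) S) \<partial>P)"
      if P: "is_strat S q pol \<gamma> P" for P
    proof -
      note [measurable_cong] = is_stratD(1)[OF P]
      have [measurable]: "(\<lambda>\<omega>. \<omega> (Suc n)) \<in> measurable P (Xopt S \<Otimes>\<^sub>M borel)" by measurable
      have 1: "Measurable.pred P (\<lambda>\<omega>. fst (\<omega> (Suc n)) \<in> Some ` ?\<Gamma>)"
        using sets_Xopt_Some[OF \<Gamma>(2)] by measurable
      have 2: "Measurable.pred P (\<lambda>\<omega>. fst (\<omega> (Suc n)) = None)" by measurable
      note [measurable] = 1 2
      have "emeasure (distr P ?M ?T) (H \<times> B) = (\<integral>\<^sup>+z. indicator (H \<times> B) z \<partial>distr P ?M ?T)"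
        by simp
      also have "\<dots> = (\<integral>\<^sup>+\<omega>. indicator (H \<times> B) (?T \<omega>) \<partial>P)"
        by (subst nn_integral_distr) measurable
      also have "\<dots> = (\<integral>\<^sup>+\<omega>. indicator H (hist n \<omega>, snd (\<omega> (Suc n))) * indicator {\<omega>. fst (\<omega> (Suc n)) \<in> Some ` ?\<Gamma>} \<omega>
          + ?e * (indicator H (hist n \<omega>, snd (\<omega> (Suc n))) * indicator {\<omega>. fst (\<omega> (Suc n)) = None} \<omega>) \<partial>P)"
      proof (intro nn_integral_cong)
        fix \<omega> :: "nat \<Rightarrow> 's option \<times> ennreal"
        have "fst (\<omega> (Suc n)) \<in> B \<longleftrightarrow> fst (\<omega> (Suc n)) \<in> Some ` ?\<Gamma> \<or> (None \<in> B \<and> fst (\<omega> (Suc n)) = None)"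
          by (subst \<Gamma>(1)) auto
        then show "indicator (H \<times> B) (?T \<omega>) = indicator H (hist n \<omega>, snd (\<omega> (Suc n))) * indicator {\<omega>. fst (\<omega> (Suc n)) \<in> Some ` ?\<Gamma>} \<omega>
          + ?e * (indicator H (hist n \<omega>, snd (\<omega> (Suc n))) * indicator {\<omega>. fst (\<omega> (Suc n)) = None} \<omega>)"
          by (auto simp: indicator_def)
      qed
      also have "\<dots> = (\<integral>\<^sup>+\<omega>. indicator H (hist n \<omega>, snd (\<omega> (Suc n))) * indicator {\<omega>. fst (\<omega> (Suc n)) \<in> Some ` ?\<Gamma>} \<omega> \<partial>P)
          + ?e * (\<integral>\<^sup>+\<omega>. indicator H (hist n \<omega>, snd (\<omega> (Suc n))) * indicator {\<omega>. fst (\<omega> (Suc n)) = None} \<omega> \<partial>P)"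
        by (simp add: nn_integral_add nn_integral_cmult)
      finally show ?thesis
        by (simp only: is_stratD(5)[OF P \<Gamma>(2), of "indicator H", OF borel_measurable_indicator[OF H]]
            is_stratD(6)[OF P, of "indicator H", OF borel_measurable_indicator[OF H]])
    qed
    have [measurable]: "?\<Gamma> \<in> sets MS" "S \<in> sets MS" using \<Gamma>(2) sets.top[of MS] by auto
    show "emeasure (distr P ?M ?T) (H \<times> B) = emeasure (distr Q ?M ?T) (H \<times> B)"
      unfolding *[OF P] *[OF Q]
      using theta[of "\<lambda>z. indicator H z * ennreal (jump_law n (fst z) (snd z) ?\<Gamma>)"]
        theta[of "\<lambda>z. indicator H z * ennreal (1 - jump_law n (fst z) (snd z) S)"]
      by simp
  qed auto
  then have eq: "(\<integral>\<^sup>+z. g ((fst (fst z))(Suc n := (snd z, snd (fst z)))) \<partial>distr P ?M ?T)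
    = (\<integral>\<^sup>+z. g ((fst (fst z))(Suc n := (snd z, snd (fst z)))) \<partial>distr Q ?M ?T)" by simp
  have u: "(\<lambda>z. (fst (fst z))(Suc n := (snd z, snd (fst z)))) \<in> measurable ?M (OmegaM S)"
  proof -
    have "(\<lambda>z. fst (fst z)) \<in> measurable ?M (OmegaM S)" "(\<lambda>z. (snd z, snd (fst z))) \<in> measurable ?M (Xopt S \<Otimes>\<^sub>M borel)"
      by measurable
    then show ?thesis unfolding OmegaM_def by (intro measurable_fun_upd[where J=UNIV]) auto
  qed
  note [measurable] = measurable_compose[OF u Suc.prems]
  show ?case using eq
    by (subst (asm) (1 2) nn_integral_distr) (measurable, simp add: hist_Suc fun_upd_def)
qed

text \<open>A cylinder over a finite set \<open>J\<close> depends only on the history up to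
  \<open>Max J\<close>, and cylinders determine a measure on the path space.\<close>

lemma strat_unique:
  assumes P: "is_strat S q pol \<gamma> P" and Q: "is_strat S q pol \<gamma> Q"
  shows "P = Q"
proof (rule measure_eqI_PiM_infinite)
  show "sets P = sets (PiM UNIV (\<lambda>_. Xopt S \<Otimes>\<^sub>M borel))" "sets Q = sets (PiM UNIV (\<lambda>_. Xopt S \<Otimes>\<^sub>M borel))"
    using is_stratD(1)[OF P] is_stratD(1)[OF Q] by (simp_all add: OmegaM_def)
  show "finite_measure P" using is_stratD(2)[OF P] by (simp add: prob_space_def)
  fix J :: "nat set" and B :: "nat \<Rightarrow> ('s option \<times> ennreal) set"
  assume J: "finite J" and B: "\<And>i. i \<in> J \<Longrightarrow> B i \<in> sets (Xopt S \<Otimes>\<^sub>M borel)"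
  let ?E = "prod_emb UNIV (\<lambda>_. Xopt S \<Otimes>\<^sub>M borel) J (Pi\<^sub>E J B)"
  have E[measurable]: "?E \<in> sets (OmegaM S)"
    unfolding OmegaM_def using J B by (intro sets_PiM_I) auto
  have *: "emeasure P ?E = (\<integral>\<^sup>+\<omega>. indicator ?E (hist (Max J) \<omega>) \<partial>P)" if P: "sets P = sets (OmegaM S)" for P
  proof -
    have "emeasure P ?E = (\<integral>\<^sup>+\<omega>. indicator ?E \<omega> \<partial>P)" using E P by simp
    also have "\<dots> = (\<integral>\<^sup>+\<omega>. indicator ?E (hist (Max J) \<omega>) \<partial>P)"
    proof (intro nn_integral_cong)
      fix \<omega> assume "\<omega> \<in> space P"
      then have \<omega>: "\<omega> \<in> space (OmegaM S)" using sets_eq_imp_space_eq[OF P] by simp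
      have "restrict (hist (Max J) \<omega>) J = restrict \<omega> J"
        using J by (auto simp: restrict_def hist_def fun_eq_iff)
      then show "indicator ?E \<omega> = (indicator ?E (hist (Max J) \<omega>) :: ennreal)"
        using \<omega> hist_space[OF \<omega>, of "Max J"] by (simp add: indicator_def prod_emb_def OmegaM_def space_PiM)
    qed
    finally show ?thesis .
  qed
  show "emeasure P ?E = emeasure Q ?E"
    unfolding *[OF is_stratD(1)[OF P]] *[OF is_stratD(1)[OF Q]]
    by (rule strat_hist_unique[OF P Q]) measurable
qed

section \<open>Existence of the strategic measure\<close>

definition next_law :: "nat \<Rightarrow> (nat \<Rightarrow> 's option \<times> ennreal) \<Rightarrow> ('s option \<times> ennreal) measure" where
  "next_law n h = functional_measure (Xopt S \<Otimes>\<^sub>M borel) (step_int n h)"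

lemma prob_space_next_law:
  assumes h: "h \<in> space (OmegaM S)"
  shows "prob_space (next_law n h)"
proof (rule prob_spaceI)
  let ?X = "Xopt S \<Otimes>\<^sub>M (borel :: ennreal measure)"
  have "act_int n h s (qt_int (\<lambda>y. indicator (space ?X) (Some y, ennreal s)))
     = act_int n h s (\<lambda>x a. ennreal (qx q x a))" for s
  proof (rule act_int_cong[OF h])
    fix x a assume xa: "x \<in> S" "a \<in> A"
    have "qt_int (\<lambda>y. indicator (space ?X) (Some y, ennreal s)) x a = qt_int (\<lambda>_. 1) x a"
      unfolding qt_int_def by (intro nn_integral_cong) (simp add: space_pair_measure)
    then show "qt_int (\<lambda>y. indicator (space ?X) (Some y, ennreal s)) x a = ennreal (qx q x a)"
      by (simp add: qt_int_one[OF xa])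
  qed
  then have "step_int n h (indicator (space ?X)) = 1"
    unfolding step_int_def using never_jump_add[OF h, of n]
    by (simp add: space_pair_measure jump_rate_eq(1)[OF h])
  then show "emeasure (next_law n h) (space (next_law n h)) = 1"
    by (simp add: next_law_def emeasure_functional_measure[OF step_int_functional[OF h]])
qed

lemma next_law_measurable: "next_law n \<in> measurable (OmegaM S) (subprob_algebra (Xopt S \<Otimes>\<^sub>M borel))"
proof (rule measurable_subprob_algebra)
  fix B assume [measurable]: "B \<in> sets (Xopt S \<Otimes>\<^sub>M (borel :: ennreal measure))"
  have "(\<lambda>h. step_int n h (indicator B)) \<in> borel_measurable (OmegaM S)" by measurable
  then show "(\<lambda>h. emeasure (next_law n h) B) \<in> borel_measurable (OmegaM S)"
    by (rule measurable_cong[THEN iffD1, rotated])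
      (simp add: next_law_def emeasure_functional_measure[OF step_int_functional])
qed (simp_all add: prob_space_imp_subprob_space prob_space_next_law, simp add: next_law_def)

text \<open>Each clause is the one-step formula for a special test function. The quotient of the
  jump clauses reappears through \<open>jump_rate_jump_law\<close>, and the cemetery clause through
  \<open>jump_rate_no_cemetery\<close>.\<close>

lemma strat_from_step_law:
  assumes sets_P: "sets P = sets (OmegaM S)" and "prob_space P"
    and init: "distr P (Xopt S \<Otimes>\<^sub>M borel) (\<lambda>\<omega>. \<omega> 0) = distr \<gamma> (Xopt S \<Otimes>\<^sub>M borel) (\<lambda>x. (Some x, 0))"
    and step: "\<And>n f. f \<in> borel_measurable (OmegaM S \<Otimes>\<^sub>M (Xopt S \<Otimes>\<^sub>M borel)) \<Longrightarrow>
      (\<integral>\<^sup>+\<omega>. f (hist n \<omega>, \<omega> (Suc n)) \<partial>P) = (\<integral>\<^sup>+\<omega>. step_int n (hist n \<omega>) (\<lambda>y. f (hist n \<omega>, y)) \<partial>P)"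
  shows "is_strat S q pol \<gamma> P"
  unfolding is_strat_def rate_eq jump_prob_eq survival_def[symmetric]
proof (intro conjI allI impI)
  have sp: "space P = space (OmegaM S)" by (rule sets_eq_imp_space_eq[OF sets_P])
  have h: "hist n \<omega> \<in> space (OmegaM S)" if "\<omega> \<in> space P" for n \<omega>
    using that by (simp add: sp hist_space)
  have sojourn: "(\<integral>\<^sup>+\<omega>. g (hist n \<omega>, snd (\<omega> (Suc n))) \<partial>P)
      = (\<integral>\<^sup>+\<omega>. sojourn_int n (hist n \<omega>) (\<lambda>\<theta>. g (hist n \<omega>, \<theta>)) \<partial>P)"
    if [measurable]: "g \<in> borel_measurable (OmegaM S \<Otimes>\<^sub>M borel)" for n g
  proof -
    have "(\<integral>\<^sup>+\<omega>. g (hist n \<omega>, snd (\<omega> (Suc n))) \<partial>P)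
       = (\<integral>\<^sup>+\<omega>. step_int n (hist n \<omega>) (\<lambda>y. g (hist n \<omega>, snd y)) \<partial>P)"
      using step[where f="\<lambda>z. g (fst z, snd (snd z))"] by simp
    also have "\<dots> = (\<integral>\<^sup>+\<omega>. sojourn_int n (hist n \<omega>) (\<lambda>\<theta>. g (hist n \<omega>, \<theta>)) \<partial>P)"
    proof (intro nn_integral_cong)
      fix \<omega> assume \<omega>: "\<omega> \<in> space P"
      let ?h = "hist n \<omega>"
      \<comment> \<open>A test function free of the next state leaves only the total mass of the
        rate kernel, which is the jump rate.\<close>
      have "act_int n ?h s (qt_int (\<lambda>y. g (?h, ennreal s)))
          = ennreal (jump_rate n ?h s) * g (?h, ennreal s)" for s
      proof -
        have "act_int n ?h s (qt_int (\<lambda>y. g (?h, ennreal s))) = act_int n ?h s (\<lambda>x a. g (?h, ennreal s) * ennreal (qx q x a))"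
        proof (intro act_int_cong h \<omega>)
          fix x a assume "x \<in> S" "a \<in> A"
          then show "qt_int (\<lambda>y. g (?h, ennreal s)) x a = g (?h, ennreal s) * ennreal (qx q x a)"
            using qt_int_one[of x a] by (simp add: qt_int_def)
        qed
        also have "\<dots> = g (?h, ennreal s) * act_int n ?h s (\<lambda>x a. ennreal (qx q x a))"
        proof -
          have "(\<lambda>a. ennreal (qx q (pick S (fst (?h n))) a)) \<in> borel_measurable MA"
            using qx_measurable'[OF measurable_const measurable_ident, of "pick S (fst (?h n))"] pick_nth_space[OF h[OF \<omega>], of n n]
            by simp
          then have "(\<lambda>a. ennreal (qx q (pick S (fst (?h n))) a)) \<in> borel_measurable (pol n ?h s)"
            by (simp cong: measurable_cong_sets add: pol_space[OF h[OF \<omega>]])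
          then show ?thesis by (simp add: act_int_def nn_integral_cmult)
        qed
        finally show ?thesis by (simp add: jump_rate_eq(1)[OF h[OF \<omega>]] mult.commute)
      qed
      then show "step_int n ?h (\<lambda>y. g (?h, snd y)) = sojourn_int n ?h (\<lambda>\<theta>. g (?h, \<theta>))"
        by (simp add: step_int_def sojourn_int_def mult.assoc)
    qed
    finally show ?thesis .
  qed
  show "(\<integral>\<^sup>+\<omega>. g (hist n \<omega>) * indicator {\<omega>. ennreal t \<le> snd (\<omega> (Suc n))} \<omega> \<partial>P)
        = (\<integral>\<^sup>+\<omega>. g (hist n \<omega>) * survival n (hist n \<omega>) t \<partial>P)"
    if t: "0 \<le> t" and g[measurable]: "g \<in> borel_measurable (OmegaM S)" for n t g
  proof -
    have "(\<integral>\<^sup>+\<omega>. g (hist n \<omega>) * indicator {\<omega>. ennreal t \<le> snd (\<omega> (Suc n))} \<omega> \<partial>P)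
        = (\<integral>\<^sup>+\<omega>. g (hist n \<omega>) * indicator {ennreal t..} (snd (\<omega> (Suc n))) \<partial>P)"
      by (intro nn_integral_cong) (auto simp: indicator_def)
    also have "\<dots> = (\<integral>\<^sup>+\<omega>. sojourn_int n (hist n \<omega>) (\<lambda>\<theta>. g (hist n \<omega>) * indicator {ennreal t..} \<theta>) \<partial>P)"
      using sojourn[where g="\<lambda>z. g (fst z) * indicator {ennreal t..} (snd z)"] by simp
    also have "\<dots> = (\<integral>\<^sup>+\<omega>. g (hist n \<omega>) * survival n (hist n \<omega>) t \<partial>P)"
    proof (intro nn_integral_cong)
      fix \<omega> assume \<omega>: "\<omega> \<in> space P"
      show "sojourn_int n (hist n \<omega>) (\<lambda>\<theta>. g (hist n \<omega>) * indicator {ennreal t..} \<theta>) = g (hist n \<omega>) * survival n (hist n \<omega>) t"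
        by (subst integral_functional_cmult[OF sojourn_int_functional[OF h[OF \<omega>]]])
          (auto simp: sojourn_int_atLeast[OF h[OF \<omega>] t])
    qed
    finally show ?thesis .
  qed
  have S[measurable]: "S \<in> sets MS" using sets.top[of MS] by simp
  show "(\<integral>\<^sup>+\<omega>. g (hist n \<omega>, snd (\<omega> (Suc n))) * indicator {\<omega>. fst (\<omega> (Suc n)) \<in> Some ` \<Gamma>} \<omega> \<partial>P)
        = (\<integral>\<^sup>+\<omega>. g (hist n \<omega>, snd (\<omega> (Suc n))) * ennreal (jump_law n (hist n \<omega>) (snd (\<omega> (Suc n))) \<Gamma>) \<partial>P)"
    if \<Gamma>[measurable]: "\<Gamma> \<in> sets MS" and g[measurable]: "g \<in> borel_measurable (OmegaM S \<Otimes>\<^sub>M borel)" for n \<Gamma> g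
  proof -
    have [measurable]: "Some ` \<Gamma> \<in> sets (Xopt S)" by (rule sets_Xopt_Some) fact
    have "(\<integral>\<^sup>+\<omega>. g (hist n \<omega>, snd (\<omega> (Suc n))) * indicator {\<omega>. fst (\<omega> (Suc n)) \<in> Some ` \<Gamma>} \<omega> \<partial>P)
       = (\<integral>\<^sup>+\<omega>. g (hist n \<omega>, snd (\<omega> (Suc n))) * indicator (Some ` \<Gamma>) (fst (\<omega> (Suc n))) \<partial>P)"
      by (intro nn_integral_cong) (auto simp: indicator_def)
    also have "\<dots> = (\<integral>\<^sup>+\<omega>. step_int n (hist n \<omega>) (\<lambda>y. g (hist n \<omega>, snd y) * indicator (Some ` \<Gamma>) (fst y)) \<partial>P)"
      using step[where f="\<lambda>z. g (fst z, snd (snd z)) * indicator (Some ` \<Gamma>) (fst (snd z))"] by simp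
    also have "\<dots> = (\<integral>\<^sup>+\<omega>. sojourn_int n (hist n \<omega>) (\<lambda>\<theta>. g (hist n \<omega>, \<theta>) * ennreal (jump_law n (hist n \<omega>) \<theta> \<Gamma>)) \<partial>P)"
    proof (intro nn_integral_cong)
      fix \<omega> assume \<omega>: "\<omega> \<in> space P"
      let ?h = "hist n \<omega>"
      have "survival n ?h s * act_int n ?h s (qt_int (\<lambda>y. g (?h, ennreal s) * indicator (Some ` \<Gamma>) (Some y)))
          = survival n ?h s * (ennreal (jump_rate n ?h s) * (g (?h, ennreal s) * ennreal (jump_law n ?h (ennreal s) \<Gamma>)))"
        if s: "0 \<le> s" for s
      proof -
        have "act_int n ?h s (qt_int (\<lambda>y. g (?h, ennreal s) * indicator (Some ` \<Gamma>) (Some y)))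
          = act_int n ?h s (\<lambda>x a. g (?h, ennreal s) * qt_int (indicator \<Gamma>) x a)"
        proof (intro act_int_cong h \<omega>)
          fix x a assume "x \<in> S" "a \<in> A"
          have "indicator (Some ` \<Gamma>) (Some y) = (indicator \<Gamma> y :: ennreal)" for y
            by (auto simp: indicator_def)
          then show "qt_int (\<lambda>y. g (?h, ennreal s) * indicator (Some ` \<Gamma>) (Some y)) x a = g (?h, ennreal s) * qt_int (indicator \<Gamma>) x a"
            unfolding qt_int_def by (simp add: nn_integral_cmult)
        qed
        also have "\<dots> = g (?h, ennreal s) * act_int n ?h s (qt_int (indicator \<Gamma>))"
        proof -
          have [measurable]: "(\<lambda>a. pick S (fst (?h n))) \<in> measurable MA MS"
            using pick_nth_space[OF h[OF \<omega>], of n n] by simp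
          have "(\<lambda>a. qt_int (indicator \<Gamma>) (pick S (fst (?h n))) a) \<in> borel_measurable MA"
            by measurable
          then have "(\<lambda>a. qt_int (indicator \<Gamma>) (pick S (fst (?h n))) a) \<in> borel_measurable (pol n ?h s)"
            by (simp cong: measurable_cong_sets add: pol_space[OF h[OF \<omega>]])
          then show ?thesis by (simp add: act_int_def nn_integral_cmult)
        qed
        finally show ?thesis
          by (simp add: jump_rate_jump_law[OF h[OF \<omega>] \<Gamma> s, symmetric] ac_simps)
      qed
      then have "indicator {0<..} s * survival n ?h s * act_int n ?h s (qt_int (\<lambda>y. g (?h, ennreal s) * indicator (Some ` \<Gamma>) (Some y)))
          = indicator {0<..} s * survival n ?h s * ennreal (jump_rate n ?h s) * (g (?h, ennreal s) * ennreal (jump_law n ?h (ennreal s) \<Gamma>))" for s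
        by (auto simp: indicator_def mult.assoc)
      moreover have "jump_law n ?h \<infinity> \<Gamma> = 0" by (simp add: jump_law_def)
      moreover have "indicator (Some ` \<Gamma>) None = (0::ennreal)" by (auto simp: indicator_def)
      ultimately show "step_int n ?h (\<lambda>y. g (?h, snd y) * indicator (Some ` \<Gamma>) (fst y))
          = sojourn_int n ?h (\<lambda>\<theta>. g (?h, \<theta>) * ennreal (jump_law n ?h \<theta> \<Gamma>))"
        by (simp only: step_int_def sojourn_int_def fst_conv snd_conv mult_zero_right ennreal_0)
    qed
    also have "\<dots> = (\<integral>\<^sup>+\<omega>. g (hist n \<omega>, snd (\<omega> (Suc n))) * ennreal (jump_law n (hist n \<omega>) (snd (\<omega> (Suc n))) \<Gamma>) \<partial>P)"
      using sojourn[where g="\<lambda>z. g z * ennreal (jump_law n (fst z) (snd z) \<Gamma>)"] by simp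
    finally show ?thesis .
  qed
  show "(\<integral>\<^sup>+\<omega>. g (hist n \<omega>, snd (\<omega> (Suc n))) * indicator {\<omega>. fst (\<omega> (Suc n)) = None} \<omega> \<partial>P)
        = (\<integral>\<^sup>+\<omega>. g (hist n \<omega>, snd (\<omega> (Suc n))) * ennreal (1 - jump_law n (hist n \<omega>) (snd (\<omega> (Suc n))) S) \<partial>P)"
    if g[measurable]: "g \<in> borel_measurable (OmegaM S \<Otimes>\<^sub>M borel)" for n g
  proof -
    have "(\<integral>\<^sup>+\<omega>. g (hist n \<omega>, snd (\<omega> (Suc n))) * indicator {\<omega>. fst (\<omega> (Suc n)) = None} \<omega> \<partial>P)
       = (\<integral>\<^sup>+\<omega>. g (hist n \<omega>, snd (\<omega> (Suc n))) * indicator {None} (fst (\<omega> (Suc n))) \<partial>P)"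
      by (intro nn_integral_cong) (auto simp: indicator_def)
    also have "\<dots> = (\<integral>\<^sup>+\<omega>. step_int n (hist n \<omega>) (\<lambda>y. g (hist n \<omega>, snd y) * indicator {None} (fst y)) \<partial>P)"
      using step[where f="\<lambda>z. g (fst z, snd (snd z)) * indicator {None} (fst (snd z))"] by simp
    also have "\<dots> = (\<integral>\<^sup>+\<omega>. sojourn_int n (hist n \<omega>) (\<lambda>\<theta>. g (hist n \<omega>, \<theta>) * ennreal (1 - jump_law n (hist n \<omega>) \<theta> S)) \<partial>P)"
    proof (intro nn_integral_cong)
      fix \<omega> assume \<omega>: "\<omega> \<in> space P"
      let ?h = "hist n \<omega>"
      have "indicator {0<..} s * survival n ?h s * act_int n ?h s (qt_int (\<lambda>y. g (?h, ennreal s) * indicator {None} (Some y)))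
          = indicator {0<..} s * survival n ?h s * ennreal (jump_rate n ?h s) * (g (?h, ennreal s) * ennreal (1 - jump_law n ?h (ennreal s) S))" for s
      proof (cases "0 < s")
        case True
        have "ennreal (jump_rate n ?h s) * (g (?h, ennreal s) * ennreal (1 - jump_law n ?h (ennreal s) S)) = 0"
          using jump_rate_no_cemetery[OF h[OF \<omega>], of s n n] True by (simp add: mult.left_commute del: mult_eq_0_iff)
        moreover have "qt_int (\<lambda>y. 0) = (\<lambda>x a. 0)" by (simp add: qt_int_def fun_eq_iff)
        ultimately show ?thesis by (simp add: act_int_def mult.assoc del: mult_eq_0_iff)
      qed simp
      moreover have "jump_law n ?h \<infinity> S = 0" by (simp add: jump_law_def)
      ultimately show "step_int n ?h (\<lambda>y. g (?h, snd y) * indicator {None} (fst y))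
          = sojourn_int n ?h (\<lambda>\<theta>. g (?h, \<theta>) * ennreal (1 - jump_law n ?h \<theta> S))"
        by (simp add: step_int_def sojourn_int_def del: mult_eq_0_iff)
    qed
    also have "\<dots> = (\<integral>\<^sup>+\<omega>. g (hist n \<omega>, snd (\<omega> (Suc n))) * ennreal (1 - jump_law n (hist n \<omega>) (snd (\<omega> (Suc n))) S) \<partial>P)"
      using sojourn[where g="\<lambda>z. g z * ennreal (1 - jump_law n (fst z) (snd z) S)"] by simp
    finally show ?thesis .
  qed
qed (use assms in auto)

lemma strat_exists:
  assumes \<gamma>: "prob_space \<gamma>" "sets \<gamma> = sets MS"
  shows "\<exists>P. is_strat S q pol \<gamma> P"
proof -
  let ?X = "Xopt S \<Otimes>\<^sub>M (borel :: ennreal measure)"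
  define init where "init = distr \<gamma> ?X (\<lambda>x. (Some x, 0))"
  have m\<gamma>: "(\<lambda>x. (Some x, 0)) \<in> measurable \<gamma> ?X"
    using \<gamma>(2) by measurable
  have init: "prob_space init" "sets init = sets ?X"
    unfolding init_def using prob_space.prob_space_distr[OF \<gamma>(1) m\<gamma>] by auto
  \<comment> \<open>Coordinate 0 carries the initial state with its dummy sojourn time; hence kernel
    \<open>Suc n\<close> reads the history up to \<open>n\<close>.\<close>
  define K where "K i h = (case i of 0 \<Rightarrow> init | Suc n \<Rightarrow> next_law n (hist n h))" for i h
  have hist_m: "hist n \<in> measurable (PiM {0..<Suc n} (\<lambda>_. ?X)) (OmegaM S)" for n
    by (rule hist_measurable_PiM) simp
  interpret IT: Ionescu_Tulcea K "\<lambda>_. ?X"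
  proof (rule Ionescu_Tulcea.intro, goal_cases)
    case (1 i)
    show "K i \<in> measurable (PiM {0..<i} (\<lambda>_. ?X)) (subprob_algebra ?X)"
    proof (cases i)
      case 0
      have "init \<in> space (subprob_algebra ?X)"
        using init by (simp add: space_subprob_algebra prob_space_imp_subprob_space)
      then show ?thesis by (simp add: K_def 0 cong: measurable_cong)
    next
      case (Suc n)
      then show ?thesis using measurable_compose[OF hist_m next_law_measurable] by (simp add: K_def[abs_def])
    qed
  next
    case (2 i h)
    then show ?case
      using measurable_space[OF hist_m] init
      by (cases i) (auto simp: K_def intro!: prob_space_next_law)
  qed
  let ?P = "IT.PF.lim"
  have sets_P: "sets ?P = sets (OmegaM S)"
    using IT.PF.sets_lim by (simp add: OmegaM_def)
  have prob: "prob_space ?P"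
  proof
    have "(\<integral>\<^sup>+\<omega>. 1 \<partial>?P) = (\<integral>\<^sup>+w. 1 \<partial>IT.C 0 0 (\<lambda>_. undefined))"
      using IT.nn_integral_lim_restrict[of "\<lambda>_. 1" 0] by simp
    then show "emeasure ?P (space ?P) = 1"
      using prob_space.emeasure_space_1[OF IT.prob_space_C[of "\<lambda>_. undefined" 0 0]] by (simp add: space_PiM)
  qed
  have "distr ?P ?X (\<lambda>\<omega>. \<omega> 0) = init"
  proof (rule measure_eqI)
    fix B assume "B \<in> sets (distr ?P ?X (\<lambda>\<omega>. \<omega> 0))"
    then have B[measurable]: "B \<in> sets ?X" by simp
    note [measurable_cong] = sets_P
    have [measurable]: "(\<lambda>\<omega>. \<omega> 0) \<in> measurable ?P ?X" by measurable
    have "emeasure (distr ?P ?X (\<lambda>\<omega>. \<omega> 0)) B = (\<integral>\<^sup>+y. indicator B y \<partial>distr ?P ?X (\<lambda>\<omega>. \<omega> 0))" by simp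
    also have "\<dots> = (\<integral>\<^sup>+\<omega>. indicator B (\<omega> 0) \<partial>?P)" by (subst nn_integral_distr) auto
    also have "\<dots> = (\<integral>\<^sup>+\<omega>. (\<integral>\<^sup>+y. indicator B y \<partial>init) \<partial>?P)"
      using IT.nn_integral_lim_step[of "\<lambda>w. indicator B (w 0)" 0] by (simp add: K_def)
    also have "\<dots> = emeasure init B"
      using init B prob_space.emeasure_space_1[OF prob] by simp
    finally show "emeasure (distr ?P ?X (\<lambda>\<omega>. \<omega> 0)) B = emeasure init B" .
  qed (simp add: init)
  moreover have "(\<integral>\<^sup>+\<omega>. f (hist n \<omega>, \<omega> (Suc n)) \<partial>?P) = (\<integral>\<^sup>+\<omega>. step_int n (hist n \<omega>) (\<lambda>y. f (hist n \<omega>, y)) \<partial>?P)"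
    if f[measurable]: "f \<in> borel_measurable (OmegaM S \<Otimes>\<^sub>M ?X)" for n f
  proof -
    have "hist n \<in> measurable (PiM {0..<Suc (Suc n)} (\<lambda>_. ?X)) (OmegaM S)"
      by (rule hist_measurable_PiM) simp
    then have F: "(\<lambda>w. f (hist n w, w (Suc n))) \<in> borel_measurable (PiM {0..<Suc (Suc n)} (\<lambda>_. ?X))"
      by measurable
    \<comment> \<open>\<open>hist n\<close> ignores all coordinates beyond \<open>n\<close>, so
      restrictions and updates there leave it unchanged.\<close>
    have r: "hist n (restrict \<omega> {0..<Suc (Suc n)}) = hist n \<omega>" "hist n (restrict \<omega> {0..<Suc n}) = hist n \<omega>"
      "hist n ((restrict \<omega> {0..<Suc n})(Suc n := y)) = hist n \<omega>" for \<omega> :: "nat \<Rightarrow> 's option \<times> ennreal" and y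
      by (auto simp: hist_def fun_eq_iff)
    have "(\<integral>\<^sup>+\<omega>. f (hist n \<omega>, \<omega> (Suc n)) \<partial>?P) = (\<integral>\<^sup>+\<omega>. (\<integral>\<^sup>+y. f (hist n \<omega>, y) \<partial>next_law n (hist n \<omega>)) \<partial>?P)"
      using IT.nn_integral_lim_step[OF F] by (simp only: r) (simp add: K_def r)
    also have "\<dots> = (\<integral>\<^sup>+\<omega>. step_int n (hist n \<omega>) (\<lambda>y. f (hist n \<omega>, y)) \<partial>?P)"
    proof (intro nn_integral_cong)
      fix \<omega> assume "\<omega> \<in> space ?P"
      then have h: "hist n \<omega> \<in> space (OmegaM S)" using hist_space sets_eq_imp_space_eq[OF sets_P] by auto
      then show "(\<integral>\<^sup>+y. f (hist n \<omega>, y) \<partial>next_law n (hist n \<omega>)) = step_int n (hist n \<omega>) (\<lambda>y. f (hist n \<omega>, y))"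
        unfolding next_law_def
        by (intro nn_integral_functional_measure step_int_functional) auto
    qed
    finally show ?thesis .
  qed
  ultimately have "is_strat S q pol \<gamma> ?P"
    by (intro strat_from_step_law sets_P prob) (auto simp: init_def)
  then show ?thesis ..
qed

lemma Pstrat_is_strat:
  assumes "prob_space \<gamma>" "sets \<gamma> = sets MS"
  shows "is_strat S q pol \<gamma> (Pstrat S q pol \<gamma>)"
  unfolding Pstrat_def using strat_exists[OF assms] strat_unique by (metis theI)

end

section \<open>Occupation measures\<close>

lemma tt_mono: "m \<le> n \<Longrightarrow> tt \<omega> m \<le> tt \<omega> n"
  unfolding tt_def by (intro sum_mono2) auto

lemma tt_Suc: "tt \<omega> (Suc n) = tt \<omega> n + snd (\<omega> (Suc n))"
  by (simp add: tt_def)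

text \<open>Uniqueness is required for two kinds of intervals: \<open>pol_at\<close> cuts time into
  left-open pieces, \<open>xi\<close> into right-open ones.\<close>

lemma tt_interval_unique:
  assumes "tt \<omega> n < t" "t \<le> tt \<omega> (Suc n)" "tt \<omega> m < t" "t \<le> tt \<omega> (Suc m)"
  shows "m = n"
proof -
  have "\<not> n < m" "\<not> m < n"
    using tt_mono[of "Suc n" m \<omega>] tt_mono[of "Suc m" n \<omega>] assms by auto
  then show ?thesis by simp
qed

lemma tt_interval_unique':
  assumes "tt \<omega> n \<le> t" "t < tt \<omega> (Suc n)" "tt \<omega> m \<le> t" "t < tt \<omega> (Suc m)"
  shows "m = n"
proof -
  have "\<not> n < m" "\<not> m < n"
    using tt_mono[of "Suc n" m \<omega>] tt_mono[of "Suc m" n \<omega>] assms by auto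
  then show ?thesis by simp
qed

lemma pol_at_eq:
  assumes "tt \<omega> n < ennreal t" "ennreal t \<le> tt \<omega> (Suc n)"
  shows "pol_at pol \<omega> t = pol n (hist n \<omega>) (t - enn2real (tt \<omega> n))"
proof -
  have "(THE n. tt \<omega> n < ennreal t \<and> ennreal t \<le> tt \<omega> (Suc n)) = n"
    by (rule the_equality) (use assms in blast, use tt_interval_unique[OF assms] in blast)
  then show ?thesis using assms unfolding pol_at_def Let_def by (metis (no_types, lifting))
qed

lemma xi_eq:
  assumes "tt \<omega> n \<le> ennreal t" "ennreal t < tt \<omega> (Suc n)"
  shows "xi \<omega> t = fst (\<omega> n)"
proof -
  have "(THE n. tt \<omega> n \<le> ennreal t \<and> ennreal t < tt \<omega> (Suc n)) = n"
    by (rule the_equality) (use assms in blast, use tt_interval_unique'[OF assms] in blast)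
  then show ?thesis using assms unfolding xi_def by (metis (no_types, lifting))
qed

context ctmdp_policy
begin

definition state_int :: "'s measure \<Rightarrow> nat \<Rightarrow> ('s \<Rightarrow> ennreal) \<Rightarrow> ennreal" where
  "state_int \<gamma> n f = (\<integral>\<^sup>+\<omega>. (if fst (\<omega> n) = None then 0 else f (pick S (fst (\<omega> n)))) \<partial>Pstrat S q pol \<gamma>)"

text \<open>The expected cost of sojourn \<open>n\<close>. The event that the sojourn still lasts at
  \<open>s\<close> is already replaced by its conditional probability, so the integrand depends on
  the history up to \<open>n\<close> alone.\<close>

definition stage_int :: "'s measure \<Rightarrow> nat \<Rightarrow> ('s \<Rightarrow> 'a \<Rightarrow> ennreal) \<Rightarrow> ennreal" where
  "stage_int \<gamma> n F =
     (\<integral>\<^sup>+\<omega>. (\<integral>\<^sup>+s. indicator {0<..} s * survival n (hist n \<omega>) s * act_int n (hist n \<omega>) s F \<partial>lborel) \<partial>Pstrat S q pol \<gamma>)"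

definition occ_int :: "'s measure \<Rightarrow> ('s \<Rightarrow> 'a \<Rightarrow> ennreal) \<Rightarrow> ennreal" where
  "occ_int \<gamma> F = (\<Sum>n. stage_int \<gamma> n F)"

text \<open>Off the countable set of jump times the interval conventions of \<open>xi\<close> and
  \<open>pol_at\<close> agree, so time splits into sojourns, each of which is shifted to start at
  0.\<close>

lemma path_cost_eq:
  assumes \<omega>: "\<omega> \<in> space (OmegaM S)"
    and None: "\<And>n. tt \<omega> n = \<infinity> \<Longrightarrow> fst (\<omega> n) = None"
    and F[measurable]: "(\<lambda>(x, a). F x a) \<in> borel_measurable (MS \<Otimes>\<^sub>M MA)"
    and c: "\<And>x a. x \<in> S \<Longrightarrow> F x a = ennreal (c x a)"
  shows "(\<integral>\<^sup>+t\<in>{0..}. (\<integral>\<^sup>+a. ennreal (cost_ext c (xi \<omega> t) a) \<partial>(pol_at pol \<omega> t)) \<partial>lborel)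
    = (\<Sum>n. \<integral>\<^sup>+s. indicator {0<..} s * act_int n (hist n \<omega>) s F * indicator {..snd (\<omega> (Suc n))} (ennreal s) \<partial>lborel)"
proof -
  let ?T = "\<lambda>n. enn2real (tt \<omega> n)"
  define I where "I n = {t. 0 < t \<and> tt \<omega> n < ennreal t \<and> ennreal t \<le> tt \<omega> (Suc n)}" for n
  note [measurable] = measurable_const[OF hist_space[OF \<omega>]]
  have I[measurable]: "I n \<in> sets borel" for n unfolding I_def by measurable
  have pt: "(\<integral>\<^sup>+a. ennreal (cost_ext c (xi \<omega> t) a) \<partial>(pol_at pol \<omega> t)) * indicator {0..} t
      = (\<Sum>n. indicator (I n) t * act_int n (hist n \<omega>) (t - ?T n) F)"
    if t: "t \<noteq> 0" "t \<notin> range ?T" for t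
  proof (cases "\<exists>n. t \<in> I n")
    case True
    then obtain n where n: "t \<in> I n" by auto
    then have t0: "0 < t" and lt: "tt \<omega> n < ennreal t" and le: "ennreal t \<le> tt \<omega> (Suc n)" by (auto simp: I_def)
    have "ennreal t \<noteq> tt \<omega> (Suc n)" using t0 t(2) by (metis enn2real_ennreal less_imp_le rangeI)
    then have "xi \<omega> t = fst (\<omega> n)" using lt le by (intro xi_eq) auto
    moreover have "pol_at pol \<omega> t = pol n (hist n \<omega>) (t - ?T n)" using lt le by (rule pol_at_eq)
    moreover have "(\<integral>\<^sup>+a. ennreal (cost_ext c (fst (\<omega> n)) a) \<partial>(pol n (hist n \<omega>) (t - ?T n))) = act_int n (hist n \<omega>) (t - ?T n) F"
      using space_OmegaM_SomeD[OF \<omega>, of n]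
      by (auto simp: act_int_def cost_ext_def c intro!: nn_integral_cong split: option.split)
    moreover have "(\<Sum>m. indicator (I m) t * act_int m (hist m \<omega>) (t - ?T m) F) = act_int n (hist n \<omega>) (t - ?T n) F"
    proof -
      have "t \<notin> I m" if "m \<noteq> n" for m
        using tt_interval_unique[OF lt le, of m] that by (auto simp: I_def)
      then have "(\<Sum>m. indicator (I m) t * act_int m (hist m \<omega>) (t - ?T m) F)
        = (\<Sum>m\<in>{n}. indicator (I m) t * act_int m (hist m \<omega>) (t - ?T m) F)"
        by (intro suminf_finite) auto
      then show ?thesis using n by simp
    qed
    ultimately show ?thesis using t0 by simp
  next
    case False
    then have "(\<Sum>m. indicator (I m) t * act_int m (hist m \<omega>) (t - ?T m) F) = 0" by simp
    moreover have "(\<integral>\<^sup>+a. ennreal (cost_ext c (xi \<omega> t) a) \<partial>(pol_at pol \<omega> t)) * indicator {0..} t = 0"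
    proof (cases "0 < t")
      case True
      then have "\<not> (\<exists>n. tt \<omega> n < ennreal t \<and> ennreal t \<le> tt \<omega> (Suc n))" using False by (auto simp: I_def)
      then have "pol_at pol \<omega> t = count_space {}" unfolding pol_at_def by (rule if_not_P)
      then show ?thesis by (simp add: nn_integral_empty)
    next
      case False
      then show ?thesis using t by simp
    qed
    ultimately show ?thesis by simp
  qed
  have "(\<integral>\<^sup>+t\<in>{0..}. (\<integral>\<^sup>+a. ennreal (cost_ext c (xi \<omega> t) a) \<partial>(pol_at pol \<omega> t)) \<partial>lborel)
     = (\<integral>\<^sup>+t. (\<Sum>n. indicator (I n) t * act_int n (hist n \<omega>) (t - ?T n) F) \<partial>lborel)"
  proof (rule nn_integral_cong_AE)
    have "countable (insert 0 (range ?T))" by simp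
    then have "insert 0 (range ?T) \<in> null_sets lborel" by (rule countable_imp_null_set_lborel)
    then have "AE t in lborel. t \<notin> insert 0 (range ?T)" by (rule AE_not_in)
    then show "AE t in lborel. (\<integral>\<^sup>+a. ennreal (cost_ext c (xi \<omega> t) a) \<partial>(pol_at pol \<omega> t)) * indicator {0..} t
      = (\<Sum>n. indicator (I n) t * act_int n (hist n \<omega>) (t - ?T n) F)"
      by eventually_elim (intro pt, auto)
  qed
  also have "\<dots> = (\<Sum>n. \<integral>\<^sup>+t. indicator (I n) t * act_int n (hist n \<omega>) (t - ?T n) F \<partial>lborel)"
    by (rule nn_integral_suminf) measurable
  also have "\<dots> = (\<Sum>n. \<integral>\<^sup>+s. indicator {0<..} s * act_int n (hist n \<omega>) s F * indicator {..snd (\<omega> (Suc n))} (ennreal s) \<partial>lborel)"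
  proof (intro suminf_cong)
    fix n
    let ?g = "\<lambda>s. indicator {0<..} s * act_int n (hist n \<omega>) s F * indicator {..snd (\<omega> (Suc n))} (ennreal s)"
    show "(\<integral>\<^sup>+t. indicator (I n) t * act_int n (hist n \<omega>) (t - ?T n) F \<partial>lborel) = (\<integral>\<^sup>+s. ?g s \<partial>lborel)"
    proof (cases "tt \<omega> n = \<infinity>")
      case True
      then have "I n = {}" by (auto simp: I_def)
      \<comment> \<open>The right side does not see that earlier sojourns have used up all time. The
        hypothesis \<open>None\<close> puts the state in the cemetery, where the integrand is
        0.\<close>
      moreover have "act_int n (hist n \<omega>) s F = 0" for s using None[OF True] by (simp add: act_int_def)
      ultimately show ?thesis by simp
    next
      case False
      then obtain T where T: "tt \<omega> n = ennreal T" "0 \<le> T" by (cases "tt \<omega> n") auto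
      have "indicator (I n) t * act_int n (hist n \<omega>) (t - ?T n) F = ?g (- T + 1 * t)" for t
      proof (cases "T < t")
        case True
        have "ennreal t = ennreal T + ennreal (t - T)" using True T by (simp add: ennreal_plus[symmetric] del: ennreal_plus)
        then have "ennreal t \<le> tt \<omega> (Suc n) \<longleftrightarrow> ennreal (t - T) \<le> snd (\<omega> (Suc n))"
          by (simp add: tt_Suc T ennreal_add_left_cancel_le)
        then show ?thesis using True T by (auto simp: I_def indicator_def ennreal_less_iff)
      next
        case False
        then show ?thesis using T by (auto simp: I_def indicator_def ennreal_less_iff)
      qed
      then have "(\<integral>\<^sup>+t. indicator (I n) t * act_int n (hist n \<omega>) (t - ?T n) F \<partial>lborel) = (\<integral>\<^sup>+t. ?g (- T + 1 * t) \<partial>lborel)"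
        by (simp only:)
      also have "\<dots> = (\<integral>\<^sup>+s. ?g s \<partial>lborel)"
        using nn_integral_real_affine[of ?g 1 "- T"] by simp
      finally show ?thesis .
    qed
  qed
  finally show ?thesis .
qed

context
  fixes \<gamma> :: "'s measure"
  assumes \<gamma>: "prob_space \<gamma>" "sets \<gamma> = sets MS"
begin

abbreviation (input) "P \<equiv> Pstrat S q pol \<gamma>"

lemma strat: "is_strat S q pol \<gamma> P"
  by (rule Pstrat_is_strat[OF \<gamma>])

lemma sets_strat[measurable_cong]: "sets P = sets (OmegaM S)"
  by (rule is_stratD(1)[OF strat])

lemma space_strat: "space P = space (OmegaM S)"
  by (rule sets_eq_imp_space_eq[OF sets_strat])

text \<open>\<open>jump_law\<close> is 0 from the cemetery and after an infinite sojourn, so a.s. no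
  state of \<open>S\<close> follows either of them. Induction along the path then gives the
  claim.\<close>

lemma AE_cemetery: "AE \<omega> in P. \<forall>n. tt \<omega> n = \<infinity> \<longrightarrow> fst (\<omega> n) = None"
proof -
  have S: "S \<in> sets MS" using sets.top[of MS] by simp
  have "AE \<omega> in P. (fst (\<omega> n) = None \<or> snd (\<omega> (Suc n)) = \<infinity>) \<longrightarrow> fst (\<omega> (Suc n)) = None" for n
  proof -
    let ?g = "\<lambda>z :: (nat \<Rightarrow> 's option \<times> ennreal) \<times> ennreal. if fst (fst z n) = None \<or> snd z = \<infinity> then 1 else 0 :: ennreal"
    have [measurable]: "Some ` S \<in> sets (Xopt S)" by (rule sets_Xopt_Some[OF S])
    have "(\<integral>\<^sup>+\<omega>. ?g (hist n \<omega>, snd (\<omega> (Suc n))) * indicator {\<omega>. fst (\<omega> (Suc n)) \<in> Some ` S} \<omega> \<partial>P)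
      = (\<integral>\<^sup>+\<omega>. ?g (hist n \<omega>, snd (\<omega> (Suc n))) * ennreal (jump_law n (hist n \<omega>) (snd (\<omega> (Suc n))) S) \<partial>P)"
      by (rule is_stratD(5)[OF strat S]) measurable
    also have "\<dots> = (\<integral>\<^sup>+\<omega>. 0 \<partial>P)" by (intro nn_integral_cong) (auto simp: jump_law_def)
    finally have "(\<integral>\<^sup>+\<omega>. ?g (hist n \<omega>, snd (\<omega> (Suc n))) * indicator {\<omega>. fst (\<omega> (Suc n)) \<in> Some ` S} \<omega> \<partial>P) = 0"
      by simp
    then have "(\<integral>\<^sup>+\<omega>. ?g (hist n \<omega>, snd (\<omega> (Suc n))) * indicator (Some ` S) (fst (\<omega> (Suc n))) \<partial>P) = 0"
      by (simp add: indicator_def)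
    then have "AE \<omega> in P. ?g (hist n \<omega>, snd (\<omega> (Suc n))) * indicator (Some ` S) (fst (\<omega> (Suc n))) = 0"
      by (subst (asm) nn_integral_0_iff_AE) measurable
    with AE_space[of P] show ?thesis
    proof eventually_elim
      case (elim \<omega>)
      then show ?case
        by (auto simp: space_strat space_OmegaM indicator_def split: if_splits dest!: spec[of _ "Suc n"])
    qed
  qed
  then have "AE \<omega> in P. \<forall>n. (fst (\<omega> n) = None \<or> snd (\<omega> (Suc n)) = \<infinity>) \<longrightarrow> fst (\<omega> (Suc n)) = None"
    by (simp add: AE_all_countable)
  then show ?thesis
  proof eventually_elim
    case (elim \<omega>)
    show ?case
    proof
      fix n show "tt \<omega> n = \<infinity> \<longrightarrow> fst (\<omega> n) = None"
      proof (induction n)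
        case 0
        then show ?case by (simp add: tt_def)
      next
        case (Suc n)
        then show ?case using elim by (auto simp: tt_Suc)
      qed
    qed
  qed
qed

text \<open>After the integrals are exchanged, the tail clause replaces the event that sojourn
  \<open>n\<close> lasts until \<open>s\<close> by \<open>survival\<close>. It applies because the
  averaged cost at elapsed time \<open>s\<close> is a function of the history.\<close>

lemma Ecost_eq_occ_int:
  assumes F[measurable]: "(\<lambda>(x, a). F x a) \<in> borel_measurable (MS \<Otimes>\<^sub>M MA)"
    and c: "\<And>x a. x \<in> S \<Longrightarrow> F x a = ennreal (c x a)"
  shows "Ecost S q pol \<gamma> c = occ_int \<gamma> F"
proof -
  interpret prob_space P by (rule is_stratD(2)[OF strat])
  interpret pair: pair_sigma_finite P lborel ..
  let ?g = "\<lambda>n \<omega> s. indicator {0<..} s * act_int n (hist n \<omega>) s F * indicator {..snd (\<omega> (Suc n))} (ennreal s)"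
  have [measurable]: "(\<lambda>\<omega>. \<omega> n) \<in> measurable P (Xopt S \<Otimes>\<^sub>M borel)" for n
    by measurable
  have meas: "(\<lambda>(\<omega>, s). ?g n \<omega> s) \<in> borel_measurable (P \<Otimes>\<^sub>M lborel)" for n
  proof -
    have "(\<lambda>(\<omega>, s). indicator {0<..} s * act_int n (hist n \<omega>) s F * (if ennreal s \<le> snd (\<omega> (Suc n)) then 1 else 0))
      \<in> borel_measurable (P \<Otimes>\<^sub>M lborel)"
      by measurable
    then show ?thesis by (simp add: indicator_def of_bool_def)
  qed
  have "Ecost S q pol \<gamma> c = (\<integral>\<^sup>+\<omega>. (\<Sum>n. \<integral>\<^sup>+s. ?g n \<omega> s \<partial>lborel) \<partial>P)"
    unfolding Ecost_def
  proof (rule nn_integral_cong_AE)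
    show "AE \<omega> in P. (\<integral>\<^sup>+t\<in>{0..}. (\<integral>\<^sup>+a. ennreal (cost_ext c (xi \<omega> t) a) \<partial>(pol_at pol \<omega> t)) \<partial>lborel)
      = (\<Sum>n. \<integral>\<^sup>+s. ?g n \<omega> s \<partial>lborel)"
      using AE_cemetery AE_space[of P]
      by eventually_elim (rule path_cost_eq[OF _ _ F c], auto simp: space_strat)
  qed
  also have "\<dots> = (\<Sum>n. \<integral>\<^sup>+\<omega>. (\<integral>\<^sup>+s. ?g n \<omega> s \<partial>lborel) \<partial>P)"
  proof (rule nn_integral_suminf)
    show "(\<lambda>\<omega>. \<integral>\<^sup>+s. ?g n \<omega> s \<partial>lborel) \<in> borel_measurable P" for n
      using lborel.borel_measurable_nn_integral[OF meas] .
  qed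
  also have "\<dots> = (\<Sum>n. stage_int \<gamma> n F)"
  proof (intro suminf_cong)
    fix n
    have "(\<integral>\<^sup>+\<omega>. (\<integral>\<^sup>+s. ?g n \<omega> s \<partial>lborel) \<partial>P) = (\<integral>\<^sup>+s. (\<integral>\<^sup>+\<omega>. ?g n \<omega> s \<partial>P) \<partial>lborel)"
      using pair.Fubini'[OF meas] by simp
    also have "\<dots> = (\<integral>\<^sup>+s. (\<integral>\<^sup>+\<omega>. indicator {0<..} s * survival n (hist n \<omega>) s * act_int n (hist n \<omega>) s F \<partial>P) \<partial>lborel)"
    proof (rule nn_integral_cong)
      fix s :: real
      show "(\<integral>\<^sup>+\<omega>. ?g n \<omega> s \<partial>P) = (\<integral>\<^sup>+\<omega>. indicator {0<..} s * survival n (hist n \<omega>) s * act_int n (hist n \<omega>) s F \<partial>P)"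
      proof (cases "0 < s")
        case True
        have "(\<integral>\<^sup>+\<omega>. act_int n (hist n \<omega>) s F * indicator {\<omega>. ennreal s \<le> snd (\<omega> (Suc n))} \<omega> \<partial>P)
          = (\<integral>\<^sup>+\<omega>. act_int n (hist n \<omega>) s F * survival n (hist n \<omega>) s \<partial>P)"
          using True by (intro is_stratD(4)[OF strat]) (auto, measurable)
        then show ?thesis using True by (simp add: indicator_def mult.commute)
      qed simp
    qed
    also have "\<dots> = stage_int \<gamma> n F"
      unfolding stage_int_def by (rule pair.Fubini') measurable
    finally show "(\<integral>\<^sup>+\<omega>. (\<integral>\<^sup>+s. ?g n \<omega> s \<partial>lborel) \<partial>P) = stage_int \<gamma> n F" .
  qed
  finally show ?thesis by (simp add: occ_int_def)
qed

lemma state_int_0: "f \<in> borel_measurable MS \<Longrightarrow> state_int \<gamma> 0 f = (\<integral>\<^sup>+x. f x \<partial>\<gamma>)"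
proof -
  assume [measurable]: "f \<in> borel_measurable MS"
  note [measurable_cong] = \<gamma>(2)
  let ?X = "Xopt S \<Otimes>\<^sub>M (borel :: ennreal measure)"
  let ?f = "\<lambda>y. if fst y = None then 0 else f (pick S (fst y))"
  have [measurable]: "(\<lambda>\<omega>. \<omega> 0) \<in> measurable P ?X" by measurable
  have m: "?f \<in> borel_measurable ?X" by measurable
  have "state_int \<gamma> 0 f = (\<integral>\<^sup>+y. ?f y \<partial>distr P ?X (\<lambda>\<omega>. \<omega> 0))"
    unfolding state_int_def by (subst nn_integral_distr) (use m in auto)
  also have "\<dots> = (\<integral>\<^sup>+y. ?f y \<partial>distr \<gamma> ?X (\<lambda>x. (Some x, 0)))"
    by (simp only: is_stratD(3)[OF strat])
  also have "\<dots> = (\<integral>\<^sup>+x. f x \<partial>\<gamma>)"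
    by (subst nn_integral_distr) (use m in auto)
  finally show ?thesis .
qed

text \<open>Both sides are functionals of \<open>f\<close>, so indicators suffice. For these the
  jump clause yields the quotient \<open>jump_law\<close>, and the jump density of the sojourn law
  cancels its denominator.\<close>

lemma state_int_Suc:
  assumes f[measurable]: "f \<in> borel_measurable MS"
  shows "state_int \<gamma> (Suc n) f = stage_int \<gamma> n (qt_int f)"
proof -
  have h: "hist n \<omega> \<in> space (OmegaM S)" if "\<omega> \<in> space P" for \<omega>
    using that by (simp add: space_strat hist_space)
  have [measurable]: "(\<lambda>\<omega>. \<omega> (Suc n)) \<in> measurable P (Xopt S \<Otimes>\<^sub>M borel)" by measurable
  have l: "integral_functional MS (state_int \<gamma> (Suc n))"
    unfolding state_int_def
    by (intro integral_functional_nn_integral integral_functional_if integral_functional_zero integral_functional_eval)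
      (auto simp: space_strat space_OmegaM dest!: spec[of _ "Suc n"])
  have r: "integral_functional MS (\<lambda>f. stage_int \<gamma> n (qt_int f))"
    unfolding stage_int_def
  proof (intro integral_functional_nn_integral integral_functional_scale)
    fix \<omega> and s :: real assume \<omega>: "\<omega> \<in> space P"
    show "integral_functional MS (\<lambda>f. act_int n (hist n \<omega>) s (qt_int f))"
      by (rule act_qt_functional[OF h[OF \<omega>]])
    note [measurable] = measurable_const[OF h[OF \<omega>]]
    show "(\<lambda>s. indicator {0<..} s * survival n (hist n \<omega>) s * act_int n (hist n \<omega>) s (qt_int f)) \<in> borel_measurable lborel"
      if [measurable]: "f \<in> borel_measurable MS" for f
      by measurable
  next
    fix f :: "'s \<Rightarrow> ennreal" assume [measurable]: "f \<in> borel_measurable MS"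
    show "(\<lambda>\<omega>. \<integral>\<^sup>+s. indicator {0<..} s * survival n (hist n \<omega>) s * act_int n (hist n \<omega>) s (qt_int f) \<partial>lborel) \<in> borel_measurable P"
      by measurable
  qed
  have "functional_measure MS (state_int \<gamma> (Suc n)) = functional_measure MS (\<lambda>f. stage_int \<gamma> n (qt_int f))"
  proof (rule measure_eqI)
    fix \<Gamma> assume "\<Gamma> \<in> sets (functional_measure MS (state_int \<gamma> (Suc n)))"
    then have \<Gamma>[measurable]: "\<Gamma> \<in> sets MS" by simp
    have "state_int \<gamma> (Suc n) (indicator \<Gamma>) = (\<integral>\<^sup>+\<omega>. 1 * indicator {\<omega>. fst (\<omega> (Suc n)) \<in> Some ` \<Gamma>} \<omega> \<partial>P)"
      unfolding state_int_def
      by (intro nn_integral_cong) (auto simp: indicator_def)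
    also have "\<dots> = (\<integral>\<^sup>+\<omega>. 1 * ennreal (jump_law n (hist n \<omega>) (snd (\<omega> (Suc n))) \<Gamma>) \<partial>P)"
      by (rule is_stratD(5)[OF strat \<Gamma>]) measurable
    also have "\<dots> = (\<integral>\<^sup>+\<omega>. sojourn_int n (hist n \<omega>) (\<lambda>\<theta>. ennreal (jump_law n (hist n \<omega>) \<theta> \<Gamma>)) \<partial>P)"
      using strat_sojourn_law[OF strat, of "\<lambda>z. ennreal (jump_law n (fst z) (snd z) \<Gamma>)" n] by simp
    also have "\<dots> = stage_int \<gamma> n (qt_int (indicator \<Gamma>))"
      unfolding stage_int_def
    proof (intro nn_integral_cong)
      fix \<omega> assume \<omega>: "\<omega> \<in> space P"
      have "jump_law n (hist n \<omega>) \<infinity> \<Gamma> = 0" by (simp add: jump_law_def)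
      moreover have "indicator {0<..} s * survival n (hist n \<omega>) s * ennreal (jump_rate n (hist n \<omega>) s) * ennreal (jump_law n (hist n \<omega>) (ennreal s) \<Gamma>)
        = indicator {0<..} s * survival n (hist n \<omega>) s * act_int n (hist n \<omega>) s (qt_int (indicator \<Gamma>))" for s
        using jump_rate_jump_law[OF h[OF \<omega>] \<Gamma>, of s n] by (cases "0 < s") (auto simp: mult.assoc)
      ultimately show "sojourn_int n (hist n \<omega>) (\<lambda>\<theta>. ennreal (jump_law n (hist n \<omega>) \<theta> \<Gamma>))
        = (\<integral>\<^sup>+s. indicator {0<..} s * survival n (hist n \<omega>) s * act_int n (hist n \<omega>) s (qt_int (indicator \<Gamma>)) \<partial>lborel)"
        by (simp add: sojourn_int_def)
    qed
    finally show "emeasure (functional_measure MS (state_int \<gamma> (Suc n))) \<Gamma> = emeasure (functional_measure MS (\<lambda>f. stage_int \<gamma> n (qt_int f))) \<Gamma>"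
      by (simp add: emeasure_functional_measure[OF l] emeasure_functional_measure[OF r])
  qed simp
  then show ?thesis
    using nn_integral_functional_measure[OF l f] nn_integral_functional_measure[OF r f] by simp
qed

text \<open>A visit is either the initial one or the end of a jump. Summing over the jump number
  gives the balance of initial mass and flow into \<open>f\<close>.\<close>

lemma state_sum_eq:
  assumes f: "f \<in> borel_measurable MS"
  shows "(\<Sum>n. state_int \<gamma> n f) = (\<integral>\<^sup>+x. f x \<partial>\<gamma>) + occ_int \<gamma> (qt_int f)"
proof -
  have "(\<lambda>n. state_int \<gamma> (Suc n) f) sums occ_int \<gamma> (qt_int f)"
    unfolding occ_int_def state_int_Suc[OF f] by (rule summable_sums) simp
  then have "(\<lambda>n. state_int \<gamma> n f) sums (occ_int \<gamma> (qt_int f) + state_int \<gamma> 0 f)"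
    by (rule sums_Suc)
  then show ?thesis by (simp add: sums_iff state_int_0[OF f] add.commute)
qed

text \<open>Where \<open>f\<close> is nonzero, rate plus cost is at least some \<delta>. Staying
  forever with positive probability would then make the accumulated rate plus cost infinite; but the
  rate part has mass at most 1, and the cost part is a.s. finite. So the jump density has mass 1,
  and each visit is matched by one unit of outflow.\<close>

lemma state_sum_le_flow:
  assumes F[measurable]: "(\<lambda>(x, a). F x a) \<in> borel_measurable (MS \<Otimes>\<^sub>M MA)"
    and fin: "occ_int \<gamma> F < \<infinity>"
    and Z: "\<And>x. x \<in> Z \<Longrightarrow> \<exists>\<delta>>0. \<forall>a\<in>A. \<delta> \<le> ennreal (qx q x a) + F x a"
    and f[measurable]: "f \<in> borel_measurable MS" and f0: "\<And>x. x \<in> S - Z \<Longrightarrow> f x = 0"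
  shows "(\<Sum>n. state_int \<gamma> n f) \<le> occ_int \<gamma> (\<lambda>x a. f x * ennreal (qx q x a))"
  unfolding occ_int_def
proof (rule suminf_le)
  fix n
  let ?L = "\<lambda>\<omega>. \<integral>\<^sup>+s. indicator {0<..} s * survival n (hist n \<omega>) s * act_int n (hist n \<omega>) s F \<partial>lborel"
  have [measurable]: "?L \<in> borel_measurable P" by measurable
  have "(\<integral>\<^sup>+\<omega>. ?L \<omega> \<partial>P) \<le> occ_int \<gamma> F"
    unfolding occ_int_def stage_int_def[symmetric]
    using sum_le_suminf[of "\<lambda>n. stage_int \<gamma> n F" "{n}"] by simp
  then have "AE \<omega> in P. ?L \<omega> \<noteq> \<infinity>"
    using fin by (intro nn_integral_PInf_AE) auto
  then show "state_int \<gamma> n f \<le> stage_int \<gamma> n (\<lambda>x a. f x * ennreal (qx q x a))"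
    unfolding state_int_def stage_int_def using AE_space[of P]
  proof (intro nn_integral_mono_AE, eventually_elim)
    case (elim \<omega>)
    let ?h = "hist n \<omega>" and ?x = "pick S (fst (\<omega> n))"
    have h: "?h \<in> space (OmegaM S)" using elim by (simp add: space_strat hist_space)
    note [measurable] = measurable_const[OF h]
    have x: "?x \<in> S" using pick_nth_space[OF h, of n] by simp
    show ?case
    proof (cases "fst (\<omega> n) = None \<or> f ?x = 0")
      case True
      then show ?thesis by auto
    next
      case False
      then have nN: "fst (\<omega> n) \<noteq> None" and "?x \<in> Z" using f0[of ?x] x by auto
      then obtain \<delta> where \<delta>: "0 < \<delta>" "\<And>a. a \<in> A \<Longrightarrow> \<delta> \<le> ennreal (qx q ?x a) + F ?x a" using Z by blast
      have [measurable]: "(\<lambda>a. ennreal (qx q ?x a)) \<in> borel_measurable (pol n ?h s)" "(\<lambda>a. F ?x a) \<in> borel_measurable (pol n ?h s)" for s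
      proof -
        have [measurable]: "(\<lambda>a. ?x) \<in> measurable MA MS" using x by simp
        have "(\<lambda>a. ennreal (qx q ?x a)) \<in> borel_measurable MA" "(\<lambda>a. (\<lambda>(x, a). F x a) (?x, a)) \<in> borel_measurable MA"
          by measurable
        then show "(\<lambda>a. ennreal (qx q ?x a)) \<in> borel_measurable (pol n ?h s)" "(\<lambda>a. F ?x a) \<in> borel_measurable (pol n ?h s)"
          by (simp_all cong: measurable_cong_sets add: pol_space[OF h])
      qed
      let ?R = "\<integral>\<^sup>+s. indicator {0<..} s * survival n ?h s * ennreal (jump_rate n ?h s) \<partial>lborel"
      have \<delta>le: "\<delta> \<le> ennreal (jump_rate n ?h s) + act_int n ?h s F" for s
      proof -
        interpret A: prob_space "pol n ?h s" by (rule pol_space[OF h])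
        have "\<delta> = (\<integral>\<^sup>+a. \<delta> \<partial>pol n ?h s)" by (simp add: A.emeasure_space_1)
        also have "\<dots> \<le> (\<integral>\<^sup>+a. ennreal (qx q ?x a) + F ?x a \<partial>pol n ?h s)"
          by (intro nn_integral_mono \<delta>) (simp add: pol_space[OF h])
        also have "\<dots> = ennreal (jump_rate n ?h s) + act_int n ?h s F"
          by (simp add: nN nn_integral_add jump_rate_eq(1)[OF h] act_int_def)
        finally show ?thesis .
      qed
      have "never_jump n ?h = 0"
      proof (rule ccontr)
        \<comment> \<open>\<open>survival\<close> never drops below \<open>never_jump\<close>, so
          the constant \<delta> times \<open>never_jump\<close>, integrated over the half-line, is a
          lower bound, and it is infinite.\<close>
        assume nz: "never_jump n ?h \<noteq> 0"
        have "\<delta> * never_jump n ?h * emeasure lborel {0::real<..}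
          = (\<integral>\<^sup>+s. \<delta> * never_jump n ?h * indicator {0::real<..} s \<partial>lborel)"
          by (rule nn_integral_cmult_indicator[symmetric]) simp
        also have "\<dots> \<le> (\<integral>\<^sup>+s. indicator {0<..} s * survival n ?h s * ennreal (jump_rate n ?h s)
            + indicator {0<..} s * survival n ?h s * act_int n ?h s F \<partial>lborel)"
        proof (intro nn_integral_mono)
          fix s :: real
          show "\<delta> * never_jump n ?h * indicator {0<..} s \<le> indicator {0<..} s * survival n ?h s * ennreal (jump_rate n ?h s)
            + indicator {0<..} s * survival n ?h s * act_int n ?h s F"
          proof (cases "0 < s")
            case True
            then have "never_jump n ?h \<le> survival n ?h s"
              by (subst jump_after[OF h, symmetric]) (auto intro: add_increasing)
            then have "never_jump n ?h * \<delta> \<le> survival n ?h s * (ennreal (jump_rate n ?h s) + act_int n ?h s F)"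
              using \<delta>le by (intro mult_mono) auto
            then show ?thesis using True by (simp add: distrib_left mult.commute)
          qed simp
        qed
        also have "\<dots> = ?R + ?L \<omega>" by (intro nn_integral_add) measurable
        also have "\<dots> < \<infinity>"
        proof -
          have "?R \<le> 1" using never_jump_add[OF h, of n] by (metis le_iff_add)
          then have "?R < \<infinity>" by (rule le_less_trans) simp
          then show ?thesis using elim by (simp add: less_top)
        qed
        finally show False
          using \<delta>(1) nz by (auto simp: emeasure_lborel_greaterThan_zero ennreal_mult_top split: if_splits)
      qed
      then have R: "?R = 1" using never_jump_add[OF h, of n] by simp
      have "f ?x = (\<integral>\<^sup>+s. f ?x * (indicator {0<..} s * survival n ?h s * ennreal (jump_rate n ?h s)) \<partial>lborel)"
        by (subst nn_integral_cmult) (auto simp: R)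
      also have "\<dots> = (\<integral>\<^sup>+s. indicator {0<..} s * survival n ?h s * act_int n ?h s (\<lambda>x a. f x * ennreal (qx q x a)) \<partial>lborel)"
      proof (intro nn_integral_cong)
        fix s
        have "act_int n ?h s (\<lambda>x a. f x * ennreal (qx q x a)) = f ?x * ennreal (jump_rate n ?h s)"
          by (simp add: nN act_int_def jump_rate_eq(1)[OF h] nn_integral_cmult)
        then show "f ?x * (indicator {0<..} s * survival n ?h s * ennreal (jump_rate n ?h s))
          = indicator {0<..} s * survival n ?h s * act_int n ?h s (\<lambda>x a. f x * ennreal (qx q x a))"
          by (simp add: ac_simps)
      qed
      finally show ?thesis by (simp add: nN)
    qed
  qed
qed auto

end

end

section \<open>The occupation measure of a policy\<close>

context ctmdp_policy
begin

definition occ_measure :: "'s measure \<Rightarrow> ('s \<times> 'a) measure" where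
  "occ_measure \<gamma> = functional_measure (MS \<Otimes>\<^sub>M MA) (\<lambda>g. occ_int \<gamma> (\<lambda>x a. g (x, a)))"

lemma sets_occ_measure[simp, measurable_cong]: "sets (occ_measure \<gamma>) = sets (MS \<Otimes>\<^sub>M MA)"
  and space_occ_measure: "space (occ_measure \<gamma>) = S \<times> A"
  by (simp_all add: occ_measure_def space_pair_measure)

lemma occ_int_functional:
  assumes \<gamma>: "prob_space \<gamma>" "sets \<gamma> = sets MS"
  shows "integral_functional (MS \<Otimes>\<^sub>M MA) (\<lambda>g. occ_int \<gamma> (\<lambda>x a. g (x, a)))"
  unfolding occ_int_def stage_int_def
proof (intro integral_functional_suminf integral_functional_nn_integral integral_functional_scale)
  note [measurable_cong] = sets_strat[OF \<gamma>]
  fix n \<omega> assume \<omega>: "\<omega> \<in> space (Pstrat S q pol \<gamma>)"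
  then have h: "hist n \<omega> \<in> space (OmegaM S)" by (simp add: space_strat[OF \<gamma>] hist_space)
  note [measurable] = measurable_const[OF h]
  show "integral_functional (MS \<Otimes>\<^sub>M MA) (\<lambda>g. act_int n (hist n \<omega>) s (\<lambda>x a. g (x, a)))" for s :: real
    unfolding act_int_def
  proof (intro integral_functional_if integral_functional_zero integral_functional_nn_integral integral_functional_eval)
    show "a \<in> space (pol n (hist n \<omega>) s) \<Longrightarrow> (pick S (fst (hist n \<omega> n)), a) \<in> space (MS \<Otimes>\<^sub>M MA)" for a
      using pick_nth_space[OF h, of n] by (simp add: pol_space[OF h] space_pair_measure)
    fix g :: "'s \<times> 'a \<Rightarrow> ennreal" assume g: "g \<in> borel_measurable (MS \<Otimes>\<^sub>M MA)"
    have "Pair (pick S (fst (hist n \<omega> n))) \<in> measurable MA (MS \<Otimes>\<^sub>M MA)"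
      using pick_nth_space[OF h, of n] by simp
    from measurable_compose[OF this g]
    show "(\<lambda>a. g (pick S (fst (hist n \<omega> n)), a)) \<in> borel_measurable (pol n (hist n \<omega>) s)"
      by (simp cong: measurable_cong_sets add: pol_space[OF h])
  qed
  show "(\<lambda>s. indicator {0<..} s * survival n (hist n \<omega>) s * act_int n (hist n \<omega>) s (\<lambda>x a. g (x, a))) \<in> borel_measurable lborel"
    if [measurable]: "g \<in> borel_measurable (MS \<Otimes>\<^sub>M MA)" for g
    by measurable
next
  note [measurable_cong] = sets_strat[OF \<gamma>]
  fix n and g :: "'s \<times> 'a \<Rightarrow> ennreal" assume [measurable]: "g \<in> borel_measurable (MS \<Otimes>\<^sub>M MA)"
  show "(\<lambda>\<omega>. \<integral>\<^sup>+s. indicator {0<..} s * survival n (hist n \<omega>) s * act_int n (hist n \<omega>) s (\<lambda>x a. g (x, a)) \<partial>lborel) \<in> borel_measurable (Pstrat S q pol \<gamma>)"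
    by measurable
qed

lemma nn_integral_occ_measure:
  assumes "prob_space \<gamma>" "sets \<gamma> = sets MS" "g \<in> borel_measurable (MS \<Otimes>\<^sub>M MA)"
  shows "(\<integral>\<^sup>+z. g z \<partial>occ_measure \<gamma>) = occ_int \<gamma> (\<lambda>x a. g (x, a))"
  unfolding occ_measure_def
  by (rule nn_integral_functional_measure[OF occ_int_functional[OF assms(1,2)] assms(3)])

lemma Ecost_eq_nn_integral:
  assumes \<gamma>: "prob_space \<gamma>" "sets \<gamma> = sets MS"
    and c: "(\<lambda>(x, a). c x a) \<in> borel_measurable (MS \<Otimes>\<^sub>M MA)"
  shows "Ecost S q pol \<gamma> c = (\<integral>\<^sup>+(x, a). ennreal (c x a) \<partial>occ_measure \<gamma>)"
proof -
  have [measurable]: "(\<lambda>(x, a). ennreal (c x a)) \<in> borel_measurable (MS \<Otimes>\<^sub>M MA)"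
    using measurable_compose[OF c measurable_ennreal] by (simp add: split_beta')
  show ?thesis
    by (subst nn_integral_occ_measure[OF \<gamma>]) (auto intro!: Ecost_eq_occ_int[OF \<gamma>])
qed

lemma state_int_mono:
  assumes "\<And>x. x \<in> S \<Longrightarrow> f x \<le> g x" and \<gamma>: "prob_space \<gamma>" "sets \<gamma> = sets MS"
  shows "state_int \<gamma> n f \<le> state_int \<gamma> n g"
  unfolding state_int_def
proof (rule nn_integral_mono)
  fix \<omega> assume "\<omega> \<in> space (Pstrat S q pol \<gamma>)"
  then show "(if fst (\<omega> n) = None then 0 else f (pick S (fst (\<omega> n)))) \<le> (if fst (\<omega> n) = None then 0 else g (pick S (fst (\<omega> n))))"
    using assms(1)[OF pick_nth_space[of \<omega> n]] by (simp add: space_strat[OF \<gamma>])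
qed

end

section \<open>Stationary policies and their embedded chain\<close>

locale ctmdp_stationary = ctmdp S A q
  for S :: "'s::polish_space set" and A :: "'a::polish_space set" and q +
  fixes \<phi> :: "'s \<Rightarrow> 'a measure"
  assumes kernel: "stat_kernel S A \<phi>"
begin

lemma kernel_measurable[measurable]: "\<phi> \<in> measurable MS (prob_algebra MA)" "\<phi> \<in> measurable MS (subprob_algebra MA)"
  using kernel by (auto simp: stat_kernel_def intro: measurable_prob_algebraD)

lemma kernel_space:
  assumes "x \<in> S"
  shows "prob_space (\<phi> x)" "sets (\<phi> x) = sets MA" "space (\<phi> x) = A"
proof -
  have "\<phi> x \<in> space (prob_algebra MA)" using measurable_space[OF kernel_measurable(1), of x] assms by simp
  then show "prob_space (\<phi> x)" "sets (\<phi> x) = sets MA" by (simp_all add: space_prob_algebra)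
  then show "space (\<phi> x) = A" using sets_eq_imp_space_eq[of "\<phi> x" MA] by simp
qed

lemma stat_pol_eq: "stat_pol S \<phi> n h s = \<phi> (pick S (fst (h n)))"
  by (simp add: stat_pol_def pick_def)

sublocale ctmdp_policy S A q "stat_pol S \<phi>"
proof
  have "(\<lambda>(h, s :: real). \<phi> (pick S (fst (h n)))) \<in> measurable (OmegaM S \<Otimes>\<^sub>M borel) (prob_algebra MA)" for n
    by measurable
  then show "is_policy S A (stat_pol S \<phi>)"
    unfolding is_policy_def stat_pol_eq by simp
qed

definition exit_rate :: "'s \<Rightarrow> ennreal" where
  "exit_rate x = (\<integral>\<^sup>+a. ennreal (qx q x a) \<partial>\<phi> x)"

text \<open>The mean cost of a sojourn: mean holding time times cost rate. At exit rate 0 it is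
  infinite unless the cost rate is 0 as well.\<close>

definition sojourn_val :: "('s \<Rightarrow> 'a \<Rightarrow> ennreal) \<Rightarrow> 's \<Rightarrow> ennreal" where
  "sojourn_val F x = inverse (exit_rate x) * (\<integral>\<^sup>+a. F x a \<partial>\<phi> x)"

text \<open>The transition operator of the embedded chain. At an absorbing state the integral of
  \<open>qt_int f\<close> is 0, so \<open>embed f\<close> is 0 there: the chain counts as killed,
  not as staying.\<close>

definition embed :: "('s \<Rightarrow> ennreal) \<Rightarrow> 's \<Rightarrow> ennreal" where
  "embed f = sojourn_val (qt_int f)"

lemma kernel_integral_measurable:
  assumes "(\<lambda>(x, a). F x a) \<in> borel_measurable (MS \<Otimes>\<^sub>M MA)"
  shows "(\<lambda>x. \<integral>\<^sup>+a. F x a \<partial>\<phi> x) \<in> borel_measurable MS"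
  using assms by (rule nn_integral_measurable_subprob_algebra2) measurable

lemma exit_rate_measurable[measurable]: "exit_rate \<in> borel_measurable MS"
  unfolding exit_rate_def[abs_def] by (rule kernel_integral_measurable) measurable

lemma sojourn_val_measurable:
  assumes "(\<lambda>(x, a). F x a) \<in> borel_measurable (MS \<Otimes>\<^sub>M MA)"
  shows "sojourn_val F \<in> borel_measurable MS"
  unfolding sojourn_val_def[abs_def] using kernel_integral_measurable[OF assms, measurable] by measurable

lemma qt_int_pair_measurable[measurable]:
  assumes [measurable]: "f \<in> borel_measurable MS"
  shows "(\<lambda>(x, a). qt_int f x a) \<in> borel_measurable (MS \<Otimes>\<^sub>M MA)"
  by measurable

lemma embed_measurable[measurable]: "f \<in> borel_measurable MS \<Longrightarrow> embed f \<in> borel_measurable MS"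
  unfolding embed_def by (rule sojourn_val_measurable) measurable

lemma exit_rate_finite: "x \<in> S \<Longrightarrow> exit_rate x < \<infinity>"
proof -
  assume x: "x \<in> S"
  obtain C where C: "\<forall>a\<in>A. qx q x a \<le> C" using qx_bounded[OF x] by blast
  interpret prob_space "\<phi> x" by (rule kernel_space[OF x])
  have "exit_rate x \<le> (\<integral>\<^sup>+a. ennreal C \<partial>\<phi> x)"
    unfolding exit_rate_def using C by (intro nn_integral_mono ennreal_leI) (simp add: kernel_space[OF x])
  also have "\<dots> < \<infinity>" by (simp add: emeasure_space_1)
  finally show ?thesis .
qed

text \<open>A finite exit rate has a nonzero inverse, so the holding-time factor cannot hide a
  positive cost.\<close>

lemma sojourn_val_eq_0_iff: "x \<in> S \<Longrightarrow> sojourn_val F x = 0 \<longleftrightarrow> (\<integral>\<^sup>+a. F x a \<partial>\<phi> x) = 0"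
  using exit_rate_finite[of x] by (auto simp: sojourn_val_def)

lemma exit_rate_sojourn_val_le: "exit_rate x * sojourn_val F x \<le> (\<integral>\<^sup>+a. F x a \<partial>\<phi> x)"
  using mult_right_mono[OF ennreal_mult_inverse_le_one[of "exit_rate x"], of "\<integral>\<^sup>+a. F x a \<partial>\<phi> x"]
  by (simp add: sojourn_val_def mult.assoc)

text \<open>The rate is constant during a sojourn, so survival is exponential and integrates to the
  inverse of the exit rate.\<close>

lemma stage_int_stationary:
  assumes \<gamma>: "prob_space \<gamma>" "sets \<gamma> = sets MS"
  shows "stage_int \<gamma> n F = state_int \<gamma> n (sojourn_val F)"
  unfolding stage_int_def state_int_def
proof (rule nn_integral_cong)
  fix \<omega> assume \<omega>: "\<omega> \<in> space (Pstrat S q (stat_pol S \<phi>) \<gamma>)"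
  let ?h = "hist n \<omega>" and ?x = "pick S (fst (\<omega> n))"
  have h: "?h \<in> space (OmegaM S)" using \<omega> by (simp add: space_strat[OF \<gamma>] hist_space)
  note [measurable] = measurable_const[OF h]
  show "(\<integral>\<^sup>+s. indicator {0<..} s * survival n ?h s * act_int n ?h s F \<partial>lborel)
    = (if fst (\<omega> n) = None then 0 else sojourn_val F ?x)"
  proof (cases "fst (\<omega> n) = None")
    case nN: False
    define r where "r = jump_rate n ?h 0"
    have r: "jump_rate n ?h s = r" for s by (simp add: r_def jump_rate_def stat_pol_eq)
    have "survival n ?h s = ennreal (exp (- (r * s)))" if "0 \<le> s" for s
      using that by (simp add: survival_def r set_lebesgue_integral_def mult.commute)
    then have "(\<integral>\<^sup>+s. indicator {0<..} s * survival n ?h s * act_int n ?h s F \<partial>lborel)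
      = (\<integral>\<^sup>+s. (indicator {0<..} s * ennreal (exp (- (r * s)))) * (\<integral>\<^sup>+a. F ?x a \<partial>\<phi> ?x) \<partial>lborel)"
      by (intro nn_integral_cong) (auto simp: nN act_int_def stat_pol_eq indicator_def simp del: not_None_eq)
    also have "\<dots> = (\<integral>\<^sup>+s. indicator {0<..} s * ennreal (exp (- (r * s))) \<partial>lborel) * (\<integral>\<^sup>+a. F ?x a \<partial>\<phi> ?x)"
      by (rule nn_integral_multc) measurable
    also have "\<dots> = inverse (ennreal r) * (\<integral>\<^sup>+a. F ?x a \<partial>\<phi> ?x)"
      by (simp add: nn_integral_exp_decay jump_rate_eq(2)[OF h] r_def)
    also have "ennreal r = exit_rate ?x"
      by (simp add: nN r_def jump_rate_eq(1)[OF h] act_int_def exit_rate_def stat_pol_eq)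
    finally show ?thesis by (simp add: nN sojourn_val_def)
  qed (simp add: act_int_def)
qed

lemma occ_int_stationary:
  assumes \<gamma>: "prob_space \<gamma>" "sets \<gamma> = sets MS"
  shows "occ_int \<gamma> F = (\<Sum>n. state_int \<gamma> n (sojourn_val F))"
  by (simp add: occ_int_def stage_int_stationary[OF \<gamma>])

lemma state_int_Suc_stationary:
  assumes \<gamma>: "prob_space \<gamma>" "sets \<gamma> = sets MS" and f: "f \<in> borel_measurable MS"
  shows "state_int \<gamma> (Suc n) f = state_int \<gamma> n (embed f)"
  by (simp add: state_int_Suc[OF \<gamma> f] stage_int_stationary[OF \<gamma>] embed_def)

lemma embed_funpow_measurable[measurable]: "f \<in> borel_measurable MS \<Longrightarrow> (embed ^^ n) f \<in> borel_measurable MS"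
  by (induction n) auto

lemma state_int_funpow:
  assumes \<gamma>: "prob_space \<gamma>" "sets \<gamma> = sets MS" and "f \<in> borel_measurable MS"
  shows "state_int \<gamma> n f = (\<integral>\<^sup>+x. (embed ^^ n) f x \<partial>\<gamma>)"
  using assms(3)
proof (induction n arbitrary: f)
  case 0
  then show ?case by (simp add: state_int_0[OF \<gamma>])
next
  case (Suc n)
  then show ?case by (simp add: state_int_Suc_stationary[OF \<gamma>] funpow_swap1)
qed

text \<open>The potential series of the embedded chain, that is, the expected total cost from a
  fixed initial state. In this form its measurability in the state and its one-step recursion are
  accessible.\<close>

definition total_val :: "('s \<Rightarrow> 'a \<Rightarrow> ennreal) \<Rightarrow> 's \<Rightarrow> ennreal" where
  "total_val F x = (\<Sum>n. (embed ^^ n) (sojourn_val F) x)"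

lemma total_val_measurable:
  assumes "(\<lambda>(x, a). F x a) \<in> borel_measurable (MS \<Otimes>\<^sub>M MA)"
  shows "total_val F \<in> borel_measurable MS"
  unfolding total_val_def[abs_def] using sojourn_val_measurable[OF assms, measurable] by measurable

lemma Ecost_return:
  assumes F: "(\<lambda>(x, a). F x a) \<in> borel_measurable (MS \<Otimes>\<^sub>M MA)"
    and c: "\<And>x a. x \<in> S \<Longrightarrow> F x a = ennreal (c x a)" and x: "x \<in> S"
  shows "Ecost S q (stat_pol S \<phi>) (return MS x) c = total_val F x"
proof -
  have \<gamma>: "prob_space (return MS x)" "sets (return MS x) = sets MS"
    using x by (auto intro: prob_space_return)
  show ?thesis
    using x sojourn_val_measurable[OF F]
    by (simp add: Ecost_eq_occ_int[OF \<gamma> F c] occ_int_stationary[OF \<gamma>] state_int_funpow[OF \<gamma>] total_val_def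
        nn_integral_return)
qed

lemma embed_suminf:
  assumes g: "\<And>n. g n \<in> borel_measurable MS" and x: "x \<in> S"
  shows "embed (\<lambda>y. \<Sum>n. g n y) x = (\<Sum>n. embed (g n) x)"
proof -
  have m: "(\<lambda>a. qt_int (g n) x a) \<in> borel_measurable (\<phi> x)" for n
    using measurable_compose[OF _ qt_int_pair_measurable[OF g], of "Pair x" MA n] x
    by (simp cong: measurable_cong_sets add: kernel_space[OF x])
  have "qt_int (\<lambda>y. \<Sum>n. g n y) x a = (\<Sum>n. qt_int (g n) x a)" for a
    unfolding qt_int_def by (rule nn_integral_suminf) (use g in measurable)
  then show ?thesis
    by (simp add: embed_def sojourn_val_def nn_integral_suminf[OF m] ennreal_suminf_cmult)
qed

text \<open>If the series is 0, so is every term. Applying \<open>embed\<close> to the series shifts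
  its index by one and yields a sum of the same terms.\<close>

lemma total_val_eq_0D:
  assumes F: "(\<lambda>(x, a). F x a) \<in> borel_measurable (MS \<Otimes>\<^sub>M MA)" and x: "x \<in> S"
    and 0: "total_val F x = 0"
  shows "sojourn_val F x = 0" "embed (total_val F) x = 0"
proof -
  have z: "(embed ^^ n) (sojourn_val F) x = 0" for n
    using 0 unfolding total_val_def by (simp add: suminf_eq_zero_iff)
  show "sojourn_val F x = 0" using z[of 0] by simp
  have "embed (total_val F) x = (\<Sum>n. embed ((embed ^^ n) (sojourn_val F)) x)"
    unfolding total_val_def[abs_def]
    by (rule embed_suminf[OF _ x]) (use sojourn_val_measurable[OF F] in auto)
  also have "\<dots> = 0" using z[of "Suc _"] by simp
  finally show "embed (total_val F) x = 0" .
qed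

text \<open>The flow inequality \<open>flow\<close> says that the process under \<open>pol\<close> a.s. leaves every state
  of \<open>Z\<close> in finite time; it is the only place where finiteness of the costs enters.\<close>

lemma stationary_improves:
  assumes pol: "is_policy S A pol" and \<gamma>: "prob_space \<gamma>" "sets \<gamma> = sets MS"
    and Z: "Z \<in> sets MS" and sets_\<nu>: "sets \<nu> = sets MS"
    and disint: "\<And>\<Gamma>. \<Gamma> \<in> sets (MS \<Otimes>\<^sub>M MA) \<Longrightarrow> \<Gamma> \<subseteq> Z \<times> A \<Longrightarrow>
      emeasure (ctmdp_policy.occ_measure S A q pol \<gamma>) \<Gamma> = (\<integral>\<^sup>+x. emeasure (\<phi> x) (Pair x -` \<Gamma>) \<partial>\<nu>)"
    and flow: "\<And>f. f \<in> borel_measurable MS \<Longrightarrow> (\<And>x. x \<in> S - Z \<Longrightarrow> f x = 0) \<Longrightarrow>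
      (\<Sum>n. ctmdp_policy.state_int S q pol \<gamma> n f) \<le> ctmdp_policy.occ_int S q pol \<gamma> (\<lambda>x a. f x * ennreal (qx q x a))"
    and closed: "\<And>f x. f \<in> borel_measurable MS \<Longrightarrow> (\<And>y. y \<in> S - Z \<Longrightarrow> f y = 0) \<Longrightarrow> x \<in> S - Z \<Longrightarrow> embed f x = 0"
    and F: "(\<lambda>(x, a). F x a) \<in> borel_measurable (MS \<Otimes>\<^sub>M MA)"
    and F0: "\<And>x. x \<in> S - Z \<Longrightarrow> sojourn_val F x = 0"
  shows "occ_int \<gamma> F \<le> ctmdp_policy.occ_int S q pol \<gamma> F"
proof -
  interpret P: ctmdp_policy S A q pol by unfold_locales (rule pol)
  note [measurable] = Z F
  note [measurable_cong] = sets_\<nu>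
  have space_\<nu>: "space \<nu> = S" using sets_eq_imp_space_eq[OF sets_\<nu>] by simp
  define m where "m f = (\<Sum>n. P.state_int \<gamma> n f)" for f
  let ?M = "MS \<Otimes>\<^sub>M MA"
  have ZA[measurable]: "Z \<times> A \<in> sets ?M"
    using Z sets.top[of MA] by (intro pair_measureI) auto
  \<comment> \<open>The disintegration is known for sets inside \<open>Z \<times> A\<close>. To
    integrate functions, both sides are made into measures, the right one as the mixture over \<nu>
    of the laws of \<open>(x, a)\<close> with \<open>a\<close> drawn from
    \<open>\<phi> x\<close>.\<close>
  have occ: "P.occ_int \<gamma> (\<lambda>x a. indicator Z x * G x a) = (\<integral>\<^sup>+x. indicator Z x * (\<integral>\<^sup>+a. G x a \<partial>\<phi> x) \<partial>\<nu>)"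
    if [measurable]: "(\<lambda>(x, a). G x a) \<in> borel_measurable ?M" for G
  proof -
    let ?K = "\<lambda>x. distr (\<phi> x) ?M (Pair x)"
    have K[measurable]: "?K \<in> measurable (density \<nu> (indicator Z)) (subprob_algebra ?M)"
    proof -
      have "?K \<in> measurable MS (subprob_algebra ?M)"
        by (rule measurable_distr2[OF _ kernel_measurable(2)]) measurable
      then show ?thesis by (simp cong: measurable_cong_sets add: sets_\<nu>)
    qed
    have eq: "density (P.occ_measure \<gamma>) (indicator (Z \<times> A)) = density \<nu> (indicator Z) \<bind> ?K"
    proof (rule measure_eqI)
      have ne: "space (density \<nu> (indicator Z)) \<noteq> {}" using S_nonempty by (simp add: space_\<nu>)
      show "sets (density (P.occ_measure \<gamma>) (indicator (Z \<times> A))) = sets (density \<nu> (indicator Z) \<bind> ?K)"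
        using ne by (subst sets_bind[of _ _ ?M]) auto
      fix \<Gamma> assume "\<Gamma> \<in> sets (density (P.occ_measure \<gamma>) (indicator (Z \<times> A)))"
      then have \<Gamma>[measurable]: "\<Gamma> \<in> sets ?M" by simp
      have "emeasure (density (P.occ_measure \<gamma>) (indicator (Z \<times> A))) \<Gamma> = emeasure (P.occ_measure \<gamma>) (\<Gamma> \<inter> Z \<times> A)"
        by (subst emeasure_density) (auto simp: indicator_inter_arith[symmetric] Int_commute)
      also have "\<dots> = (\<integral>\<^sup>+x. emeasure (\<phi> x) (Pair x -` (\<Gamma> \<inter> Z \<times> A)) \<partial>\<nu>)"
        by (rule disint) auto
      also have "\<dots> = (\<integral>\<^sup>+x. indicator Z x * emeasure (?K x) \<Gamma> \<partial>\<nu>)"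
      proof (rule nn_integral_cong)
        fix x assume "x \<in> space \<nu>"
        then have x: "x \<in> S" by (simp add: space_\<nu>)
        have "Pair x \<in> measurable (\<phi> x) ?M"
          using x by (simp cong: measurable_cong_sets add: kernel_space[OF x])
        then have "emeasure (?K x) \<Gamma> = emeasure (\<phi> x) (Pair x -` \<Gamma> \<inter> A)"
          by (subst emeasure_distr) (auto simp: kernel_space[OF x])
        moreover have "Pair x -` (\<Gamma> \<inter> Z \<times> A) = (if x \<in> Z then Pair x -` \<Gamma> \<inter> A else {})" by auto
        ultimately show "emeasure (\<phi> x) (Pair x -` (\<Gamma> \<inter> Z \<times> A)) = indicator Z x * emeasure (?K x) \<Gamma>" by simp
      qed
      also have "\<dots> = (\<integral>\<^sup>+x. emeasure (?K x) \<Gamma> \<partial>density \<nu> (indicator Z))"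
        by (subst nn_integral_density) (auto intro!: measurable_compose[OF K measurable_emeasure_subprob_algebra[OF \<Gamma>], simplified])
      also have "\<dots> = emeasure (density \<nu> (indicator Z) \<bind> ?K) \<Gamma>"
        by (rule emeasure_bind[OF ne K \<Gamma>, symmetric])
      finally show "emeasure (density (P.occ_measure \<gamma>) (indicator (Z \<times> A))) \<Gamma> = emeasure (density \<nu> (indicator Z) \<bind> ?K) \<Gamma>" .
    qed
    have G[measurable]: "(\<lambda>z. G (fst z) (snd z)) \<in> borel_measurable ?M" using that by (simp add: split_beta')
    have "P.occ_int \<gamma> (\<lambda>x a. indicator Z x * G x a) = (\<integral>\<^sup>+z. indicator Z (fst z) * G (fst z) (snd z) \<partial>P.occ_measure \<gamma>)"
      by (subst P.nn_integral_occ_measure[OF \<gamma>]) auto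
    also have "\<dots> = (\<integral>\<^sup>+z. indicator (Z \<times> A) z * G (fst z) (snd z) \<partial>P.occ_measure \<gamma>)"
      by (intro nn_integral_cong) (auto simp: P.space_occ_measure indicator_def)
    also have "\<dots> = (\<integral>\<^sup>+z. G (fst z) (snd z) \<partial>density (P.occ_measure \<gamma>) (indicator (Z \<times> A)))"
      by (subst nn_integral_density) auto
    also have "\<dots> = (\<integral>\<^sup>+x. (\<integral>\<^sup>+z. G (fst z) (snd z) \<partial>?K x) \<partial>density \<nu> (indicator Z))"
      unfolding eq by (rule nn_integral_bind[OF G K])
    also have "\<dots> = (\<integral>\<^sup>+x. indicator Z x * (\<integral>\<^sup>+z. G (fst z) (snd z) \<partial>?K x) \<partial>\<nu>)"
      by (rule nn_integral_density)
        (auto intro!: measurable_compose[OF K nn_integral_measurable_subprob_algebra[OF G], simplified])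
    also have "\<dots> = (\<integral>\<^sup>+x. indicator Z x * (\<integral>\<^sup>+a. G x a \<partial>\<phi> x) \<partial>\<nu>)"
    proof (rule nn_integral_cong)
      fix x assume "x \<in> space \<nu>"
      then have x: "x \<in> S" by (simp add: space_\<nu>)
      have P: "Pair x \<in> measurable (\<phi> x) ?M"
        using x by (simp cong: measurable_cong_sets add: kernel_space[OF x])
      have "(\<integral>\<^sup>+z. G (fst z) (snd z) \<partial>?K x) = (\<integral>\<^sup>+a. G (fst (x, a)) (snd (x, a)) \<partial>\<phi> x)"
        by (rule nn_integral_distr[OF P]) (simp only: measurable_distr_eq1 G)
      then show "indicator Z x * (\<integral>\<^sup>+z. G (fst z) (snd z) \<partial>?K x) = indicator Z x * (\<integral>\<^sup>+a. G x a \<partial>\<phi> x)"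
        by (simp only: fst_conv snd_conv)
    qed
    finally show ?thesis .
  qed
  have occ_mono: "P.occ_int \<gamma> (\<lambda>x a. indicator Z x * G x a) \<le> P.occ_int \<gamma> G"
    if G[measurable]: "(\<lambda>(x, a). G x a) \<in> borel_measurable ?M" for G
  proof -
    have [measurable]: "(\<lambda>z. G (fst z) (snd z)) \<in> borel_measurable ?M" using that by (simp add: split_beta')
    have "(\<integral>\<^sup>+z. indicator Z (fst z) * G (fst z) (snd z) \<partial>P.occ_measure \<gamma>) \<le> (\<integral>\<^sup>+z. G (fst z) (snd z) \<partial>P.occ_measure \<gamma>)"
      by (intro nn_integral_mono) (auto simp: indicator_def)
    then show ?thesis
      using P.nn_integral_occ_measure[OF \<gamma>, of "\<lambda>z. indicator Z (fst z) * G (fst z) (snd z)"]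
        P.nn_integral_occ_measure[OF \<gamma>, of "\<lambda>z. G (fst z) (snd z)"] by simp
  qed
  \<comment> \<open>\<open>flow\<close> turns visits into an integral of the exit rate against the
    occupation measure. Disintegration averages that rate to \<open>exit_rate\<close>, which cancels
    against the mean holding time inside \<open>sojourn_val\<close>.\<close>
  have flow': "m (sojourn_val G) \<le> P.occ_int \<gamma> G"
    if G[measurable]: "(\<lambda>(x, a). G x a) \<in> borel_measurable ?M" and G0: "\<And>x. x \<in> S - Z \<Longrightarrow> sojourn_val G x = 0" for G
  proof -
    note [measurable] = sojourn_val_measurable[OF G]
    define g where "g x = indicator Z x * sojourn_val G x" for x
    have [measurable]: "g \<in> borel_measurable MS" unfolding g_def by measurable
    have "m (sojourn_val G) \<le> m g"
      unfolding m_def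
    proof (intro suminf_le P.state_int_mono \<gamma>)
      show "sojourn_val G x \<le> g x" if "x \<in> S" for x
        using G0[of x] that by (cases "x \<in> Z") (auto simp: g_def)
    qed auto
    also have "\<dots> \<le> P.occ_int \<gamma> (\<lambda>x a. g x * ennreal (qx q x a))"
      unfolding m_def by (rule flow) (auto simp: g_def)
    also have "\<dots> = P.occ_int \<gamma> (\<lambda>x a. indicator Z x * (sojourn_val G x * ennreal (qx q x a)))"
      by (simp add: g_def mult.assoc)
    also have "\<dots> = (\<integral>\<^sup>+x. indicator Z x * (\<integral>\<^sup>+a. sojourn_val G x * ennreal (qx q x a) \<partial>\<phi> x) \<partial>\<nu>)"
      by (rule occ) measurable
    also have "\<dots> \<le> (\<integral>\<^sup>+x. indicator Z x * (\<integral>\<^sup>+a. G x a \<partial>\<phi> x) \<partial>\<nu>)"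
    proof (rule nn_integral_mono, rule mult_left_mono)
      fix x assume "x \<in> space \<nu>"
      then have x: "x \<in> S" by (simp add: space_\<nu>)
      have "(\<lambda>a. ennreal (qx q x a)) \<in> borel_measurable MA"
        using qx_measurable'[OF measurable_const measurable_ident, of x] x by simp
      then have "(\<lambda>a. ennreal (qx q x a)) \<in> borel_measurable (\<phi> x)"
        by (simp cong: measurable_cong_sets add: kernel_space[OF x])
      then have "(\<integral>\<^sup>+a. sojourn_val G x * ennreal (qx q x a) \<partial>\<phi> x) = sojourn_val G x * exit_rate x"
        unfolding exit_rate_def by (rule nn_integral_cmult)
      then show "(\<integral>\<^sup>+a. sojourn_val G x * ennreal (qx q x a) \<partial>\<phi> x) \<le> (\<integral>\<^sup>+a. G x a \<partial>\<phi> x)"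
        using exit_rate_sojourn_val_le[of x G] by (simp add: mult.commute)
    qed simp
    also have "\<dots> = P.occ_int \<gamma> (\<lambda>x a. indicator Z x * G x a)" by (rule occ[symmetric]) measurable
    also have "\<dots> \<le> P.occ_int \<gamma> G" by (rule occ_mono) measurable
    finally show ?thesis .
  qed
  \<comment> \<open>The balance equation for \<open>pol\<close> is exact; bounding its flow term
    below by \<open>flow'\<close> with \<open>G = qt_int f\<close> brings in the embedded chain of
    \<phi>.\<close>
  have step: "(\<integral>\<^sup>+x. f x \<partial>\<gamma>) + m (embed f) \<le> m f"
    if f[measurable]: "f \<in> borel_measurable MS" and f0: "\<And>x. x \<in> S - Z \<Longrightarrow> f x = 0" for f
  proof -
    have "m (embed f) \<le> P.occ_int \<gamma> (qt_int f)"
      unfolding embed_def by (rule flow') (use closed[OF f f0] in \<open>auto simp: embed_def[symmetric]\<close>)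
    then show ?thesis unfolding m_def P.state_sum_eq[OF \<gamma> f] by (rule add_left_mono)
  qed
  \<comment> \<open>The inequality \<open>step\<close>, iterated. The function must vary, since each
    round replaces \<open>f\<close> by \<open>embed f\<close>, which again vanishes off
    \<open>Z\<close> by \<open>closed\<close>. Partial sums leave no remainder term to
    control.\<close>
  have part: "(\<Sum>k<n. state_int \<gamma> k f) \<le> m f"
    if "f \<in> borel_measurable MS" "\<And>x. x \<in> S - Z \<Longrightarrow> f x = 0" for f n
    using that
  proof (induction n arbitrary: f)
    case (Suc n)
    have "(\<Sum>k<Suc n. state_int \<gamma> k f) = (\<integral>\<^sup>+x. f x \<partial>\<gamma>) + (\<Sum>k<n. state_int \<gamma> k (embed f))"
      by (simp add: sum.lessThan_Suc_shift state_int_0[OF \<gamma> Suc.prems(1)] state_int_Suc_stationary[OF \<gamma> Suc.prems(1)]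
          del: sum.lessThan_Suc)
    also have "\<dots> \<le> (\<integral>\<^sup>+x. f x \<partial>\<gamma>) + m (embed f)"
      using closed[OF Suc.prems] Suc.prems by (intro add_left_mono Suc.IH) auto
    also have "\<dots> \<le> m f" by (rule step[OF Suc.prems])
    finally show ?case .
  qed simp
  have "occ_int \<gamma> F = (SUP n. \<Sum>k<n. state_int \<gamma> k (sojourn_val F))"
    by (simp add: occ_int_stationary[OF \<gamma>] suminf_eq_SUP)
  also have "\<dots> \<le> m (sojourn_val F)"
    by (intro SUP_least part sojourn_val_measurable F F0)
  also have "\<dots> \<le> P.occ_int \<gamma> F" by (rule flow'[OF F F0])
  finally show ?thesis .
qed

end

text \<open>The hypotheses of \<open>stationary_improves\<close> are supplied with
  \<open>zeta\<close> as \<open>Z\<close>. Measurability of \<open>zeta\<close> and closedness of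
  its complement come from the value function of \<open>psistar\<close>, the flow inequality from
  the definition of \<open>S2\<close> and the finite costs.\<close>

theorem theorem6p1:
  fixes S :: "'s::polish_space set" and A :: "'a::polish_space set"
    and q :: "'s \<Rightarrow> 'a \<Rightarrow> 's set \<Rightarrow> real" and \<gamma> :: "'s measure"
    and c :: "nat \<Rightarrow> 's \<Rightarrow> 'a \<Rightarrow> real" and d :: "nat \<Rightarrow> real" and N :: nat
    and fstar psistar :: "'s \<Rightarrow> 'a"
    and pol :: "('s,'a) policy" and \<phi> :: "'s \<Rightarrow> 'a measure"
  assumes S_borel: "S \<in> sets borel" and S_ne: "S \<noteq> {}"
    and A_borel: "A \<in> sets borel" and A_ne: "A \<noteq> {}"
    and model: "ctmdp_model S A q"
    and gamma: "prob_space \<gamma>" "sets \<gamma> = sets (restrict_space borel S)"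
    and c_meas: "\<forall>i\<le>N. (\<lambda>(x,a). c i x a) \<in> borel_measurable (restrict_space borel S \<Otimes>\<^sub>M restrict_space borel A)"
    and c_nonneg: "\<forall>i\<le>N. \<forall>x\<in>S. \<forall>a\<in>A. 0 \<le> c i x a"
    and d_nonneg: "\<forall>j\<in>{1..N}. 0 \<le> d j"
    and cond1: "condition1 S A q c N"
    and fstar: "fstar \<in> measurable (restrict_space borel S) (restrict_space borel A)"
      "\<forall>x\<in>S2 S A q c N. (\<Sum>i\<le>N. c i x (fstar x)) + qx q x (fstar x) = 0"
    and psistar: "psistar \<in> measurable (restrict_space borel S) (restrict_space borel A)"
      "\<forall>x\<in>S - zeta S A q c N.
         Ecost S q (stat_pol S (\<lambda>y. return (restrict_space borel A) (psistar y)))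
           (return (restrict_space borel S) x) (\<lambda>y a. \<Sum>i\<le>N. c i y a) = 0"
      "\<forall>x\<in>S2 S A q c N. psistar x = fstar x"
    and pol: "is_policy S A pol"
    and feasible: "\<forall>j\<in>{1..N}. Ecost S q pol \<gamma> (c j) \<le> ennreal (d j)"
    and finite_value: "Ecost S q pol \<gamma> (c 0) < \<infinity>"
    and pol_zeta_c: "\<forall>n. \<forall>h\<in>space (OmegaM S). \<forall>s>0. \<forall>x.
         fst (h n) = Some x \<longrightarrow> x \<in> S - zeta S A q c N \<longrightarrow>
         pol n h s = return (restrict_space borel A) (psistar x)"
    and phi: "stat_kernel S A \<phi>"
    and phi_disint: "\<forall>\<Gamma>\<in>sets (restrict_space borel S \<Otimes>\<^sub>M restrict_space borel A).
         \<Gamma> \<subseteq> zeta S A q c N \<times> A \<longrightarrow>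
         occ S q pol \<gamma> \<Gamma> = (\<integral>\<^sup>+x. emeasure (\<phi> x) (Pair x -` \<Gamma>) \<partial>(occ_marg S A q pol \<gamma>))"
    and phi_zeta_c: "\<forall>x\<in>S - zeta S A q c N. \<phi> x = return (restrict_space borel A) (psistar x)"
  shows "\<forall>i\<le>N. Ecost S q (stat_pol S \<phi>) \<gamma> (c i) \<le> Ecost S q pol \<gamma> (c i)"
proof (intro allI impI)
  fix i assume i: "i \<le> N"
  have qx_meas: "(\<lambda>(x, a). qx q x a) \<in> borel_measurable (restrict_space borel S \<Otimes>\<^sub>M restrict_space borel A)"
    using cond1 unfolding condition1_def by (intro continuous_on_measurable_restrict_pair) blast
  interpret ctmdp S A q by unfold_locales fact+
  interpret P: ctmdp_policy S A q pol by unfold_locales fact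
  interpret F: ctmdp_stationary S A q \<phi> by unfold_locales fact
  note psi_meas = psistar(1)
  have psi: "psistar x \<in> A" if "x \<in> S" for x
    using measurable_space[OF psi_meas, of x] that by simp
  let ?psi = "\<lambda>y. return MA (psistar y)"
  have "stat_kernel S A ?psi"
    unfolding stat_kernel_def using measurable_compose[OF psi_meas measurable_return_prob_space] .
  then interpret K: ctmdp_stationary S A q ?psi by unfold_locales
  let ?Z = "zeta S A q c N"
  define C where "C x a = ennreal (\<Sum>i\<le>N. c i x a)" for x a
  have c_meas'[measurable]: "(\<lambda>(x, a). c i x a) \<in> borel_measurable (MS \<Otimes>\<^sub>M MA)" if "i \<le> N" for i
    using c_meas that by blast
  have csum_meas: "(\<lambda>(x, a). \<Sum>i\<le>N. c i x a) \<in> borel_measurable (MS \<Otimes>\<^sub>M MA)"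
  proof -
    have "(\<lambda>z. \<Sum>i\<le>N. (\<lambda>(x, a). c i x a) z) \<in> borel_measurable (MS \<Otimes>\<^sub>M MA)"
      by (intro borel_measurable_sum c_meas') auto
    then show ?thesis by (simp add: split_beta')
  qed
  have C_meas: "(\<lambda>(x, a). C x a) \<in> borel_measurable (MS \<Otimes>\<^sub>M MA)"
    using measurable_compose[OF csum_meas measurable_ennreal] by (simp add: C_def split_beta')
  have csum_nonneg: "0 \<le> (\<Sum>i\<le>N. c i x a)" if "x \<in> S" "a \<in> A" for x a
    using c_nonneg that by (intro sum_nonneg) auto
  have W: "Ecost S q (stat_pol S ?psi) (return MS x) (\<lambda>y a. \<Sum>i\<le>N. c i y a) = K.total_val C x" if "x \<in> S" for x
    by (rule K.Ecost_return[OF C_meas _ that]) (simp add: C_def)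
  have det: "det_markov S A (stat_pol S ?psi)"
    unfolding det_markov_def
  proof (intro conjI allI ballI impI)
    fix n h and s :: real assume h: "h \<in> space (OmegaM S)"
    show "\<exists>a\<in>A. stat_pol S ?psi n h s = return MA a"
      using psi[OF P.pick_nth_space[OF h, of n]] by (auto simp: K.stat_pol_eq)
  qed (auto simp: K.policy K.stat_pol_eq)
  text \<open>Since \<open>psistar\<close> itself competes in the infimum defining \<open>zeta\<close>, it attains it off \<open>zeta\<close>.\<close>
  have zeta_iff: "x \<in> ?Z \<longleftrightarrow> K.total_val C x \<noteq> 0" if x: "x \<in> S" for x
  proof
    assume "x \<in> ?Z"
    then have "0 < (INF pol\<in>{pol. det_markov S A pol}. Ecost S q pol (return MS x) (\<lambda>y a. \<Sum>i\<le>N. c i y a))"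
      by (simp add: zeta_def)
    also have "\<dots> \<le> Ecost S q (stat_pol S ?psi) (return MS x) (\<lambda>y a. \<Sum>i\<le>N. c i y a)"
      by (rule INF_lower) (simp add: det)
    finally show "K.total_val C x \<noteq> 0" using W[OF x] by simp
  next
    assume "K.total_val C x \<noteq> 0"
    then show "x \<in> ?Z" using bspec[OF psistar(2), of x] W[OF x] x by auto
  qed
  have Z_sub: "?Z \<subseteq> S" by (auto simp: zeta_def)
  note [measurable] = K.total_val_measurable[OF C_meas]
  \<comment> \<open>\<open>zeta\<close> is defined by an infimum over a whole class of policies; it
    is measurable because the single value function \<open>K.total_val C\<close> decides
    membership.\<close>
  have Z_meas: "?Z \<in> sets MS"
  proof -
    have "?Z = {x \<in> space MS. K.total_val C x \<noteq> 0}" using zeta_iff Z_sub by auto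
    also have "\<dots> \<in> sets MS" by measurable
    finally show ?thesis .
  qed
  have return_int: "(\<integral>\<^sup>+a. G a \<partial>return MA (psistar x)) = G (psistar x)" if "x \<in> S" "G \<in> borel_measurable MA" for G x
    using psi[OF that(1)] that(2) by (simp add: nn_integral_return)
  have sec: "(\<lambda>a. G x a) \<in> borel_measurable MA" if "(\<lambda>(x, a). G x a) \<in> borel_measurable (MS \<Otimes>\<^sub>M MA)" "x \<in> S" for G :: "'s \<Rightarrow> 'a \<Rightarrow> ennreal" and x
    using measurable_compose[OF _ that(1), of "Pair x" MA] that(2) by simp
  \<comment> \<open>The value of \<open>psistar\<close> is a sum of nonnegative terms. If it is 0,
    the present cost is 0, and the rate kernel charges only states whose value is 0 too.\<close>
  have off: "c j x (psistar x) = 0" "qt_int (K.total_val C) x (psistar x) = 0" if "x \<in> S - ?Z" "j \<le> N" for x j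
  proof -
    have x: "x \<in> S" and 0: "K.total_val C x = 0" using that zeta_iff by auto
    note z = K.total_val_eq_0D[OF C_meas x 0]
    have "C x (psistar x) = 0"
      using z(1) return_int[OF x sec[OF C_meas x]] by (simp add: K.sojourn_val_eq_0_iff[OF x])
    then have "(\<Sum>i\<le>N. c i x (psistar x)) = 0"
      using csum_nonneg[OF x psi[OF x]] by (simp add: C_def)
    then show "c j x (psistar x) = 0"
      using that(2) c_nonneg x psi[OF x] by (subst (asm) sum_nonneg_eq_0_iff) auto
    show "qt_int (K.total_val C) x (psistar x) = 0"
      using z(2) return_int[OF x sec[OF K.qt_int_pair_measurable x]] K.total_val_measurable[OF C_meas]
      by (simp add: K.embed_def K.sojourn_val_eq_0_iff[OF x])
  qed
  \<comment> \<open>On \<open>S2\<close> the map \<open>psistar\<close> agrees with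
    \<open>fstar\<close>, under which neither costs nor jumps occur, so its value is 0.\<close>
  have S2_Z: "x \<notin> ?Z" if "x \<in> S2 S A q c N" for x
  proof -
    have x: "x \<in> S" using that by (simp add: S2_def)
    have "(\<Sum>i\<le>N. c i x (psistar x)) + qx q x (psistar x) = 0" using fstar(2) psistar(3) that by simp
    then have 0: "(\<Sum>i\<le>N. c i x (psistar x)) = 0" "qx q x (psistar x) = 0"
      using csum_nonneg[OF x psi[OF x]] qx_nonneg[OF x psi[OF x]] by auto
    have "(K.embed ^^ n) (K.sojourn_val C) x = 0" for n
    proof (cases n)
      case 0
      then show ?thesis
        using return_int[OF x sec[OF C_meas x]] \<open>(\<Sum>i\<le>N. c i x (psistar x)) = 0\<close>
        by (simp add: K.sojourn_val_eq_0_iff[OF x] C_def)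
    next
      case (Suc m)
      have [measurable]: "(K.embed ^^ m) (K.sojourn_val C) \<in> borel_measurable MS"
        using K.sojourn_val_measurable[OF C_meas] by measurable
      have "qt_int ((K.embed ^^ m) (K.sojourn_val C)) x (psistar x) = 0"
        using 0(2) by (subst qt_int_eq[OF x psi[OF x]]) auto
      then show ?thesis
        using Suc return_int[OF x sec[OF K.qt_int_pair_measurable x]]
        by (simp add: K.embed_def[of "(K.embed ^^ m) _"] K.sojourn_val_eq_0_iff[OF x])
    qed
    then show ?thesis using zeta_iff[OF x] by (simp add: K.total_val_def)
  qed
  \<comment> \<open>The witness is the infimum over the actions of rate plus total cost. It is
    nonnegative, and it differs from 0 because \<open>x\<close> is outside
    \<open>S2\<close>.\<close>
  have Z_pos: "\<exists>\<delta>>0. \<forall>a\<in>A. \<delta> \<le> ennreal (qx q x a) + C x a" if xZ: "x \<in> ?Z" for x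
  proof -
    have x: "x \<in> S" using xZ Z_sub by auto
    let ?g = "\<lambda>a. qx q x a + (\<Sum>i\<le>N. c i x a)"
    have nn: "0 \<le> ?g a" if "a \<in> A" for a using qx_nonneg[OF x that] csum_nonneg[OF x that] by simp
    have "(INF a\<in>A. ?g a) \<noteq> 0" using S2_Z[of x] xZ x by (auto simp: S2_def)
    moreover have "0 \<le> (INF a\<in>A. ?g a)" using A_ne nn by (intro cINF_greatest) auto
    ultimately have pos: "0 < (INF a\<in>A. ?g a)" by simp
    have "ennreal (INF a\<in>A. ?g a) \<le> ennreal (qx q x a) + C x a" if a: "a \<in> A" for a
    proof -
      have "(INF a\<in>A. ?g a) \<le> ?g a"
        using a nn by (intro cINF_lower bdd_belowI2[of _ 0]) auto
      then have "ennreal (INF a\<in>A. ?g a) \<le> ennreal (?g a)" by (rule ennreal_leI)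
      then show ?thesis using qx_nonneg[OF x a] csum_nonneg[OF x a] by (simp add: C_def)
    qed
    then show ?thesis using pos by (intro exI[of _ "ennreal (INF a\<in>A. ?g a)"]) auto
  qed
  \<comment> \<open>The constraints bound the costs with index at least 1, and the finite value
    bounds the cost with index 0.\<close>
  have fin: "P.occ_int \<gamma> C < \<infinity>"
  proof -
    have "P.occ_int \<gamma> C = (\<integral>\<^sup>+z. (\<lambda>(x, a). C x a) z \<partial>P.occ_measure \<gamma>)"
      by (subst P.nn_integral_occ_measure[OF gamma C_meas]) simp
    also have "\<dots> = (\<integral>\<^sup>+z. (\<Sum>j\<le>N. (\<lambda>(x, a). ennreal (c j x a)) z) \<partial>P.occ_measure \<gamma>)"
      using c_nonneg by (intro nn_integral_cong) (auto simp: C_def P.space_occ_measure intro!: sum_ennreal[symmetric])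
    also have "\<dots> = (\<Sum>j\<le>N. \<integral>\<^sup>+z. (\<lambda>(x, a). ennreal (c j x a)) z \<partial>P.occ_measure \<gamma>)"
    proof (rule nn_integral_sum)
      fix j assume "j \<in> {..N}"
      then show "(\<lambda>(x, a). ennreal (c j x a)) \<in> borel_measurable (P.occ_measure \<gamma>)"
        using measurable_compose[OF c_meas' measurable_ennreal, of j] by (simp add: split_beta' cong: measurable_cong_sets)
    qed
    also have "\<dots> = (\<Sum>j\<le>N. Ecost S q pol \<gamma> (c j))"
      by (intro sum.cong refl) (simp add: P.Ecost_eq_nn_integral[OF gamma c_meas'])
    also have "\<dots> < \<infinity>"
    proof -
      have "Ecost S q pol \<gamma> (c j) < \<infinity>" if "j \<le> N" for j
      proof (cases "j = 0")
        case False
        then have "Ecost S q pol \<gamma> (c j) \<le> ennreal (d j)" using feasible that by simp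
        then show ?thesis by (rule le_less_trans) simp
      qed (use finite_value in simp)
      then show ?thesis by simp
    qed
    finally show ?thesis .
  qed
  have c_enn: "(\<lambda>(x, a). ennreal (c i x a)) \<in> borel_measurable (MS \<Otimes>\<^sub>M MA)"
    using measurable_compose[OF c_meas'[OF i] measurable_ennreal] by (simp add: split_beta')
  have "F.occ_int \<gamma> (\<lambda>x a. ennreal (c i x a)) \<le> P.occ_int \<gamma> (\<lambda>x a. ennreal (c i x a))"
  proof (rule F.stationary_improves[OF pol gamma Z_meas _ _ _ _ c_enn])
    show "sets (occ_marg S A q pol \<gamma>) = sets MS"
      using sets.sigma_sets_eq[of MS] sets.space_closed[of MS] unfolding occ_marg_def by simp
  next
    fix \<Gamma> assume \<Gamma>: "\<Gamma> \<in> sets (MS \<Otimes>\<^sub>M MA)" "\<Gamma> \<subseteq> ?Z \<times> A"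
    have "(\<lambda>(x, a). indicator \<Gamma> (x, a) :: real) \<in> borel_measurable (MS \<Otimes>\<^sub>M MA)"
      using \<Gamma>(1) by simp
    then have "occ S q pol \<gamma> \<Gamma> = (\<integral>\<^sup>+(x, a). ennreal (indicator \<Gamma> (x, a)) \<partial>P.occ_measure \<gamma>)"
      unfolding occ_def by (rule P.Ecost_eq_nn_integral[OF gamma])
    also have "\<dots> = emeasure (P.occ_measure \<gamma>) \<Gamma>"
      using \<Gamma>(1) by (simp add: split_beta' ennreal_indicator)
    finally show "emeasure (P.occ_measure \<gamma>) \<Gamma> = (\<integral>\<^sup>+x. emeasure (\<phi> x) (Pair x -` \<Gamma>) \<partial>occ_marg S A q pol \<gamma>)"
      using phi_disint \<Gamma> by simp
  next
    fix f :: "'s \<Rightarrow> ennreal" assume f: "f \<in> borel_measurable MS" and f0: "\<And>x. x \<in> S - ?Z \<Longrightarrow> f x = 0"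
    show "(\<Sum>n. P.state_int \<gamma> n f) \<le> P.occ_int \<gamma> (\<lambda>x a. f x * ennreal (qx q x a))"
      by (rule P.state_sum_le_flow[where Z="?Z" and F=C]) (fact gamma C_meas fin Z_pos f f0)+
  next
    fix f :: "'s \<Rightarrow> ennreal" and x
    assume f[measurable]: "f \<in> borel_measurable MS" and f0: "\<And>y. y \<in> S - ?Z \<Longrightarrow> f y = 0" and x: "x \<in> S - ?Z"
    \<comment> \<open>From a state off \<open>zeta\<close> the rate kernel under
      \<open>psistar\<close> charges only states of value 0. These lie off \<open>zeta\<close>,
      where \<open>f\<close> vanishes; and off \<open>zeta\<close> the kernel \<phi> is
      \<open>psistar\<close>.\<close>
    have "(\<integral>\<^sup>+y. K.total_val C y \<partial>qt_meas S q x (psistar x)) = 0"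
      using off(2)[OF x, of 0] by (simp add: qt_int_def)
    then have "AE y in qt_meas S q x (psistar x). K.total_val C y = 0"
      by (subst (asm) nn_integral_0_iff_AE) auto
    then have "AE y in qt_meas S q x (psistar x). f y = 0"
      using AE_space[of "qt_meas S q x (psistar x)"] by eventually_elim (use f0 zeta_iff in auto)
    then have "qt_int f x (psistar x) = 0"
      unfolding qt_int_def by (subst nn_integral_0_iff_AE) auto
    then show "F.embed f x = 0"
      using x phi_zeta_c return_int[OF _ sec[OF K.qt_int_pair_measurable[OF f]], of x]
      by (simp add: F.embed_def F.sojourn_val_eq_0_iff)
  next
    fix x assume x: "x \<in> S - ?Z"
    then show "F.sojourn_val (\<lambda>x a. ennreal (c i x a)) x = 0"
      using phi_zeta_c return_int[OF _ sec[OF c_enn], of x] off(1)[OF x i]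
      by (simp add: F.sojourn_val_eq_0_iff)
  qed
  then show "Ecost S q (stat_pol S \<phi>) \<gamma> (c i) \<le> Ecost S q pol \<gamma> (c i)"
    using F.Ecost_eq_occ_int[OF gamma c_enn refl] P.Ecost_eq_occ_int[OF gamma c_enn refl] by simp
qed

end
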